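(* Let $K$ be an algebraically closed field with $\mathrm{char}\,K\neq 2$ and let $A$ be a finite-dimensional gr-basic superalgebra over $K$. Then there is a sub-superalgebra $S$ of $A$ such that $A=S\oplus J_{\mathbb Z_2}(A)$ (as super vector spaces).
   Context: A superalgebra is a $\mathbb Z_2$-graded associative unital $K$-algebra $A=A_{\bar0}\oplus A_{\bar1}$ with $A_gA_h\subseteq A_{g+h}$ ($\mathbb Z_2=\mathbb Z/2\mathbb Z$). A sub-superalgebra is a subalgebra $S$ which is a graded subspace, i.e. $S=(S\cap A_{\bar0})\oplus(S\cap A_{\bar1})$. Graded left modules $M=M_{\bar0}\oplus M_{\bar1}$ satisfy $A_gM_h\subseteq M_{g+h}$. A graded submodule $N$ of a graded module $M$ is gr-maximal if $M/N$ is nonzero and has no graded submodules other than $0$ and itself. $J_{\mathbb Z_2}(A)$, the graded Jacobson radical, is the intersection of all gr-maximal submodules of ${}_AA$; it is a graded ideal. A gr-division superalgebra is a superalgebra in which every nonzero homogeneous element is invertible. A finite-dimensional superalgebra $A$ is gr-basic if $A/J_{\mathbb Z_2}(A)$ is a direct sum of gr-division superalgebras. *)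

theory Defs
  imports "HOL-Algebra.Algebra" "HOL-Library.Z2"
begin

text \<open>The group \<open>\<int>/2\<int>\<close> is the additive group of the type \<^typ>\<open>bit\<close>. A super structure is a
  \<^const>\<open>carrier\<close>-based structure together with its family of homogeneous components, indexed by
  \<^typ>\<open>bit\<close>.\<close>

definition direct_sum :: "('a, 'm) ring_scheme \<Rightarrow> 'a set \<Rightarrow> 'a set \<Rightarrow> 'a set \<Rightarrow> bool" where
  "direct_sum V W P Q \<longleftrightarrow> W = P <+>\<^bsub>V\<^esub> Q \<and> P \<inter> Q = {\<zero>\<^bsub>V\<^esub>}"

text \<open>In the record \<^typ>\<open>('k, 'a) module\<close> the fields \<^const>\<open>monoid.mult\<close> and \<^const>\<open>monoid.one\<close> play no role
  for a bare vector space; for an algebra they carry its ring structure. (The locale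
  \<^locale>\<open>algebra\<close> of the library covers commutative algebras only.)\<close>

locale super_vector_space = field K + module K V
  for K :: "('k, 'm) ring_scheme" (structure)
    and V :: "('k, 'a, 'n) module_scheme" (structure) +
  fixes G :: "bit \<Rightarrow> 'a set"
  assumes component_subspace: "submodule (G g) K V"
    and component_sum: "direct_sum V (carrier V) (G 0) (G 1)"

locale superalgebra = super_vector_space K A G + A?: ring A
  for K :: "('k, 'm) ring_scheme" (structure)
    and A :: "('k, 'a, 'n) module_scheme" (structure)
    and G :: "bit \<Rightarrow> 'a set" +
  assumes smult_mult_left:
      "\<lbrakk>c \<in> carrier K; x \<in> carrier A; y \<in> carrier A\<rbrakk>
        \<Longrightarrow> (c \<odot>\<^bsub>A\<^esub> x) \<otimes>\<^bsub>A\<^esub> y = c \<odot>\<^bsub>A\<^esub> (x \<otimes>\<^bsub>A\<^esub> y)"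
    and smult_mult_right:
      "\<lbrakk>c \<in> carrier K; x \<in> carrier A; y \<in> carrier A\<rbrakk>
        \<Longrightarrow> x \<otimes>\<^bsub>A\<^esub> (c \<odot>\<^bsub>A\<^esub> y) = c \<odot>\<^bsub>A\<^esub> (x \<otimes>\<^bsub>A\<^esub> y)"
    and component_mult:
      "\<lbrakk>x \<in> G g; y \<in> G h\<rbrakk> \<Longrightarrow> x \<otimes>\<^bsub>A\<^esub> y \<in> G (g + h)"

text \<open>For a field \<open>K\<close> this is the characteristic, because the order of an element of infinite
  order is \<open>0\<close> in the library.\<close>

definition ring_char :: "('k, 'm) ring_scheme \<Rightarrow> nat" where
  "ring_char K = group.ord (add_monoid K) \<one>\<^bsub>K\<^esub>"

definition finite_dim :: "('k, 'm) ring_scheme \<Rightarrow> ('k, 'a, 'n) module_scheme \<Rightarrow> bool" where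
  "finite_dim K V \<longleftrightarrow>
    (\<exists>B. finite B \<and> B \<subseteq> carrier V \<and>
      (\<forall>x \<in> carrier V. \<exists>c \<in> B \<rightarrow> carrier K. x = (\<Oplus>\<^bsub>V\<^esub>b\<in>B. c b \<odot>\<^bsub>V\<^esub> b)))"

text \<open>The scalars \<open>R\<close> are the field \<open>K\<close> for graded subspaces and the superalgebra itself for
  graded submodules of a graded left module.\<close>

definition gr_submodule ::
    "('r, 'm) ring_scheme \<Rightarrow> ('r, 'a, 'n) module_scheme \<Rightarrow> (bit \<Rightarrow> 'a set) \<Rightarrow> 'a set \<Rightarrow> bool" where
  "gr_submodule R M H N \<longleftrightarrow> submodule N R M \<and> direct_sum M N (N \<inter> H 0) (N \<inter> H 1)"

text \<open>The quotient carries the scalar action \<open>a (x + N) = a x + N\<close> in addition to the operations of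
  \<^const>\<open>FactRing\<close>; its multiplication and its unit are meaningful only if \<open>N\<close> is a two-sided ideal of
  an algebra \<open>M\<close>.\<close>

definition quotient_module :: "('r, 'a, 'n) module_scheme \<Rightarrow> 'a set \<Rightarrow> ('r, 'a set) module" where
  "quotient_module M N =
    \<lparr>carrier = a_rcosets\<^bsub>M\<^esub> N, monoid.mult = rcoset_mult M N, one = N +>\<^bsub>M\<^esub> \<one>\<^bsub>M\<^esub>,
     ring.zero = N, ring.add = set_add M, smult = (\<lambda>a C. \<Union>x\<in>C. N +>\<^bsub>M\<^esub> (a \<odot>\<^bsub>M\<^esub> x))\<rparr>"

definition quotient_grading ::
    "('a, 'n) ring_scheme \<Rightarrow> (bit \<Rightarrow> 'a set) \<Rightarrow> 'a set \<Rightarrow> bit \<Rightarrow> 'a set set" where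
  "quotient_grading M H N g = (\<lambda>x. N +>\<^bsub>M\<^esub> x) ` H g"

definition gr_maximal ::
    "('r, 'm) ring_scheme \<Rightarrow> ('r, 'a, 'n) module_scheme \<Rightarrow> (bit \<Rightarrow> 'a set) \<Rightarrow> 'a set \<Rightarrow> bool" where
  "gr_maximal R M H N \<longleftrightarrow>
    gr_submodule R M H N \<and>
    carrier (quotient_module M N) \<noteq> {\<zero>\<^bsub>quotient_module M N\<^esub>} \<and>
    (\<forall>L. gr_submodule R (quotient_module M N) (quotient_grading M H N) L \<longrightarrow>
       L = {\<zero>\<^bsub>quotient_module M N\<^esub>} \<or> L = carrier (quotient_module M N))"

definition regular_module :: "('a, 'n) ring_scheme \<Rightarrow> ('a, 'a) module" where
  "regular_module A =
    \<lparr>carrier = carrier A, monoid.mult = monoid.mult A, one = \<one>\<^bsub>A\<^esub>,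
     ring.zero = \<zero>\<^bsub>A\<^esub>, ring.add = ring.add A, smult = monoid.mult A\<rparr>"

text \<open>Intersecting with the carrier matters only for the zero algebra, which has no gr-maximal
  submodules: the empty intersection is then the whole module.\<close>

definition gr_jacobson :: "('a, 'n) ring_scheme \<Rightarrow> (bit \<Rightarrow> 'a set) \<Rightarrow> 'a set" where
  "gr_jacobson A G = carrier A \<inter> \<Inter> {N. gr_maximal A (regular_module A) G N}"

definition gr_division ::
    "('k, 'm) ring_scheme \<Rightarrow> ('k, 'a, 'n) module_scheme \<Rightarrow> (bit \<Rightarrow> 'a set) \<Rightarrow> bool" where
  "gr_division K D G \<longleftrightarrow>
    superalgebra K D G \<and> (\<forall>g. \<forall>x \<in> G g. x \<noteq> \<zero>\<^bsub>D\<^esub> \<longrightarrow> x \<in> Units D)"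

text \<open>Internal direct sum of algebras: the summands are two-sided ideals \<open>I i\<close>, each of which is a
  gr-division superalgebra for the induced operations and grading, with a unit \<open>e i\<close> of its own.
  Multiplication is then componentwise, since \<open>I i \<inter> I j = {0}\<close> for \<open>i \<noteq> j\<close>.\<close>

definition sum_of_gr_division ::
    "('k, 'm) ring_scheme \<Rightarrow> ('k, 'a, 'n) module_scheme \<Rightarrow> (bit \<Rightarrow> 'a set) \<Rightarrow> bool" where
  "sum_of_gr_division K B G \<longleftrightarrow>
    (\<exists>(n::nat) I e.
      (\<forall>i<n. ideal (I i) B \<and>
         gr_division K (B\<lparr>carrier := I i, one := e i\<rparr>) (\<lambda>g. G g \<inter> I i)) \<and>
      (\<forall>x \<in> carrier B. \<exists>!y. y \<in> (\<Pi>\<^sub>E i\<in>{..<n}. I i) \<and> x = (\<Oplus>\<^bsub>B\<^esub>i\<in>{..<n}. y i)))"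

definition gr_basic ::
    "('k, 'm) ring_scheme \<Rightarrow> ('k, 'a, 'n) module_scheme \<Rightarrow> (bit \<Rightarrow> 'a set) \<Rightarrow> bool" where
  "gr_basic K A G \<longleftrightarrow>
    sum_of_gr_division K (quotient_module A (gr_jacobson A G)) (quotient_grading A G (gr_jacobson A G))"

definition sub_superalgebra ::
    "('k, 'm) ring_scheme \<Rightarrow> ('k, 'a, 'n) module_scheme \<Rightarrow> (bit \<Rightarrow> 'a set) \<Rightarrow> 'a set \<Rightarrow> bool" where
  "sub_superalgebra K A G S \<longleftrightarrow> subring S A \<and> gr_submodule K A G S"

text \<open>Both summands being graded subspaces, each \<open>G g\<close> is the direct sum of \<open>P \<inter> G g\<close> and
  \<open>Q \<inter> G g\<close>.\<close>

definition super_direct_sum ::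
    "('k, 'm) ring_scheme \<Rightarrow> ('k, 'a, 'n) module_scheme \<Rightarrow> (bit \<Rightarrow> 'a set)
      \<Rightarrow> 'a set \<Rightarrow> 'a set \<Rightarrow> bool" where
  "super_direct_sum K V G P Q \<longleftrightarrow>
    gr_submodule K V G P \<and> gr_submodule K V G Q \<and> direct_sum V (carrier V) P Q"

end

theory Submission
  imports Defs
begin

text \<open>Let \<open>J\<close> be the graded Jacobson radical. Since \<open>K\<close> is algebraically closed, the graded division
  summands \<open>D\<^sub>i\<close> of \<open>A/J\<close> are as small as possible. An even element of \<open>D\<^sub>i\<close> is annihilated by a product of
  linear factors over \<open>K\<close>, one of which vanishes for lack of zero divisors, so the even part is
  \<open>K e\<^sub>i\<close>. The product of two odd elements is therefore a multiple of \<open>e\<^sub>i\<close>; extracting a square root,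
  the odd part is either \<open>0\<close> or a line \<open>K u\<^sub>i\<close> with \<open>u\<^sub>i\<^sup>2 = e\<^sub>i\<close> (lemmas \<open>block_even\<close> and \<open>block_odd\<close>).

  A complement of \<open>J\<close> is thus obtained by lifting finitely many equations to \<open>A\<close>: that the \<open>e\<^sub>i\<close> are
  orthogonal idempotents with sum \<open>1\<close>, and that \<open>u\<^sub>i\<close> is an odd square root of \<open>e\<^sub>i\<close>. Both kinds lift
  because even elements of \<open>J\<close> are nilpotent, so that suitable Newton iterations stop after finitely many
  steps (\<open>idempotents_from_nilpotent_product\<close> and \<open>square_root_from_nilpotent_defect\<close>). The iteration for
  square roots divides by \<open>2\<close>; this is where the characteristic enters.

  If \<open>f\<^sub>i\<close> and \<open>w\<^sub>i\<close> are the lifts, the complement is \<open>\<Oplus>\<^sub>i (K f\<^sub>i + K w\<^sub>i)\<close>. It is graded and closed under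
  multiplication, it maps onto \<open>A/J\<close>, and it meets \<open>J\<close> trivially: a nonzero multiple of \<open>f\<^sub>i\<close> in \<open>J\<close> would make
  the idempotent \<open>f\<^sub>i\<close> nilpotent (\<open>ex_graded_complement\<close>).

  The nilpotence of an even \<open>x \<in> J\<close> comes from the definition of \<open>J\<close>. For even \<open>y \<in> J\<close> the element
  \<open>1 + y\<close> is left invertible, for otherwise the graded left ideal \<open>A (1 + y)\<close> would lie in a gr-maximal one,
  which contains \<open>y\<close> and hence \<open>1\<close>. So \<open>x - l\<close> is left invertible for every scalar \<open>l \<noteq> 0\<close>, and cancelling these
  factors in a product of linear factors that annihilates \<open>x\<close> leaves a power of \<open>x\<close>.

  The lifting argument is carried out for a homomorphism of rings whose source is graded, with scalars
  taken from a central subring; the module structure is only used at the beginning and at the end.\<close>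

section \<open>Newton iterations in a ring\<close>

context ring
begin

text \<open>The quadratic convergence of both iterations below: the error term is replaced by a multiple of its
  square, which lowers the exponent of nilpotence by at least one.\<close>

lemma nilpotent_square_mult:
  assumes z: "z \<in> carrier R" and w: "w \<in> carrier R" and comm: "z \<otimes> w = w \<otimes> z"
    and nil: "z [^] Suc (Suc m) = \<zero>"
  shows "(z \<otimes> z \<otimes> w) [^] Suc m = \<zero>"
proof -
  have zz: "z \<otimes> z \<otimes> w = w \<otimes> (z \<otimes> z)"
    using z w comm by (metis m_assoc)
  have "(z \<otimes> z \<otimes> w) [^] Suc m = (z \<otimes> z) [^] Suc m \<otimes> w [^] Suc m"
    by (rule pow_mult_distrib[OF zz]) (use z w in auto)
  also have "(z \<otimes> z) [^] Suc m = z [^] Suc m \<otimes> z [^] Suc m"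
    by (rule pow_mult_distrib) (use z in auto)
  also have "\<dots> = z [^] (Suc (Suc m) + m)"
    using z by (simp only: nat_pow_mult) (simp add: add.commute)
  also have "\<dots> = \<zero>"
    using z nil by (simp only: nat_pow_mult[symmetric]) simp
  finally show ?thesis
    using w by simp
qed

text \<open>If \<open>b + c = 1\<close> and \<open>b c = 0\<close>, then \<open>b\<close> and \<open>c\<close> are idempotents; in general \<open>b c\<close> measures
  the failure. Grouping the terms of \<open>(b + c)\<^sup>3 = 1\<close> as \<open>b\<^sup>2 (b + 3 c) + c\<^sup>2 (c + 3 b)\<close> gives a new such
  pair whose product is a multiple of \<open>(b c)\<^sup>2\<close>. The form \<open>b h b\<close> of the result keeps track of the corner of
  the ring in which \<open>b\<close> lies and, together with the symmetric statement for \<open>c\<close>, determines its image in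
  every quotient in which \<open>b c\<close> vanishes. The subring \<open>E\<close> will be the even part of a graded ring.\<close>

lemma idempotents_from_nilpotent_product:
  assumes E: "subring E R"
  shows "\<lbrakk>b \<in> E; c \<in> E; b \<oplus> c = \<one>; (b \<otimes> c) [^] Suc m = \<zero>\<rbrakk> \<Longrightarrow>
    \<exists>h\<in>E. \<exists>k\<in>E. (b \<otimes> h \<otimes> b) \<oplus> (c \<otimes> k \<otimes> c) = \<one> \<and> (b \<otimes> h \<otimes> b) \<otimes> (c \<otimes> k \<otimes> c) = \<zero>"
proof (induction m arbitrary: b c)
  have EC: "E \<subseteq> carrier R" using subringE(1)[OF E] .
  have one: "\<one> \<in> E" using subringE(3)[OF E] .
  have mult: "x \<otimes> y \<in> E" if "x \<in> E" "y \<in> E" for x y using subringE(6)[OF E] that .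
  have add: "x \<oplus> y \<in> E" if "x \<in> E" "y \<in> E" for x y using subringE(7)[OF E] that .
  {
    fix b c assume bc: "b \<in> E" "c \<in> E" "b \<oplus> c = \<one>"
    hence "b \<otimes> (b \<oplus> c) = (b \<oplus> c) \<otimes> b"
      using EC by (simp add: subsetD)
    hence "b \<otimes> c = c \<otimes> b"
      using bc(1,2) EC by (simp add: l_distr r_distr subsetD)
  } note comm = this
  {
    case (0 b c)
    have carr: "b \<in> carrier R" "c \<in> carrier R" using 0 EC by auto
    have "b \<otimes> c = \<zero>" using 0 carr by simp
    have "b = b \<otimes> (b \<oplus> c)" using 0 carr by simp
    hence "b \<otimes> b = b" using carr \<open>b \<otimes> c = \<zero>\<close> by (simp add: r_distr)
    have "c = (b \<oplus> c) \<otimes> c" using 0 carr by simp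
    hence "c \<otimes> c = c" using carr \<open>b \<otimes> c = \<zero>\<close> by (simp add: l_distr)
    show ?case
      using one carr \<open>b \<otimes> b = b\<close> \<open>c \<otimes> c = c\<close> \<open>b \<otimes> c = \<zero>\<close> 0 by (intro bexI[of _ \<one>]) auto
  }
  {
    case (Suc m b c)
    have carr: "b \<in> carrier R" "c \<in> carrier R" using Suc EC by auto
    note cm = comm[OF Suc(2,3,4)]
    have cml: "c \<otimes> (b \<otimes> x) = b \<otimes> (c \<otimes> x)" if "x \<in> carrier R" for x
      using carr that cm by (metis m_assoc)
    let ?p = "b \<oplus> c \<oplus> c \<oplus> c" and ?q = "c \<oplus> b \<oplus> b \<oplus> b"
    let ?b = "b \<otimes> ?p \<otimes> b" and ?c = "c \<otimes> ?q \<otimes> c"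
    note norm = l_distr r_distr m_assoc a_ac carr cm[symmetric] cml
    have inE: "?p \<in> E" "?q \<in> E" "?b \<in> E" "?c \<in> E"
      using Suc(2,3) by (auto intro!: mult add)
    have "?b \<oplus> ?c = (b \<oplus> c) \<otimes> (b \<oplus> c) \<otimes> (b \<oplus> c)"
      by (simp add: norm)
    hence sum: "?b \<oplus> ?c = \<one>" using Suc by simp
    have "?b \<otimes> ?c = (b \<otimes> c) \<otimes> (b \<otimes> c) \<otimes> (?p \<otimes> ?q)"
      by (simp add: norm)
    moreover have "(b \<otimes> c) \<otimes> (?p \<otimes> ?q) = (?p \<otimes> ?q) \<otimes> (b \<otimes> c)"
      by (simp add: norm)
    ultimately have nil: "(?b \<otimes> ?c) [^] Suc m = \<zero>"
      using nilpotent_square_mult[of "b \<otimes> c" "?p \<otimes> ?q" m] Suc carr by simp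
    obtain h k where hk: "h \<in> E" "k \<in> E"
      "(?b \<otimes> h \<otimes> ?b) \<oplus> (?c \<otimes> k \<otimes> ?c) = \<one>" "(?b \<otimes> h \<otimes> ?b) \<otimes> (?c \<otimes> k \<otimes> ?c) = \<zero>"
      using Suc(1)[OF inE(3,4) sum nil] by blast
    let ?h = "?p \<otimes> b \<otimes> h \<otimes> (b \<otimes> ?p)" and ?k = "?q \<otimes> c \<otimes> k \<otimes> (c \<otimes> ?q)"
    have carr': "h \<in> carrier R" "k \<in> carrier R" "?p \<in> carrier R" "?q \<in> carrier R"
      using hk(1,2) inE EC by auto
    have "b \<otimes> ?h \<otimes> b = ?b \<otimes> h \<otimes> ?b" "c \<otimes> ?k \<otimes> c = ?c \<otimes> k \<otimes> ?c"
      using carr carr' by (simp_all only: m_assoc m_closed)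
    moreover have "?h \<in> E" "?k \<in> E"
      using Suc hk inE by (auto intro!: mult)
    ultimately show ?case
      using hk(3,4) by metis
  }
qed

text \<open>Here \<open>f\<close> acts as a unit and \<open>2 h = f - v\<^sup>2\<close> is the defect of \<open>v\<close> as a square root of \<open>f\<close>. The
  factor \<open>1 + h\<close> is the beginning of the series of \<open>(1 - 2 h)\<^sup>-\<^sup>1\<^sup>/\<^sup>2\<close>; from
  \<open>(1 - 2 h) (1 + h)\<^sup>2 = 1 - h\<^sup>2 (3 + 2 h)\<close> the defect of \<open>v (1 + h)\<close> is a multiple of \<open>h\<^sup>2\<close>. The
  element \<open>\<eta>\<close> is one half, needed to write the new defect as \<open>2 h'\<close> again. The result has the form
  \<open>v (1 + h u)\<close>, so it is odd if \<open>v\<close> is odd and \<open>E\<close> is the even part, and congruent to \<open>v\<close> modulo \<open>h\<close>.\<close>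

lemma square_root_from_nilpotent_defect:
  assumes E: "subring E R" and f: "f \<in> E" and eta: "\<eta> \<in> E" "\<eta> \<oplus> \<eta> = \<one>"
    and central: "\<And>x. x \<in> carrier R \<Longrightarrow> \<eta> \<otimes> x = x \<otimes> \<eta>"
  shows "\<lbrakk>v \<in> carrier R; h \<in> E; f \<otimes> v = v; v \<otimes> f = v; f \<otimes> h = h; h \<otimes> f = h; h \<otimes> v = v \<otimes> h;
      v \<otimes> v \<oplus> h \<oplus> h = f; h [^] Suc m = \<zero>\<rbrakk> \<Longrightarrow>
    \<exists>u\<in>E. v \<otimes> (\<one> \<oplus> h \<otimes> u) \<otimes> (v \<otimes> (\<one> \<oplus> h \<otimes> u)) = f \<and> v \<otimes> (\<one> \<oplus> h \<otimes> u) \<otimes> f = v \<otimes> (\<one> \<oplus> h \<otimes> u)"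
proof (induction m arbitrary: v h)
  have EC: "E \<subseteq> carrier R" using subringE(1)[OF E] .
  have one: "\<one> \<in> E" using subringE(3)[OF E] .
  have mult: "x \<otimes> y \<in> E" if "x \<in> E" "y \<in> E" for x y using subringE(6)[OF E] that .
  have add: "x \<oplus> y \<in> E" if "x \<in> E" "y \<in> E" for x y using subringE(7)[OF E] that .
  {
    case (0 v h)
    hence "h = \<zero>" using EC by auto
    thus ?case using 0 subringE(2)[OF E] by (intro bexI[of _ \<zero>]) auto
  }
  {
    case (Suc m v h)
    have carr: "v \<in> carrier R" "h \<in> carrier R" "\<eta> \<in> carrier R" "f \<in> carrier R"
      using Suc EC eta f by auto
    have hv: "h \<otimes> (v \<otimes> x) = v \<otimes> (h \<otimes> x)" if "x \<in> carrier R" for x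
      using carr that Suc(8) by (metis m_assoc)
    have fh: "f \<otimes> (h \<otimes> x) = h \<otimes> x" if "x \<in> carrier R" for x
      using carr that Suc(6) by (metis m_assoc)
    have hf: "h \<otimes> (f \<otimes> x) = h \<otimes> x" if "x \<in> carrier R" for x
      using carr that Suc(7) by (metis m_assoc)
    have fv: "f \<otimes> (v \<otimes> x) = v \<otimes> x" if "x \<in> carrier R" for x
      using carr that Suc(4) by (metis m_assoc)
    have vf: "v \<otimes> (f \<otimes> x) = v \<otimes> x" if "x \<in> carrier R" for x
      using carr that Suc(5) by (metis m_assoc)
    have etal: "x \<otimes> (\<eta> \<otimes> y) = \<eta> \<otimes> (x \<otimes> y)" if "x \<in> carrier R" "y \<in> carrier R" for x y
      using carr that central by (metis m_assoc)
    have eta2: "\<eta> \<otimes> x \<oplus> \<eta> \<otimes> x = x" if "x \<in> carrier R" for x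
      using carr that eta(2) by (metis l_distr l_one)
    let ?v = "v \<otimes> (\<one> \<oplus> h)" and ?t = "f \<oplus> f \<oplus> f \<oplus> (h \<oplus> h)"
    let ?h = "\<eta> \<otimes> (h \<otimes> h \<otimes> ?t)"
    note norm = l_distr r_distr m_assoc a_ac carr Suc(4-8) hv fh hf fv vf
    have hh: "h \<otimes> h \<otimes> ?t = h \<otimes> h \<oplus> h \<otimes> h \<oplus> h \<otimes> h \<oplus> (h \<otimes> h \<otimes> h \<oplus> h \<otimes> h \<otimes> h)"
      by (simp add: norm)
    have t: "?t \<in> carrier R" using carr by simp
    have inE: "?t \<in> E" "?h \<in> E" using Suc eta f by (auto intro!: mult add)
    have q1: "v \<otimes> v \<otimes> h \<oplus> (h \<otimes> h \<oplus> h \<otimes> h) = h"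
    proof -
      have "(v \<otimes> v \<oplus> h \<oplus> h) \<otimes> h = h" using Suc by simp
      thus ?thesis by (simp add: norm)
    qed
    have q2: "v \<otimes> v \<otimes> h \<otimes> h \<oplus> (h \<otimes> h \<otimes> h \<oplus> h \<otimes> h \<otimes> h) = h \<otimes> h"
    proof -
      have "(v \<otimes> v \<oplus> h \<oplus> h) \<otimes> (h \<otimes> h) = h \<otimes> h" using Suc carr by (simp add: fh)
      thus ?thesis by (simp add: norm)
    qed
    have "?v \<otimes> ?v \<oplus> ?h \<oplus> ?h = ?v \<otimes> ?v \<oplus> (h \<otimes> h \<otimes> ?t)"
      using carr t eta2[of "h \<otimes> h \<otimes> ?t"] by (simp add: a_assoc)
    also have "\<dots> = v \<otimes> v \<oplus> (v \<otimes> v \<otimes> h \<oplus> (h \<otimes> h \<oplus> h \<otimes> h))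
        \<oplus> (v \<otimes> v \<otimes> h \<oplus> (v \<otimes> v \<otimes> h \<otimes> h \<oplus> (h \<otimes> h \<otimes> h \<oplus> h \<otimes> h \<otimes> h)) \<oplus> h \<otimes> h)"
      unfolding hh by (simp add: norm)
    also have "\<dots> = v \<otimes> v \<oplus> h \<oplus> (v \<otimes> v \<otimes> h \<oplus> (h \<otimes> h \<oplus> h \<otimes> h))"
      unfolding q1 q2 using carr q1 by (simp add: a_assoc)
    also have "\<dots> = f"
      unfolding q1 using Suc by simp
    finally have sum: "?v \<otimes> ?v \<oplus> ?h \<oplus> ?h = f" .
    have hw: "?h = h \<otimes> h \<otimes> (\<eta> \<otimes> ?t)"
      using carr t by (simp add: m_assoc etal)
    moreover have "h \<otimes> (\<eta> \<otimes> ?t) = \<eta> \<otimes> ?t \<otimes> h"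
      using carr by (simp add: etal norm)
    ultimately have nil: "?h [^] Suc m = \<zero>"
      using nilpotent_square_mult[of h "\<eta> \<otimes> ?t" m] Suc carr t by simp
    have c1: "f \<otimes> ?v = ?v" "?v \<otimes> f = ?v" by (simp_all add: norm)
    have c2: "f \<otimes> ?h = ?h" "?h \<otimes> f = ?h" "?h \<otimes> ?v = ?v \<otimes> ?h"
      using carr by (simp_all add: etal norm)
    obtain u where u: "u \<in> E" "?v \<otimes> (\<one> \<oplus> ?h \<otimes> u) \<otimes> (?v \<otimes> (\<one> \<oplus> ?h \<otimes> u)) = f"
      "?v \<otimes> (\<one> \<oplus> ?h \<otimes> u) \<otimes> f = ?v \<otimes> (\<one> \<oplus> ?h \<otimes> u)"
      using Suc(1)[OF _ inE(2) c1 c2 sum nil] carr by blast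
    \<comment> \<open>The new defect is \<open>h\<close> times \<open>h \<eta> t\<close>, so both correction factors combine into one of the form \<open>1 + h u\<close>.\<close>
    let ?s = "h \<otimes> (\<eta> \<otimes> ?t) \<otimes> u"
    let ?u = "\<one> \<oplus> ?s \<oplus> h \<otimes> ?s"
    have uc: "u \<in> carrier R" using u EC by auto
    have "?s \<in> E" using Suc u inE eta by (auto intro!: mult)
    have sc: "?s \<in> carrier R" using carr uc t by simp
    have "?h \<otimes> u = h \<otimes> ?s" unfolding hw using carr uc t by (simp add: m_assoc)
    hence "?v \<otimes> (\<one> \<oplus> ?h \<otimes> u) = v \<otimes> ((\<one> \<oplus> h) \<otimes> (\<one> \<oplus> h \<otimes> ?s))"
      using carr sc by (simp add: m_assoc)
    also have "(\<one> \<oplus> h) \<otimes> (\<one> \<oplus> h \<otimes> ?s) = \<one> \<oplus> h \<otimes> ?u"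
      using carr sc by (simp add: l_distr r_distr a_ac del: m_assoc)
    finally have "?v \<otimes> (\<one> \<oplus> ?h \<otimes> u) = v \<otimes> (\<one> \<oplus> h \<otimes> ?u)" .
    moreover have "?u \<in> E" using \<open>?s \<in> E\<close> Suc one by (auto intro!: mult add)
    ultimately show ?case using u(2,3) by metis
  }
qed

end

section \<open>Graded rings and their graded left ideals\<close>

locale graded_ring = ring R for R (structure) +
  fixes G :: "bit \<Rightarrow> 'a set"
  assumes component: "additive_subgroup (G g) R"
    and decomposition: "x \<in> carrier R \<Longrightarrow> \<exists>y\<in>G 0. \<exists>z\<in>G 1. x = y \<oplus> z"
    and component_inter: "G 0 \<inter> G 1 = {\<zero>}"
    and mult_component: "\<lbrakk>x \<in> G g; y \<in> G h\<rbrakk> \<Longrightarrow> x \<otimes> y \<in> G (g + h)"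
begin

lemma component_subset: "G g \<subseteq> carrier R"
  using additive_subgroup.a_subset[OF component] .

lemma component_carrier [simp]: "x \<in> G g \<Longrightarrow> x \<in> carrier R"
  using component_subset by auto

lemmas [simp] = component_carrier[of _ 0] component_carrier[of _ 1]

lemma component_zero [simp]: "\<zero> \<in> G g"
  using additive_subgroup.zero_closed[OF component] .

lemma component_add: "\<lbrakk>x \<in> G g; y \<in> G g\<rbrakk> \<Longrightarrow> x \<oplus> y \<in> G g"
  using additive_subgroup.a_closed[OF component] .

lemma component_neg: "x \<in> G g \<Longrightarrow> \<ominus> x \<in> G g"
  using additive_subgroup.a_inv_closed[OF component] .

lemma component_minus: "\<lbrakk>x \<in> G g; y \<in> G g\<rbrakk> \<Longrightarrow> x \<ominus> y \<in> G g"
  unfolding a_minus_def by (intro component_add component_neg)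

lemma even_even: "\<lbrakk>x \<in> G 0; y \<in> G 0\<rbrakk> \<Longrightarrow> x \<otimes> y \<in> G 0"
  and even_odd: "\<lbrakk>x \<in> G 0; y \<in> G 1\<rbrakk> \<Longrightarrow> x \<otimes> y \<in> G 1"
  and odd_even: "\<lbrakk>x \<in> G 1; y \<in> G 0\<rbrakk> \<Longrightarrow> x \<otimes> y \<in> G 1"
  and odd_odd: "\<lbrakk>x \<in> G 1; y \<in> G 1\<rbrakk> \<Longrightarrow> x \<otimes> y \<in> G 0"
  using mult_component[of x 0 y 0] mult_component[of x 0 y 1]
    mult_component[of x 1 y 0] mult_component[of x 1 y 1] by simp_all

lemma homogeneous_eqI:
  assumes "x \<in> G 0" "y \<in> G 1" "x' \<in> G 0" "y' \<in> G 1" "x \<oplus> y = x' \<oplus> y'"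
  shows "x = x'" and "y = y'"
proof -
  have c: "x \<in> carrier R" "y \<in> carrier R" "x' \<in> carrier R" "y' \<in> carrier R"
    using assms by auto
  have "x \<ominus> x' = y' \<ominus> y"
  proof -
    have "x \<ominus> x' = (x \<oplus> y) \<ominus> x' \<ominus> y" using c by algebra
    also have "\<dots> = y' \<ominus> y" unfolding assms(5) using c by algebra
    finally show ?thesis .
  qed
  moreover have "x \<ominus> x' \<in> G 0" "y' \<ominus> y \<in> G 1"
    using assms by (auto intro: component_minus)
  ultimately have "x \<ominus> x' = \<zero>" "y' \<ominus> y = \<zero>"
    using component_inter by auto
  thus "x = x'" "y = y'"
    using c by auto
qed

text \<open>The even component \<open>e\<close> of \<open>1\<close> is a right unit for homogeneous elements, by comparing components in
  \<open>x = x \<cdot> 1\<close>; hence it is a right unit, and \<open>1 = 1 \<cdot> e\<close>.\<close>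

lemma one_even: "\<one> \<in> G 0"
proof -
  obtain e d where ed: "e \<in> G 0" "d \<in> G 1" "\<one> = e \<oplus> d"
    using decomposition[OF one_closed] by blast
  have c: "e \<in> carrier R" "d \<in> carrier R" using ed by auto
  have 0: "x = x \<otimes> e" if "x \<in> G 0" for x
  proof (rule homogeneous_eqI(1))
    show "x \<oplus> \<zero> = x \<otimes> e \<oplus> x \<otimes> d"
      using that c ed(3) by (simp add: r_distr[symmetric]) (metis component_carrier r_one)
  qed (use that ed in \<open>auto intro: even_even even_odd\<close>)
  have 1: "x = x \<otimes> e" if "x \<in> G 1" for x
  proof (rule homogeneous_eqI(2))
    show "\<zero> \<oplus> x = x \<otimes> d \<oplus> x \<otimes> e"
      using that c ed(3) by (simp add: r_distr[symmetric] a_comm) (metis component_carrier r_one)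
  qed (use that ed in \<open>auto intro: odd_even odd_odd\<close>)
  have "\<one> \<otimes> e = e \<otimes> e \<oplus> d \<otimes> e"
    using c by (simp add: ed(3) l_distr)
  also have "\<dots> = \<one>"
    using 0[OF ed(1)] 1[OF ed(2)] ed(3) by simp
  finally show ?thesis
    using ed(1) c(1) by simp
qed

lemma even_subring: "subring (G 0) R"
  by (rule subringI) (use one_even in \<open>auto intro: component_neg component_add even_even\<close>)

text \<open>These are the graded submodules of the regular module, freed from the record \<^const>\<open>regular_module\<close>.\<close>

definition graded_left_ideal :: "'a set \<Rightarrow> bool" where
  "graded_left_ideal N \<longleftrightarrow> additive_subgroup N R \<and> (\<forall>a\<in>carrier R. \<forall>x\<in>N. a \<otimes> x \<in> N) \<and>
    (\<forall>x\<in>N. \<exists>y\<in>N \<inter> G 0. \<exists>z\<in>N \<inter> G 1. x = y \<oplus> z)"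

lemma graded_left_idealI:
  assumes "N \<subseteq> carrier R" "\<zero> \<in> N" "\<And>x y. \<lbrakk>x \<in> N; y \<in> N\<rbrakk> \<Longrightarrow> x \<oplus> y \<in> N"
    and mult: "\<And>a x. \<lbrakk>a \<in> carrier R; x \<in> N\<rbrakk> \<Longrightarrow> a \<otimes> x \<in> N"
    and "\<And>x. x \<in> N \<Longrightarrow> \<exists>y\<in>N \<inter> G 0. \<exists>z\<in>N \<inter> G 1. x = y \<oplus> z"
  shows "graded_left_ideal N"
proof -
  have "\<ominus> x \<in> N" if "x \<in> N" for x
    using mult[of "\<ominus> \<one>" x] that assms(1) by (auto simp: l_minus)
  hence "additive_subgroup N R"
    using assms(1-3) by (intro additive_subgroup.intro add.subgroupI) (auto simp: a_inv_def)
  thus ?thesis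
    using assms unfolding graded_left_ideal_def by blast
qed

lemma graded_left_idealD:
  assumes "graded_left_ideal N"
  shows "additive_subgroup N R" "N \<subseteq> carrier R" "\<zero> \<in> N"
    and "\<lbrakk>x \<in> N; y \<in> N\<rbrakk> \<Longrightarrow> x \<oplus> y \<in> N"
    and "\<lbrakk>a \<in> carrier R; x \<in> N\<rbrakk> \<Longrightarrow> a \<otimes> x \<in> N"
    and "x \<in> N \<Longrightarrow> \<ominus> x \<in> N"
    and "x \<in> N \<Longrightarrow> \<exists>y\<in>N \<inter> G 0. \<exists>z\<in>N \<inter> G 1. x = y \<oplus> z"
  using assms additive_subgroup.a_subset[of N R] additive_subgroup.zero_closed[of N R]
    additive_subgroup.a_closed[of N R] additive_subgroup.a_inv_closed[of N R]
  unfolding graded_left_ideal_def by auto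

lemma graded_left_ideal_homogeneous_part:
  assumes N: "graded_left_ideal N" and "x \<in> G 0" "y \<in> G 1" "x \<oplus> y \<in> N"
  shows "x \<in> N" and "y \<in> N"
proof -
  obtain x' y' where "x' \<in> N \<inter> G 0" "y' \<in> N \<inter> G 1" "x \<oplus> y = x' \<oplus> y'"
    using graded_left_idealD(7)[OF N assms(4)] by blast
  thus "x \<in> N" "y \<in> N"
    using homogeneous_eqI[of x y x' y'] assms by auto
qed

lemma subgroup_regular_module:
  "subgroup N (add_monoid (regular_module R)) \<longleftrightarrow> subgroup N (add_monoid R)"
  by (simp add: subgroup_def m_inv_def regular_module_def)

lemma coset_regular_module: "a_r_coset (regular_module R) = a_r_coset R"
  "A_RCOSETS (regular_module R) = A_RCOSETS R" "set_add (regular_module R) = set_add R"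
  by (simp_all add: fun_eq_iff a_r_coset_def' A_RCOSETS_def' set_add_def' regular_module_def)

lemma gr_submodule_imp_graded_left_ideal:
  assumes "gr_submodule R (regular_module R) G N"
  shows "graded_left_ideal N"
proof -
  interpret submodule N R "regular_module R"
    using assms unfolding gr_submodule_def by blast
  have sub: "subgroup N (add_monoid R)"
    using subgroup_axioms subgroup_regular_module by blast
  have mult: "a \<otimes> x \<in> N" if "a \<in> carrier R" "x \<in> N" for a x
    using smult_closed[OF that] by (simp add: regular_module_def)
  have "N = (N \<inter> G 0) <+>\<^bsub>R\<^esub> (N \<inter> G 1)"
    using assms unfolding gr_submodule_def direct_sum_def coset_regular_module by blast
  hence "\<exists>y\<in>N \<inter> G 0. \<exists>z\<in>N \<inter> G 1. x = y \<oplus> z" if "x \<in> N" for x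
    using that unfolding set_add_def' by blast
  thus ?thesis
    using sub mult unfolding graded_left_ideal_def additive_subgroup_def by blast
qed

lemma graded_left_ideal_imp_gr_submodule:
  assumes N: "graded_left_ideal N"
  shows "gr_submodule R (regular_module R) G N"
proof -
  note D = graded_left_idealD[OF N]
  have "submodule N R (regular_module R)"
  proof (intro submodule.intro submodule_axioms.intro)
    show "subgroup N (add_monoid (regular_module R))"
      using D(1) subgroup_regular_module unfolding additive_subgroup_def by blast
  qed (use D(5) in \<open>simp add: regular_module_def\<close>)
  moreover have "N = (N \<inter> G 0) <+>\<^bsub>R\<^esub> (N \<inter> G 1)"
  proof
    show "N \<subseteq> (N \<inter> G 0) <+>\<^bsub>R\<^esub> (N \<inter> G 1)"
      using D(7) by (auto simp: set_add_def')
    show "(N \<inter> G 0) <+>\<^bsub>R\<^esub> (N \<inter> G 1) \<subseteq> N"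
      using D(4) by (auto simp: set_add_def')
  qed
  moreover have "(N \<inter> G 0) \<inter> (N \<inter> G 1) = {\<zero>}"
    using component_inter D(3) by blast
  ultimately show ?thesis
    unfolding gr_submodule_def direct_sum_def coset_regular_module by (simp add: regular_module_def)
qed

text \<open>Zorn's lemma, a graded left ideal being proper when it does not contain \<open>1\<close>.\<close>

lemma ex_maximal_graded_left_ideal:
  assumes N: "graded_left_ideal N" and "\<one> \<notin> N"
  shows "\<exists>M. graded_left_ideal M \<and> N \<subseteq> M \<and> \<one> \<notin> M \<and>
    (\<forall>P. graded_left_ideal P \<longrightarrow> M \<subseteq> P \<longrightarrow> \<one> \<notin> P \<longrightarrow> P = M)"
proof -
  define F where "F = {M. graded_left_ideal M \<and> N \<subseteq> M \<and> \<one> \<notin> M}"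
  have "\<exists>M\<in>F. \<forall>U\<in>F. M \<subseteq> U \<longrightarrow> U = M"
  proof (rule subset_Zorn_nonempty)
    show "F \<noteq> {}" using assms unfolding F_def by blast
    fix \<C> assume C: "\<C> \<noteq> {}" "subset.chain F \<C>"
    hence CF: "\<And>U. U \<in> \<C> \<Longrightarrow> graded_left_ideal U \<and> N \<subseteq> U \<and> \<one> \<notin> U"
      and lin: "\<And>U V. \<lbrakk>U \<in> \<C>; V \<in> \<C>\<rbrakk> \<Longrightarrow> U \<subseteq> V \<or> V \<subseteq> U"
      unfolding subset.chain_def F_def by auto
    have "graded_left_ideal (\<Union>\<C>)"
    proof (rule graded_left_idealI)
      show "\<Union>\<C> \<subseteq> carrier R" using CF graded_left_idealD(2) by blast
      show "\<zero> \<in> \<Union>\<C>" using CF graded_left_idealD(3) C(1) by blast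
      show "x \<oplus> y \<in> \<Union>\<C>" if xy: "x \<in> \<Union>\<C>" "y \<in> \<Union>\<C>" for x y
      proof -
        obtain U V where XY: "U \<in> \<C>" "V \<in> \<C>" "x \<in> U" "y \<in> V" using xy by blast
        then obtain Z where "Z \<in> \<C>" "x \<in> Z" "y \<in> Z" using lin[of U V] by blast
        thus ?thesis using CF graded_left_idealD(4) by blast
      qed
      show "a \<otimes> x \<in> \<Union>\<C>" if "a \<in> carrier R" "x \<in> \<Union>\<C>" for a x
        using that CF graded_left_idealD(5) by blast
      show "\<exists>y\<in>\<Union>\<C> \<inter> G 0. \<exists>z\<in>\<Union>\<C> \<inter> G 1. x = y \<oplus> z" if x: "x \<in> \<Union>\<C>" for x
      proof -
        obtain U where U: "U \<in> \<C>" "x \<in> U" using x by blast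
        thus ?thesis using CF graded_left_idealD(7)[of U x] by blast
      qed
    qed
    moreover obtain U where "U \<in> \<C>" using C(1) by blast
    moreover have "N \<subseteq> \<Union>\<C>" using CF[OF \<open>U \<in> \<C>\<close>] Union_upper[OF \<open>U \<in> \<C>\<close>] subset_trans by metis
    moreover have "\<one> \<notin> \<Union>\<C>" using CF by auto
    ultimately show "\<Union>\<C> \<in> F" unfolding F_def by simp
  qed
  then obtain M where "M \<in> F" "\<And>U. \<lbrakk>U \<in> F; M \<subseteq> U\<rbrakk> \<Longrightarrow> U = M"
    by metis
  thus ?thesis unfolding F_def by (intro exI[of _ M]) (simp, metis subset_trans)
qed

text \<open>Graded submodules of the quotient by \<open>M\<close> correspond to graded left ideals above \<open>M\<close>, by taking
  preimages; for maximal \<open>M\<close> there are only two of the latter.\<close>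

lemma maximal_imp_gr_maximal:
  assumes M: "graded_left_ideal M" and "\<one> \<notin> M"
    and max: "\<And>P. \<lbrakk>graded_left_ideal P; M \<subseteq> P; \<one> \<notin> P\<rbrakk> \<Longrightarrow> P = M"
  shows "gr_maximal R (regular_module R) G M"
proof -
  note D = graded_left_idealD[OF M]
  interpret M: abelian_subgroup M R
    using D(1) abelian_group_axioms by (intro abelian_subgroupI3)
  let ?Q = "quotient_module (regular_module R) M"
  have Q: "carrier ?Q = a_rcosets M" "\<zero>\<^bsub>?Q\<^esub> = M" "add ?Q = set_add R"
    by (simp_all add: quotient_module_def coset_regular_module)
  have smult: "a \<odot>\<^bsub>?Q\<^esub> (M +> x) = M +> (a \<otimes> x)" if a: "a \<in> carrier R" and x: "x \<in> carrier R" for a x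
  proof -
    have "M +> (a \<otimes> y) = M +> (a \<otimes> x)" if y: "y \<in> M +> x" for y
    proof -
      obtain m where m: "m \<in> M" "y = m \<oplus> x"
        using y by (auto simp: a_r_coset_def')
      have "a \<otimes> y = a \<otimes> m \<oplus> a \<otimes> x" using m D(2) a x by (auto simp: r_distr)
      hence "a \<otimes> y \<in> M +> (a \<otimes> x)"
        using D(5)[OF a m(1)] by (auto simp: a_r_coset_def')
      thus ?thesis using a x M.a_repr_independence' by simp
    qed
    hence "(\<Union>y\<in>M +> x. M +> (a \<otimes> y)) = (\<Union>y\<in>M +> x. M +> (a \<otimes> x))"
      by (intro SUP_cong refl)
    moreover have "M +> x \<noteq> {}" using x M.a_rcos_self by auto
    ultimately have "(\<Union>y\<in>M +> x. M +> (a \<otimes> y)) = M +> (a \<otimes> x)" by simp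
    moreover have "a \<odot>\<^bsub>?Q\<^esub> (M +> x) = (\<Union>y\<in>M +> x. M +> (a \<otimes> y))"
      unfolding quotient_module_def coset_regular_module by (simp add: regular_module_def)
    ultimately show ?thesis by simp
  qed
  have "carrier ?Q \<noteq> {\<zero>\<^bsub>?Q\<^esub>}"
  proof
    assume "carrier ?Q = {\<zero>\<^bsub>?Q\<^esub>}"
    hence "M +> \<one> = M" unfolding Q using a_rcosetsI[OF D(2) one_closed] by blast
    thus False using M.a_rcos_self[OF one_closed] assms(2) by simp
  qed
  moreover have "L = {\<zero>\<^bsub>?Q\<^esub>} \<or> L = carrier ?Q"
    if L: "gr_submodule R ?Q (quotient_grading (regular_module R) G M) L" for L
  proof -
    interpret L: submodule L R ?Q using L unfolding gr_submodule_def by blast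
    define P where "P = {x \<in> carrier R. M +> x \<in> L}"
    have zero_L: "M \<in> L" using L.one_closed Q by simp
    have LC: "L \<subseteq> a_rcosets M" using L.subset Q by simp
    have "L = (L \<inter> (+>) M ` G 0) <+>\<^bsub>?Q\<^esub> (L \<inter> (+>) M ` G 1)"
      using L unfolding gr_submodule_def direct_sum_def quotient_grading_def coset_regular_module by simp
    moreover have "V <+>\<^bsub>?Q\<^esub> W = {v <+>\<^bsub>R\<^esub> w | v w. v \<in> V \<and> w \<in> W}" for V W
      unfolding set_add_def'[of ?Q] Q by blast
    ultimately have Lsum: "\<exists>V\<in>L \<inter> (+>) M ` G 0. \<exists>W\<in>L \<inter> (+>) M ` G 1. U = V <+>\<^bsub>R\<^esub> W"
      if "U \<in> L" for U
      using that by (smt (verit) mem_Collect_eq)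
    have MP: "M \<subseteq> P"
    proof
      fix x assume "x \<in> M"
      thus "x \<in> P" unfolding P_def using D(2) zero_L M.a_rcos_const[of x] by (simp add: subset_iff)
    qed
    have Padd: "x \<oplus> y \<in> P" if "x \<in> P" "y \<in> P" for x y
    proof -
      have c: "x \<in> carrier R" "y \<in> carrier R" "M +> x \<in> L" "M +> y \<in> L"
        using that unfolding P_def by auto
      have "(M +> x) <+>\<^bsub>R\<^esub> (M +> y) \<in> L"
        using L.m_closed[OF c(3,4)] by (simp add: Q)
      thus ?thesis unfolding P_def using c M.a_rcos_sum by simp
    qed
    have "graded_left_ideal P"
    proof (rule graded_left_idealI)
      show "P \<subseteq> carrier R" unfolding P_def by blast
      show "\<zero> \<in> P" using MP D(3) by blast
      show "a \<otimes> x \<in> P" if "a \<in> carrier R" "x \<in> P" for a x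
        using that L.smult_closed[of a "M +> x"] smult unfolding P_def by simp
      show "\<exists>y\<in>P \<inter> G 0. \<exists>z\<in>P \<inter> G 1. x = y \<oplus> z" if x: "x \<in> P" for x
      proof -
        obtain y z where yz: "y \<in> G 0" "M +> y \<in> L" "z \<in> G 1" "M +> z \<in> L"
          and "M +> x = (M +> y) <+>\<^bsub>R\<^esub> (M +> z)"
          using Lsum[of "M +> x"] x unfolding P_def by blast
        hence "M +> x = M +> (y \<oplus> z)" by (simp add: M.a_rcos_sum)
        hence "x \<in> M +> (y \<oplus> z)" using x M.a_rcos_self unfolding P_def by blast
        then obtain m where m: "m \<in> M" "x = m \<oplus> (y \<oplus> z)" by (auto simp: a_r_coset_def')
        \<comment> \<open>The homogeneous representatives \<open>y\<close> and \<open>z\<close> add up to \<open>x\<close> only modulo \<open>M\<close>; the difference is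
          distributed over them, which is possible because \<open>M\<close> is graded.\<close>
        obtain m0 m1 where m01: "m0 \<in> M" "m0 \<in> G 0" "m1 \<in> M" "m1 \<in> G 1" "m = m0 \<oplus> m1"
          using D(7)[OF m(1)] by blast
        have yzP: "y \<in> P" "z \<in> P" using yz unfolding P_def by auto
        have "x = (m0 \<oplus> y) \<oplus> (m1 \<oplus> z)"
          unfolding m(2) m01(5) using yz m01 by (simp add: a_ac)
        moreover have "m0 \<oplus> y \<in> P \<inter> G 0" "m1 \<oplus> z \<in> P \<inter> G 1"
          using m01 MP yz yzP by (auto intro: Padd component_add)
        ultimately show ?thesis by blast
      qed
    qed (use Padd in auto)
    show ?thesis
    proof (cases "\<one> \<in> P")
      case True
      hence "P = carrier R"
        using graded_left_idealD(2,5)[OF \<open>graded_left_ideal P\<close>] by (metis r_one subset_antisym subsetI)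
      hence "a_rcosets M \<subseteq> L" unfolding P_def A_RCOSETS_def' by blast
      thus ?thesis using LC Q by auto
    next
      case False
      hence "P = M" using max[OF \<open>graded_left_ideal P\<close> MP] by blast
      have "L \<subseteq> {M}"
      proof
        fix U assume U: "U \<in> L"
        then obtain x where x: "x \<in> carrier R" "U = M +> x" using LC unfolding A_RCOSETS_def' by blast
        hence "x \<in> M" using U \<open>P = M\<close> unfolding P_def by auto
        thus "U \<in> {M}" using x M.a_rcos_const by simp
      qed
      hence "L = {M}" using zero_L by auto
      thus ?thesis unfolding Q by simp
    qed
  qed
  ultimately show ?thesis
    unfolding gr_maximal_def using graded_left_ideal_imp_gr_submodule[OF M] by blast
qed

lemma gr_jacobson_graded_left_ideal: "graded_left_ideal (gr_jacobson R G)"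
proof -
  let ?J = "gr_jacobson R G"
  have sub: "graded_left_ideal N" if "gr_maximal R (regular_module R) G N" for N
    using that gr_submodule_imp_graded_left_ideal unfolding gr_maximal_def by blast
  show ?thesis
  proof (rule graded_left_idealI)
    show "\<exists>y\<in>?J \<inter> G 0. \<exists>z\<in>?J \<inter> G 1. x = y \<oplus> z" if x: "x \<in> ?J" for x
    proof -
      obtain y z where yz: "y \<in> G 0" "z \<in> G 1" "x = y \<oplus> z"
        using decomposition[of x] x unfolding gr_jacobson_def by blast
      have "y \<in> N \<and> z \<in> N" if N: "gr_maximal R (regular_module R) G N" for N
      proof -
        have "y \<oplus> z \<in> N" using x N yz(3) unfolding gr_jacobson_def by simp
        thus ?thesis using graded_left_ideal_homogeneous_part[OF sub[OF N] yz(1,2)] by simp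
      qed
      hence "y \<in> ?J" "z \<in> ?J" using yz(1,2) unfolding gr_jacobson_def by simp_all
      thus ?thesis using yz by blast
    qed
    show "?J \<subseteq> carrier R" unfolding gr_jacobson_def by simp
    show "\<zero> \<in> ?J" using graded_left_idealD(3)[OF sub] unfolding gr_jacobson_def by simp
    show "x \<oplus> y \<in> ?J" if "x \<in> ?J" "y \<in> ?J" for x y
      using that graded_left_idealD(4)[OF sub, of _ x y] unfolding gr_jacobson_def by simp
    show "a \<otimes> x \<in> ?J" if "a \<in> carrier R" "x \<in> ?J" for a x
      using that graded_left_idealD(5)[OF sub, of _ a x] unfolding gr_jacobson_def by simp
  qed
qed

text \<open>Otherwise the graded left ideal generated by \<open>1 + y\<close> is proper (it is graded because \<open>1 + y\<close> is even)
  and lies in a gr-maximal one; the latter contains \<open>y\<close>, hence also \<open>1\<close>.\<close>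

lemma even_gr_jacobson_left_inverse:
  assumes y: "y \<in> gr_jacobson R G" "y \<in> G 0"
  shows "\<exists>z\<in>carrier R. z \<otimes> (\<one> \<oplus> y) = \<one>"
proof (rule ccontr)
  assume no: "\<not> ?thesis"
  let ?N = "(\<lambda>z. z \<otimes> (\<one> \<oplus> y)) ` carrier R"
  have yc: "y \<in> carrier R" "\<one> \<oplus> y \<in> carrier R" "\<one> \<oplus> y \<in> G 0"
    using y one_even by (auto intro: component_add)
  have N: "graded_left_ideal ?N"
  proof (rule graded_left_idealI)
    show "\<zero> \<in> ?N" using yc by (auto intro!: image_eqI[of _ _ \<zero>])
    show "u \<oplus> v \<in> ?N" if uv: "u \<in> ?N" "v \<in> ?N" for u v
      using that yc by (auto simp: l_distr[symmetric])
    show "a \<otimes> u \<in> ?N" if "a \<in> carrier R" "u \<in> ?N" for a u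
      using that yc by (auto simp: m_assoc[symmetric])
    show "\<exists>v\<in>?N \<inter> G 0. \<exists>w\<in>?N \<inter> G 1. u = v \<oplus> w" if u: "u \<in> ?N" for u
    proof -
      obtain c where c: "c \<in> carrier R" "u = c \<otimes> (\<one> \<oplus> y)" using u by blast
      obtain a b where ab: "a \<in> G 0" "b \<in> G 1" "c = a \<oplus> b"
        using decomposition[OF c(1)] by blast
      have "u = a \<otimes> (\<one> \<oplus> y) \<oplus> b \<otimes> (\<one> \<oplus> y)"
        unfolding c(2) ab(3) using ab(1,2) yc(2) by (intro l_distr) simp_all
      moreover have "a \<otimes> (\<one> \<oplus> y) \<in> ?N \<inter> G 0" "b \<otimes> (\<one> \<oplus> y) \<in> ?N \<inter> G 1"
        using ab(1,2) even_even[OF _ yc(3)] odd_even[OF _ yc(3)] by auto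
      ultimately show ?thesis by blast
    qed
  qed (use yc in auto)
  have "\<one> \<notin> ?N" using no by force
  then obtain M where M: "graded_left_ideal M" "?N \<subseteq> M" "\<one> \<notin> M"
    and max: "\<forall>P. graded_left_ideal P \<longrightarrow> M \<subseteq> P \<longrightarrow> \<one> \<notin> P \<longrightarrow> P = M"
    using ex_maximal_graded_left_ideal[OF N] by auto
  have gr_max: "gr_maximal R (regular_module R) G M"
    by (rule maximal_imp_gr_maximal[OF M(1,3)]) (use max in simp)
  note D = graded_left_idealD[OF M(1)]
  have "\<one> \<oplus> y \<in> M" using M(2) yc by (intro subsetD[OF M(2)] image_eqI[of _ _ \<one>]) simp_all
  moreover have "y \<in> M" using y gr_max unfolding gr_jacobson_def by simp
  ultimately have "(\<one> \<oplus> y) \<oplus> \<ominus> y \<in> M" using D(4,6) by blast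
  moreover have "(\<one> \<oplus> y) \<oplus> \<ominus> y = \<one>" using yc by algebra
  ultimately show False using M(3) by simp
qed

end

section \<open>Lifting along a homomorphism with nil even kernel\<close>

text \<open>An algebra over a field is treated here as a ring that contains its scalars. The set \<open>F\<close> stands for
  the image of the field. This is a subfield except in the zero ring, where it is \<open>{0}\<close>; the assumption on
  inverses covers both cases.\<close>

locale scalar_graded_ring = graded_ring R G for R (structure) and G +
  fixes F :: "'a set"
  assumes scalars_subring: "subring F R"
    and scalars_even: "F \<subseteq> G 0"
    and scalars_central: "\<lbrakk>c \<in> F; x \<in> carrier R\<rbrakk> \<Longrightarrow> c \<otimes> x = x \<otimes> c"
    and scalars_inverse: "\<lbrakk>c \<in> F; c \<noteq> \<zero>\<rbrakk> \<Longrightarrow> \<exists>d\<in>F. d \<otimes> c = \<one>"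
    and scalars_half: "\<exists>\<eta>\<in>F. \<eta> \<oplus> \<eta> = \<one>"
    and scalars_sqrt: "c \<in> F \<Longrightarrow> \<exists>d\<in>F. d \<otimes> d = c"
begin

lemma scalar_carrier [simp]: "c \<in> F \<Longrightarrow> c \<in> carrier R"
  using scalars_even by auto

lemma scalar_closed [simp]:
  "\<zero> \<in> F" "\<one> \<in> F" "\<lbrakk>c \<in> F; d \<in> F\<rbrakk> \<Longrightarrow> c \<oplus> d \<in> F" "\<lbrakk>c \<in> F; d \<in> F\<rbrakk> \<Longrightarrow> c \<otimes> d \<in> F" "c \<in> F \<Longrightarrow> \<ominus> c \<in> F"
  using subringE[OF scalars_subring] by auto

end

text \<open>The model is the projection of a finite-dimensional superalgebra onto the quotient by its graded
  Jacobson radical. The product in the last assumption runs over the linear factors \<open>x - l\<close>.\<close>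

locale graded_nil_extension = scalar_graded_ring R G F + S: ring S + hom: ring_hom_ring R S \<pi>
  for R (structure) and G F and S (structure) and \<pi> +
  assumes kernel_even_nilpotent: "\<lbrakk>x \<in> G 0; \<pi> x = \<zero>\<^bsub>S\<^esub>\<rbrakk> \<Longrightarrow> \<exists>m::nat. x [^] m = \<zero>"
    and kernel_graded: "\<lbrakk>x \<in> G 0; y \<in> G 1; \<pi> (x \<oplus> y) = \<zero>\<^bsub>S\<^esub>\<rbrakk> \<Longrightarrow> \<pi> x = \<zero>\<^bsub>S\<^esub>"
    and even_split: "x \<in> G 0 \<Longrightarrow> \<exists>ls. set ls \<subseteq> F \<and> foldr (\<lambda>l y. (x \<ominus> l) \<otimes> y) ls \<one> = \<zero>"
begin

lemma kernel_even_nilpotent_Suc: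
  assumes "x \<in> G 0" "\<pi> x = \<zero>\<^bsub>S\<^esub>"
  shows "\<exists>m::nat. x [^] Suc m = \<zero>"
proof -
  obtain m :: nat where "x [^] m = \<zero>" using kernel_even_nilpotent[OF assms] by blast
  hence "x [^] Suc m = \<zero>" using assms by simp
  thus ?thesis by blast
qed

lemma kernel_even_idempotent_zero:
  assumes "e \<in> G 0" "e \<otimes> e = e" "\<pi> e = \<zero>\<^bsub>S\<^esub>"
  shows "e = \<zero>"
proof -
  obtain m :: nat where "e [^] Suc m = \<zero>" using kernel_even_nilpotent_Suc[OF assms(1,3)] by blast
  moreover have "e [^] Suc m = e" for m :: nat
    by (induction m) (use assms in auto)
  ultimately show ?thesis by simp
qed

text \<open>The iteration is started with \<open>b\<close> and \<open>c = 1 - b\<close>, whose product lies in the kernel. To compute the image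
  of \<open>b h b\<close>, multiply \<open>b h b + c k c = 1\<close> by \<open>\<pi> b\<close>, which annihilates \<open>\<pi> c\<close>.\<close>

lemma lift_even_idempotent:
  assumes b: "b \<in> G 0" and idem: "\<pi> b \<otimes>\<^bsub>S\<^esub> \<pi> b = \<pi> b"
  shows "\<exists>h\<in>G 0. (b \<otimes> h \<otimes> b) \<otimes> (b \<otimes> h \<otimes> b) = b \<otimes> h \<otimes> b \<and> \<pi> (b \<otimes> h \<otimes> b) = \<pi> b"
proof -
  define c where "c = \<one> \<ominus> b"
  have cG: "c \<in> G 0" unfolding c_def using b one_even by (rule component_minus[rotated])
  have carr: "b \<in> carrier R" "c \<in> carrier R" using b cG by auto
  have sum: "b \<oplus> c = \<one>" unfolding c_def using carr(1) by algebra
  have pc: "\<pi> b \<oplus>\<^bsub>S\<^esub> \<pi> c = \<one>\<^bsub>S\<^esub>" using sum carr by (metis hom.hom_add hom.hom_one)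
  have pbc: "\<pi> b \<otimes>\<^bsub>S\<^esub> \<pi> c = \<zero>\<^bsub>S\<^esub>"
  proof -
    have "\<pi> b \<otimes>\<^bsub>S\<^esub> (\<pi> b \<oplus>\<^bsub>S\<^esub> \<pi> c) = \<pi> b" using pc carr by simp
    thus ?thesis using carr idem by (simp add: S.r_distr)
  qed
  have "b \<otimes> c \<in> G 0" "\<pi> (b \<otimes> c) = \<zero>\<^bsub>S\<^esub>" using b cG even_even pbc carr by auto
  then obtain m :: nat where "(b \<otimes> c) [^] Suc m = \<zero>" using kernel_even_nilpotent_Suc by blast
  then obtain h k where hk: "h \<in> G 0" "k \<in> G 0" "(b \<otimes> h \<otimes> b) \<oplus> (c \<otimes> k \<otimes> c) = \<one>"
      "(b \<otimes> h \<otimes> b) \<otimes> (c \<otimes> k \<otimes> c) = \<zero>"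
    using idempotents_from_nilpotent_product[OF even_subring b cG sum] by blast
  let ?e = "b \<otimes> h \<otimes> b" and ?d = "c \<otimes> k \<otimes> c"
  have ed: "?e \<in> carrier R" "?d \<in> carrier R" using carr hk by auto
  have "?e \<otimes> (?e \<oplus> ?d) = ?e" using hk ed by simp
  hence "?e \<otimes> ?e = ?e" using ed hk(4) by (simp only: r_distr) simp
  moreover have "\<pi> ?e = \<pi> b"
  proof -
    have "\<pi> b \<otimes>\<^bsub>S\<^esub> \<pi> ?e = \<pi> ?e"
      using carr hk idem by (simp add: S.m_assoc[symmetric])
    moreover have "\<pi> b \<otimes>\<^bsub>S\<^esub> \<pi> ?d = \<zero>\<^bsub>S\<^esub>"
      using carr hk pbc by (simp add: S.m_assoc[symmetric])
    moreover have "\<pi> b \<otimes>\<^bsub>S\<^esub> (\<pi> ?e \<oplus>\<^bsub>S\<^esub> \<pi> ?d) = \<pi> b"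
      using hk(3) ed carr by (metis hom.hom_add hom.hom_one hom.hom_closed S.r_one)
    ultimately show ?thesis using ed carr by (simp add: S.r_distr)
  qed
  ultimately show ?thesis using hk(1) by blast
qed

text \<open>The idempotents are lifted one after the other. The element \<open>g\<close> is the complementary idempotent of those
  already lifted; lifting the next one inside the corner \<open>g R g\<close> makes it orthogonal to all previous ones.\<close>

lemma lift_orthogonal_idempotents:
  fixes n :: nat and a :: "nat \<Rightarrow> 'a"
  assumes "\<And>i. i < n \<Longrightarrow> a i \<in> G 0"
    and "\<And>i j. \<lbrakk>i < n; j < n\<rbrakk> \<Longrightarrow> \<pi> (a i) \<otimes>\<^bsub>S\<^esub> \<pi> (a j) = (if i = j then \<pi> (a i) else \<zero>\<^bsub>S\<^esub>)"
  shows "\<exists>f g. (\<forall>i<n. f i \<in> G 0 \<and> \<pi> (f i) = \<pi> (a i) \<and> f i \<otimes> g = \<zero> \<and> g \<otimes> f i = \<zero>) \<and> g \<in> G 0 \<and>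
    (\<forall>i<n. \<forall>j<n. f i \<otimes> f j = (if i = j then f i else \<zero>)) \<and> g \<oplus> (\<Oplus>i\<in>{..<n}. f i) = \<one>"
  using assms
proof (induction n)
  case 0
  show ?case using one_even by (intro exI[of _ a] exI[of _ \<one>]) simp
next
  case (Suc n)
  have "\<exists>f g. (\<forall>i<n. f i \<in> G 0 \<and> \<pi> (f i) = \<pi> (a i) \<and> f i \<otimes> g = \<zero> \<and> g \<otimes> f i = \<zero>) \<and> g \<in> G 0 \<and>
    (\<forall>i<n. \<forall>j<n. f i \<otimes> f j = (if i = j then f i else \<zero>)) \<and> g \<oplus> (\<Oplus>i\<in>{..<n}. f i) = \<one>"
    by (rule Suc.IH) (use Suc.prems in auto)
  then obtain f g where fg: "\<forall>i<n. f i \<in> G 0 \<and> \<pi> (f i) = \<pi> (a i) \<and> f i \<otimes> g = \<zero> \<and> g \<otimes> f i = \<zero>"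
      "\<forall>i<n. \<forall>j<n. f i \<otimes> f j = (if i = j then f i else \<zero>)"
    and g: "g \<in> G 0" and sum: "g \<oplus> (\<Oplus>i\<in>{..<n}. f i) = \<one>"
    by (elim exE conjE) (rule that)
  have f: "f i \<in> G 0" "\<pi> (f i) = \<pi> (a i)" "f i \<otimes> g = \<zero>" "g \<otimes> f i = \<zero>" if "i < n" for i
    using fg(1) that by auto
  have ff: "f i \<otimes> f j = (if i = j then f i else \<zero>)" if "i < n" "j < n" for i j
    using fg(2) that by simp
  have gc: "g \<in> carrier R" and fc: "f \<in> {..<n} \<rightarrow> carrier R" using g f(1) by auto
  have fsum: "(\<Oplus>i\<in>{..<n}. f i) \<in> carrier R" using fc by simp
  have an: "a n \<in> G 0" "a n \<in> carrier R" "\<pi> (a n) \<otimes>\<^bsub>S\<^esub> \<pi> (a n) = \<pi> (a n)" using Suc.prems by auto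
  have gg: "g \<otimes> g = g"
  proof -
    have "g \<otimes> (\<Oplus>i\<in>{..<n}. f i) = (\<Oplus>i\<in>{..<n}. g \<otimes> f i)"
      using gc fc by (intro finsum_rdistr) auto
    also have "\<dots> = (\<Oplus>i\<in>{..<n}. \<zero>)" using f(4) by (intro finsum_cong) auto
    finally have "g \<otimes> (\<Oplus>i\<in>{..<n}. f i) = \<zero>" by simp
    moreover have "g \<otimes> (g \<oplus> (\<Oplus>i\<in>{..<n}. f i)) = g" using sum gc by simp
    ultimately show ?thesis using gc fsum by (simp add: r_distr)
  qed
  have psum: "\<pi> g \<oplus>\<^bsub>S\<^esub> (\<Oplus>\<^bsub>S\<^esub>i\<in>{..<n}. \<pi> (a i)) = \<one>\<^bsub>S\<^esub>"
  proof -
    have "\<pi> (\<Oplus>i\<in>{..<n}. f i) = (\<Oplus>\<^bsub>S\<^esub>i\<in>{..<n}. \<pi> (f i))"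
      using fc by (subst hom.hom_finsum) (auto simp: comp_def)
    also have "\<dots> = (\<Oplus>\<^bsub>S\<^esub>i\<in>{..<n}. \<pi> (a i))"
      using Suc.prems(1) f(2) by (intro S.finsum_cong) auto
    finally show ?thesis using sum gc fsum by (metis hom.hom_add hom.hom_one)
  qed
  have pac: "(\<lambda>i. \<pi> (a i)) \<in> {..<n} \<rightarrow> carrier S" using Suc.prems(1) by auto
  have pga: "\<pi> g \<otimes>\<^bsub>S\<^esub> \<pi> (a n) = \<pi> (a n)" "\<pi> (a n) \<otimes>\<^bsub>S\<^esub> \<pi> g = \<pi> (a n)"
  proof -
    have "(\<Oplus>\<^bsub>S\<^esub>i\<in>{..<n}. \<pi> (a i)) \<otimes>\<^bsub>S\<^esub> \<pi> (a n) = (\<Oplus>\<^bsub>S\<^esub>i\<in>{..<n}. \<pi> (a i) \<otimes>\<^bsub>S\<^esub> \<pi> (a n))"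
      using an pac by (intro S.finsum_ldistr) auto
    also have "\<dots> = (\<Oplus>\<^bsub>S\<^esub>i\<in>{..<n}. \<zero>\<^bsub>S\<^esub>)" using Suc.prems(2) by (intro S.finsum_cong) auto
    finally have l: "(\<Oplus>\<^bsub>S\<^esub>i\<in>{..<n}. \<pi> (a i)) \<otimes>\<^bsub>S\<^esub> \<pi> (a n) = \<zero>\<^bsub>S\<^esub>" by simp
    have "\<pi> (a n) \<otimes>\<^bsub>S\<^esub> (\<Oplus>\<^bsub>S\<^esub>i\<in>{..<n}. \<pi> (a i)) = (\<Oplus>\<^bsub>S\<^esub>i\<in>{..<n}. \<pi> (a n) \<otimes>\<^bsub>S\<^esub> \<pi> (a i))"
      using an pac by (intro S.finsum_rdistr) auto
    also have "\<dots> = (\<Oplus>\<^bsub>S\<^esub>i\<in>{..<n}. \<zero>\<^bsub>S\<^esub>)" using Suc.prems(2) by (intro S.finsum_cong) auto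
    finally have r: "\<pi> (a n) \<otimes>\<^bsub>S\<^esub> (\<Oplus>\<^bsub>S\<^esub>i\<in>{..<n}. \<pi> (a i)) = \<zero>\<^bsub>S\<^esub>" by simp
    have sc: "(\<Oplus>\<^bsub>S\<^esub>i\<in>{..<n}. \<pi> (a i)) \<in> carrier S" using pac by simp
    have "(\<pi> g \<oplus>\<^bsub>S\<^esub> (\<Oplus>\<^bsub>S\<^esub>i\<in>{..<n}. \<pi> (a i))) \<otimes>\<^bsub>S\<^esub> \<pi> (a n) = \<pi> (a n)"
      using psum an by simp
    thus "\<pi> g \<otimes>\<^bsub>S\<^esub> \<pi> (a n) = \<pi> (a n)" using l sc gc an by (simp add: S.l_distr)
    have "\<pi> (a n) \<otimes>\<^bsub>S\<^esub> (\<pi> g \<oplus>\<^bsub>S\<^esub> (\<Oplus>\<^bsub>S\<^esub>i\<in>{..<n}. \<pi> (a i))) = \<pi> (a n)"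
      using psum an by simp
    thus "\<pi> (a n) \<otimes>\<^bsub>S\<^esub> \<pi> g = \<pi> (a n)" using r sc gc an by (simp add: S.r_distr)
  qed
  \<comment> \<open>The compression to the corner of \<open>g\<close> has the same image, since \<open>\<pi> g\<close> is complementary to the earlier \<open>\<pi> (a i)\<close>.\<close>
  define b where "b = g \<otimes> a n \<otimes> g"
  have b: "b \<in> G 0" "b \<in> carrier R" unfolding b_def using g an even_even by auto
  have pb: "\<pi> b = \<pi> (a n)" unfolding b_def using gc an pga by simp
  obtain h where h: "h \<in> G 0" "(b \<otimes> h \<otimes> b) \<otimes> (b \<otimes> h \<otimes> b) = b \<otimes> h \<otimes> b" "\<pi> (b \<otimes> h \<otimes> b) = \<pi> b"
    using lift_even_idempotent[OF b(1)] pb an(3) by auto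
  define e where "e = b \<otimes> h \<otimes> b"
  have e: "e \<in> G 0" "e \<in> carrier R" "e \<otimes> e = e" "\<pi> e = \<pi> (a n)"
    using h b pb even_even unfolding e_def by auto
  have gb: "g \<otimes> b = b" "b \<otimes> g = b"
    unfolding b_def using gc an gg by (simp_all add: m_assoc) (simp add: m_assoc[symmetric])
  have ge: "g \<otimes> e = e" "e \<otimes> g = e"
    unfolding e_def using gc b h gb by (simp_all add: m_assoc) (simp add: m_assoc[symmetric])
  have fe: "f i \<otimes> e = \<zero>" "e \<otimes> f i = \<zero>" if "i < n" for i
  proof -
    have c: "f i \<in> carrier R" using f(1)[OF that] by simp
    have "f i \<otimes> e = f i \<otimes> g \<otimes> e" using ge c gc e by (simp add: m_assoc)
    thus "f i \<otimes> e = \<zero>" using f(3)[OF that] e by simp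
    have "e \<otimes> f i = e \<otimes> (g \<otimes> f i)" using ge c gc e by (simp add: m_assoc[symmetric])
    thus "e \<otimes> f i = \<zero>" using f(4)[OF that] e by simp
  qed
  define f' where "f' = (\<lambda>i. if i < n then f i else e)"
  define g' where "g' = g \<ominus> e"
  have f'n: "f' i = f i" if "i < n" for i unfolding f'_def using that by simp
  have f'e: "f' n = e" unfolding f'_def by simp
  have g'G: "g' \<in> G 0" unfolding g'_def using g e by (intro component_minus)
  have sum': "g' \<oplus> (\<Oplus>i\<in>{..<Suc n}. f' i) = \<one>"
  proof -
    have "(\<Oplus>i\<in>{..<Suc n}. f' i) = e \<oplus> (\<Oplus>i\<in>{..<n}. f' i)"
      unfolding lessThan_Suc using fc e f'n f'e by (subst finsum_insert) auto
    also have "(\<Oplus>i\<in>{..<n}. f' i) = (\<Oplus>i\<in>{..<n}. f i)"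
      using fc f'n by (intro finsum_cong) auto
    finally have s: "(\<Oplus>i\<in>{..<Suc n}. f' i) = e \<oplus> (\<Oplus>i\<in>{..<n}. f i)" .
    have "g' \<oplus> (e \<oplus> (\<Oplus>i\<in>{..<n}. f i)) = g \<oplus> (\<Oplus>i\<in>{..<n}. f i)"
      unfolding g'_def using gc e fsum by algebra
    thus ?thesis using s sum by simp
  qed
  have "f' i \<in> G 0 \<and> \<pi> (f' i) = \<pi> (a i) \<and> f' i \<otimes> g' = \<zero> \<and> g' \<otimes> f' i = \<zero>" if "i < Suc n" for i
  proof (cases "i < n")
    case True
    have c: "f i \<in> carrier R" using f(1)[OF True] by simp
    have "f i \<otimes> g' = f i \<otimes> g \<ominus> f i \<otimes> e" "g' \<otimes> f i = g \<otimes> f i \<ominus> e \<otimes> f i"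
      unfolding g'_def using c gc e by (simp_all add: a_minus_def r_distr l_distr r_minus l_minus)
    thus ?thesis using True f fe f'n by (simp add: a_minus_def)
  next
    case False
    hence "i = n" using that by simp
    have "e \<otimes> g' = e \<otimes> g \<ominus> e \<otimes> e" "g' \<otimes> e = g \<otimes> e \<ominus> e \<otimes> e"
      unfolding g'_def using gc e(2) by (simp_all only: a_minus_def r_distr l_distr r_minus l_minus a_inv_closed)
    hence "e \<otimes> g' = \<zero>" "g' \<otimes> e = \<zero>" using ge e by (simp_all add: a_minus_def r_neg)
    thus ?thesis using e f'e \<open>i = n\<close> by simp
  qed
  moreover have "f' i \<otimes> f' j = (if i = j then f' i else \<zero>)" if "i < Suc n" "j < Suc n" for i j
    using that ff fe e(3) unfolding f'_def by auto
  ultimately show ?case using g'G sum' by (intro exI[of _ f'] exI[of _ g']) simp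
qed

text \<open>If the images add up to \<open>1\<close>, the complementary idempotent lies in the kernel and is nilpotent, thus zero.\<close>

lemma lift_complete_orthogonal_idempotents:
  fixes n :: nat and a :: "nat \<Rightarrow> 'a"
  assumes a: "\<And>i. i < n \<Longrightarrow> a i \<in> G 0"
    and orth: "\<And>i j. \<lbrakk>i < n; j < n\<rbrakk> \<Longrightarrow> \<pi> (a i) \<otimes>\<^bsub>S\<^esub> \<pi> (a j) = (if i = j then \<pi> (a i) else \<zero>\<^bsub>S\<^esub>)"
    and sum: "(\<Oplus>\<^bsub>S\<^esub>i\<in>{..<n}. \<pi> (a i)) = \<one>\<^bsub>S\<^esub>"
  obtains f where "\<And>i. i < n \<Longrightarrow> f i \<in> G 0" "\<And>i. i < n \<Longrightarrow> \<pi> (f i) = \<pi> (a i)"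
    "\<And>i j. \<lbrakk>i < n; j < n\<rbrakk> \<Longrightarrow> f i \<otimes> f j = (if i = j then f i else \<zero>)" "(\<Oplus>i\<in>{..<n}. f i) = \<one>"
proof -
  have "\<exists>f g. (\<forall>i<n. f i \<in> G 0 \<and> \<pi> (f i) = \<pi> (a i) \<and> f i \<otimes> g = \<zero> \<and> g \<otimes> f i = \<zero>) \<and> g \<in> G 0 \<and>
      (\<forall>i<n. \<forall>j<n. f i \<otimes> f j = (if i = j then f i else \<zero>)) \<and> g \<oplus> (\<Oplus>i\<in>{..<n}. f i) = \<one>"
    by (rule lift_orthogonal_idempotents) (use a orth in auto)
  then obtain f g where f': "\<forall>i<n. f i \<in> G 0 \<and> \<pi> (f i) = \<pi> (a i) \<and> f i \<otimes> g = \<zero> \<and> g \<otimes> f i = \<zero>"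
      "\<forall>i<n. \<forall>j<n. f i \<otimes> f j = (if i = j then f i else \<zero>)"
    and g: "g \<in> G 0" and fg: "g \<oplus> (\<Oplus>i\<in>{..<n}. f i) = \<one>"
    by (elim exE conjE) (rule that)
  have f: "f i \<in> G 0" "\<pi> (f i) = \<pi> (a i)" "g \<otimes> f i = \<zero>" if "i < n" for i
    using f'(1) that by auto
  have ff: "f i \<otimes> f j = (if i = j then f i else \<zero>)" if "i < n" "j < n" for i j
    using f'(2) that by simp
  have gc: "g \<in> carrier R" and fc: "f \<in> {..<n} \<rightarrow> carrier R" using g f(1) by auto
  have fsum: "(\<Oplus>i\<in>{..<n}. f i) \<in> carrier R" using fc by simp
  have "g \<otimes> (\<Oplus>i\<in>{..<n}. f i) = (\<Oplus>i\<in>{..<n}. g \<otimes> f i)"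
    using gc fc by (intro finsum_rdistr) auto
  also have "\<dots> = (\<Oplus>i\<in>{..<n}. \<zero>)" using f(3) by (intro finsum_cong) auto
  finally have "g \<otimes> (\<Oplus>i\<in>{..<n}. f i) = \<zero>" by simp
  moreover have "g \<otimes> (g \<oplus> (\<Oplus>i\<in>{..<n}. f i)) = g" using fg gc by simp
  ultimately have gg: "g \<otimes> g = g" using gc fsum by (simp add: r_distr)
  have "\<pi> (\<Oplus>i\<in>{..<n}. f i) = (\<Oplus>\<^bsub>S\<^esub>i\<in>{..<n}. \<pi> (f i))"
    using fc by (subst hom.hom_finsum) (auto simp: comp_def)
  also have "\<dots> = (\<Oplus>\<^bsub>S\<^esub>i\<in>{..<n}. \<pi> (a i))"
    using a f(2) by (intro S.finsum_cong) auto
  finally have "\<pi> g \<oplus>\<^bsub>S\<^esub> \<one>\<^bsub>S\<^esub> = \<one>\<^bsub>S\<^esub>" using sum fg gc fsum by (metis hom.hom_add hom.hom_one)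
  hence "\<pi> g = \<zero>\<^bsub>S\<^esub>" using gc by simp
  hence "g = \<zero>" using kernel_even_idempotent_zero[OF g gg] by simp
  hence "(\<Oplus>i\<in>{..<n}. f i) = \<one>" using fg fsum by simp
  thus ?thesis using that f ff by blast
qed

text \<open>Replacing \<open>v\<close> by \<open>f v f\<close> puts it into the corner with unit \<open>f\<close> without changing its image; there its
  square differs from \<open>f\<close> by an even element of the kernel.\<close>

lemma lift_odd_square_root:
  assumes f: "f \<in> G 0" "f \<otimes> f = f" and v: "v \<in> G 1" and pv: "\<pi> v \<otimes>\<^bsub>S\<^esub> \<pi> v = \<pi> f"
    "\<pi> f \<otimes>\<^bsub>S\<^esub> \<pi> v = \<pi> v" "\<pi> v \<otimes>\<^bsub>S\<^esub> \<pi> f = \<pi> v"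
  shows "\<exists>w\<in>G 1. w \<otimes> w = f \<and> f \<otimes> w = w \<and> w \<otimes> f = w \<and> \<pi> w = \<pi> v"
proof -
  obtain \<eta> where eta: "\<eta> \<in> F" "\<eta> \<oplus> \<eta> = \<one>" using scalars_half by blast
  define u where "u = f \<otimes> v \<otimes> f"
  define h where "h = \<eta> \<otimes> (f \<ominus> u \<otimes> u)"
  have c: "f \<in> carrier R" "v \<in> carrier R" "\<eta> \<in> carrier R" using f v eta by auto
  have uG: "u \<in> G 1" unfolding u_def using f v even_odd odd_even by blast
  have uc: "u \<in> carrier R" using uG by simp
  have fu: "f \<otimes> u = u" "u \<otimes> f = u"
    unfolding u_def using c f by (simp_all add: m_assoc) (simp add: m_assoc[symmetric])
  have pu: "\<pi> u = \<pi> v" unfolding u_def using c pv by simp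
  have dG: "f \<ominus> u \<otimes> u \<in> G 0" using f uG odd_odd by (intro component_minus)
  have hG: "h \<in> G 0" unfolding h_def using dG eta scalars_even even_even by blast
  have hc: "h \<in> carrier R" "f \<ominus> u \<otimes> u \<in> carrier R" using hG dG by auto
  have "\<pi> (f \<ominus> u \<otimes> u) = \<zero>\<^bsub>S\<^esub>"
    using c uc pu pv by (simp add: a_minus_def S.r_neg)
  hence "\<pi> h = \<zero>\<^bsub>S\<^esub>" unfolding h_def using c hc by simp
  then obtain m :: nat where nil: "h [^] Suc m = \<zero>" using kernel_even_nilpotent_Suc[OF hG] by blast
  have fuu: "f \<otimes> (u \<otimes> u) = u \<otimes> u" "u \<otimes> u \<otimes> f = u \<otimes> u"
    using fu c uc by (simp_all add: m_assoc) (simp add: m_assoc[symmetric])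
  have fd: "f \<otimes> (f \<ominus> u \<otimes> u) = f \<ominus> u \<otimes> u" "(f \<ominus> u \<otimes> u) \<otimes> f = f \<ominus> u \<otimes> u"
    using c uc fuu f(2) by (simp_all add: a_minus_def r_distr l_distr r_minus l_minus)
  have ud: "(f \<ominus> u \<otimes> u) \<otimes> u = u \<otimes> (f \<ominus> u \<otimes> u)"
    using c uc fu by (simp add: a_minus_def r_distr l_distr r_minus l_minus m_assoc)
  have fh: "f \<otimes> h = h"
    unfolding h_def using c hc eta fd(1) scalars_central[OF eta(1), of f] by (metis m_assoc)
  have hf: "h \<otimes> f = h"
    unfolding h_def using c hc fd(2) by (simp add: m_assoc)
  have hu: "h \<otimes> u = u \<otimes> h"
    unfolding h_def using c hc uc ud scalars_central[OF eta(1), of u] by (metis m_assoc)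
  have hh: "h \<oplus> h = f \<ominus> u \<otimes> u"
    unfolding h_def using c hc eta(2) by (metis l_distr l_one)
  have sum: "u \<otimes> u \<oplus> h \<oplus> h = f"
  proof -
    have "u \<otimes> u \<oplus> h \<oplus> h = u \<otimes> u \<oplus> (h \<oplus> h)" using uc hc by (simp add: a_assoc)
    also have "\<dots> = f" unfolding hh using uc c by algebra
    finally show ?thesis .
  qed
  have etaG: "\<eta> \<in> G 0" using eta scalars_even by blast
  obtain t where t: "t \<in> G 0" "u \<otimes> (\<one> \<oplus> h \<otimes> t) \<otimes> (u \<otimes> (\<one> \<oplus> h \<otimes> t)) = f"
      "u \<otimes> (\<one> \<oplus> h \<otimes> t) \<otimes> f = u \<otimes> (\<one> \<oplus> h \<otimes> t)"
    using square_root_from_nilpotent_defect[OF even_subring f(1) etaG eta(2) scalars_central[OF eta(1)]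
        uc hG fu fh hf hu sum nil] by blast
  have "\<one> \<oplus> h \<otimes> t \<in> G 0" using one_even hG t(1) by (intro component_add even_even)
  hence "u \<otimes> (\<one> \<oplus> h \<otimes> t) \<in> G 1" using uG odd_even by blast
  moreover have "f \<otimes> (u \<otimes> (\<one> \<oplus> h \<otimes> t)) = u \<otimes> (\<one> \<oplus> h \<otimes> t)"
    using fu c uc hc t(1) by (simp add: m_assoc[symmetric])
  moreover have "\<pi> (u \<otimes> (\<one> \<oplus> h \<otimes> t)) = \<pi> v"
    using uc hc t(1) \<open>\<pi> h = \<zero>\<^bsub>S\<^esub>\<close> pu c by simp
  ultimately show ?thesis using t by blast
qed

section \<open>Graded division summands and the complement\<close>

text \<open>The ideal \<open>I\<close> is a summand of the target with unit \<open>e\<close> in which nonzero homogeneous elements are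
  invertible. In a product of linear factors that annihilates \<open>x\<close>, each factor \<open>x - l\<close> acts on \<open>I\<close> as
  \<open>\<pi> x - \<pi> l e\<close>, which is even, so it is zero or can be cancelled. If all factors are cancelled,
  then \<open>e = 0\<close> and \<open>I\<close> is trivial.\<close>

lemma block_even:
  assumes I: "ideal I S" and e: "e \<in> I" "\<And>y. y \<in> I \<Longrightarrow> e \<otimes>\<^bsub>S\<^esub> y = y"
    and a: "a \<in> G 0" "\<pi> a = e"
    and div: "\<And>g x. \<lbrakk>x \<in> G g; \<pi> x \<in> I; \<pi> x \<noteq> \<zero>\<^bsub>S\<^esub>\<rbrakk> \<Longrightarrow> \<exists>y\<in>I. y \<otimes>\<^bsub>S\<^esub> \<pi> x = e"
    and x: "x \<in> G 0" "\<pi> x \<in> I"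
  shows "\<exists>c\<in>F. \<pi> x = \<pi> c \<otimes>\<^bsub>S\<^esub> e"
proof -
  interpret I: ideal I S by (rule I)
  have c: "x \<in> carrier R" "a \<in> carrier R" "e \<in> carrier S" using x a by auto
  obtain ls where ls: "set ls \<subseteq> F" "foldr (\<lambda>l y. (x \<ominus> l) \<otimes> y) ls \<one> = \<zero>"
    using even_split[OF x(1)] by blast
  have pc: "set ls \<subseteq> F \<Longrightarrow> foldr (\<lambda>l y. (x \<ominus> l) \<otimes> y) ls \<one> \<in> carrier R" for ls
    by (induction ls) (use c in auto)
  have "\<lbrakk>set ls \<subseteq> F; \<pi> (foldr (\<lambda>l y. (x \<ominus> l) \<otimes> y) ls \<one>) \<otimes>\<^bsub>S\<^esub> e = \<zero>\<^bsub>S\<^esub>\<rbrakk> \<Longrightarrow> ?thesis" for ls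
  proof (induction ls)
    case Nil
    hence "e = \<zero>\<^bsub>S\<^esub>" using c by simp
    hence "\<pi> x = \<zero>\<^bsub>S\<^esub>" using e(2)[OF x(2)] c(1) by (metis S.l_null hom.hom_closed)
    hence "\<pi> x = \<pi> \<zero> \<otimes>\<^bsub>S\<^esub> e" using c(3) by simp
    thus ?case using scalar_closed(1) by blast
  next
    case (Cons l ls)
    let ?p = "foldr (\<lambda>l y. (x \<ominus> l) \<otimes> y) ls \<one>"
    have l: "l \<in> F" "l \<in> carrier R" and p: "?p \<in> carrier R" using Cons.prems pc by auto
    let ?w = "\<pi> ?p \<otimes>\<^bsub>S\<^esub> e"
    have w: "?w \<in> I" "?w \<in> carrier S" using p e(1) c I.I_l_closed by auto
    have "\<pi> (x \<ominus> l \<otimes> a) \<otimes>\<^bsub>S\<^esub> ?w = \<pi> x \<otimes>\<^bsub>S\<^esub> ?w \<ominus>\<^bsub>S\<^esub> \<pi> l \<otimes>\<^bsub>S\<^esub> (e \<otimes>\<^bsub>S\<^esub> ?w)"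
      using c l p a by (simp add: a_minus_def S.l_distr S.l_minus S.m_assoc)
    also have "\<dots> = \<pi> x \<otimes>\<^bsub>S\<^esub> ?w \<ominus>\<^bsub>S\<^esub> \<pi> l \<otimes>\<^bsub>S\<^esub> ?w" using e(2)[OF w(1)] by simp
    also have "\<dots> = \<pi> ((x \<ominus> l) \<otimes> ?p) \<otimes>\<^bsub>S\<^esub> e"
      using c l p by (simp add: a_minus_def S.l_distr S.l_minus S.m_assoc)
    also have "\<dots> = \<zero>\<^bsub>S\<^esub>" using Cons.prems by simp
    finally have 0: "\<pi> (x \<ominus> l \<otimes> a) \<otimes>\<^bsub>S\<^esub> ?w = \<zero>\<^bsub>S\<^esub>" .
    have la: "l \<otimes> a \<in> G 0" using l a scalars_even even_even by blast
    have in0: "x \<ominus> l \<otimes> a \<in> G 0" using x la by (intro component_minus)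
    have pla: "\<pi> (x \<ominus> l \<otimes> a) = \<pi> x \<ominus>\<^bsub>S\<^esub> \<pi> l \<otimes>\<^bsub>S\<^esub> e"
      using c l a by (simp add: a_minus_def)
    have "\<pi> l \<otimes>\<^bsub>S\<^esub> e \<in> I" using I.I_l_closed e l by simp
    hence inI: "\<pi> (x \<ominus> l \<otimes> a) \<in> I"
      unfolding pla unfolding a_minus_def using x(2) by (intro I.a_closed I.a_inv_closed)
    show ?case
    proof (cases "\<pi> (x \<ominus> l \<otimes> a) = \<zero>\<^bsub>S\<^esub>")
      case True
      hence "\<pi> x = \<pi> l \<otimes>\<^bsub>S\<^esub> e" using pla c l by simp
      thus ?thesis using l by blast
    next
      case False
      obtain y where y: "y \<in> I" "y \<otimes>\<^bsub>S\<^esub> \<pi> (x \<ominus> l \<otimes> a) = e" using div[OF in0 inI False] by blast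
      have yc: "y \<in> carrier S" "\<pi> (x \<ominus> l \<otimes> a) \<in> carrier S" using y inI by auto
      have "?w = (y \<otimes>\<^bsub>S\<^esub> \<pi> (x \<ominus> l \<otimes> a)) \<otimes>\<^bsub>S\<^esub> ?w" using y e(2)[OF w(1)] by simp
      also have "\<dots> = y \<otimes>\<^bsub>S\<^esub> (\<pi> (x \<ominus> l \<otimes> a) \<otimes>\<^bsub>S\<^esub> ?w)" using yc w by (intro S.m_assoc)
      also have "\<dots> = \<zero>\<^bsub>S\<^esub>" unfolding 0 using yc by simp
      finally show ?thesis using Cons.IH Cons.prems by simp
    qed
  qed
  from this[OF ls(1)] show ?thesis using ls(2) c by simp
qed

text \<open>The square of an odd \<open>u \<noteq> 0\<close> in \<open>I\<close> is a scalar multiple \<open>c e\<close> by the even case, with \<open>c \<noteq> 0\<close>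
  as \<open>u\<close> is invertible; division by a square root of \<open>c\<close> gives \<open>v\<close> with \<open>v\<^sup>2 = e\<close>. For every odd \<open>x\<close>
  in \<open>I\<close> the product \<open>v x\<close> is a scalar multiple of \<open>e\<close>, so that \<open>x = v (v x)\<close> is a scalar multiple of \<open>v\<close>.\<close>

lemma block_odd:
  assumes I: "ideal I S" and e: "e \<in> I" "\<And>y. y \<in> I \<Longrightarrow> e \<otimes>\<^bsub>S\<^esub> y = y" "\<And>y. y \<in> I \<Longrightarrow> y \<otimes>\<^bsub>S\<^esub> e = y"
    and a: "a \<in> G 0" "\<pi> a = e"
    and div: "\<And>g x. \<lbrakk>x \<in> G g; \<pi> x \<in> I; \<pi> x \<noteq> \<zero>\<^bsub>S\<^esub>\<rbrakk> \<Longrightarrow> \<exists>y\<in>I. y \<otimes>\<^bsub>S\<^esub> \<pi> x = e"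
  shows "\<exists>v\<in>G 1. \<pi> v \<in> I \<and> (\<pi> v \<otimes>\<^bsub>S\<^esub> \<pi> v = e \<or> v = \<zero>) \<and>
    (\<forall>x\<in>G 1. \<pi> x \<in> I \<longrightarrow> (\<exists>c\<in>F. \<pi> x = \<pi> c \<otimes>\<^bsub>S\<^esub> \<pi> v))"
proof (cases "\<forall>x\<in>G 1. \<pi> x \<in> I \<longrightarrow> \<pi> x = \<zero>\<^bsub>S\<^esub>")
  case True
  interpret I: ideal I S by (rule I)
  have "\<pi> x = \<pi> \<zero> \<otimes>\<^bsub>S\<^esub> \<pi> \<zero>" if "x \<in> G 1" "\<pi> x \<in> I" for x
  proof -
    have "\<pi> x = \<zero>\<^bsub>S\<^esub>" using True that by blast
    thus ?thesis by simp
  qed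
  hence "\<forall>x\<in>G 1. \<pi> x \<in> I \<longrightarrow> (\<exists>c\<in>F. \<pi> x = \<pi> c \<otimes>\<^bsub>S\<^esub> \<pi> \<zero>)"
    using scalar_closed(1) by blast
  moreover have "\<pi> \<zero> \<in> I" by simp
  ultimately show ?thesis using component_zero[of 1] by blast
next
  case False
  interpret I: ideal I S by (rule I)
  have even: "\<exists>c\<in>F. \<pi> x = \<pi> c \<otimes>\<^bsub>S\<^esub> e" if "x \<in> G 0" "\<pi> x \<in> I" for x
    by (rule block_even[OF I e(1,2) a div that])
  obtain u where u: "u \<in> G 1" "\<pi> u \<in> I" "\<pi> u \<noteq> \<zero>\<^bsub>S\<^esub>" using False by blast
  have uc: "u \<in> carrier R" "e \<in> carrier S" using u e by auto
  obtain y where y: "y \<in> I" "y \<otimes>\<^bsub>S\<^esub> \<pi> u = e" using div[OF u] by blast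
  have yc: "y \<in> carrier S" using y by simp
  have "\<pi> (u \<otimes> u) \<in> I" using u uc I.I_l_closed by simp
  then obtain c where c: "c \<in> F" "\<pi> (u \<otimes> u) = \<pi> c \<otimes>\<^bsub>S\<^esub> e"
    using even[OF odd_odd[OF u(1) u(1)]] by blast
  have "c \<noteq> \<zero>"
  proof
    assume "c = \<zero>"
    hence 0: "\<pi> u \<otimes>\<^bsub>S\<^esub> \<pi> u = \<zero>\<^bsub>S\<^esub>" using c uc by simp
    have "\<pi> u = (y \<otimes>\<^bsub>S\<^esub> \<pi> u) \<otimes>\<^bsub>S\<^esub> \<pi> u" using y e(2)[OF u(2)] by simp
    also have "\<dots> = y \<otimes>\<^bsub>S\<^esub> (\<pi> u \<otimes>\<^bsub>S\<^esub> \<pi> u)" using yc uc by (intro S.m_assoc) auto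
    finally show False using u(3) yc unfolding 0 by simp
  qed
  obtain s where s: "s \<in> F" "s \<otimes> s = c" using scalars_sqrt[OF c(1)] by blast
  hence "s \<noteq> \<zero>" using \<open>c \<noteq> \<zero>\<close> by auto
  then obtain t where t: "t \<in> F" "t \<otimes> s = \<one>" using scalars_inverse[OF s(1)] by blast
  have st: "s \<in> carrier R" "t \<in> carrier R" using s t by auto
  have tG: "t \<in> G 0" using t scalars_even by blast
  let ?v = "t \<otimes> u"
  have vG: "?v \<in> G 1" using even_odd[OF tG u(1)] .
  have vI: "\<pi> ?v \<in> I" using st uc u(2) I.I_l_closed by simp
  have tc: "t \<otimes> t \<otimes> c = \<one>"
  proof -
    have "t \<otimes> t \<otimes> (s \<otimes> s) = t \<otimes> (t \<otimes> s) \<otimes> s" using st by (simp add: m_assoc)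
    thus ?thesis using s t st by simp
  qed
  have "?v \<otimes> ?v = t \<otimes> t \<otimes> (u \<otimes> u)"
  proof -
    have "?v \<otimes> ?v = t \<otimes> (u \<otimes> t) \<otimes> u" using st uc by (simp add: m_assoc)
    also have "u \<otimes> t = t \<otimes> u" using scalars_central[OF t(1)] uc by simp
    finally show ?thesis using st uc by (simp add: m_assoc)
  qed
  hence "\<pi> ?v \<otimes>\<^bsub>S\<^esub> \<pi> ?v = \<pi> (t \<otimes> t) \<otimes>\<^bsub>S\<^esub> \<pi> (u \<otimes> u)" using st uc by (metis hom.hom_mult m_closed)
  also have "\<dots> = \<pi> (t \<otimes> t \<otimes> c) \<otimes>\<^bsub>S\<^esub> e" unfolding c(2) using st c(1) uc by (simp add: S.m_assoc)
  also have "\<dots> = e" unfolding tc using uc by simp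
  finally have vv: "\<pi> ?v \<otimes>\<^bsub>S\<^esub> \<pi> ?v = e" .
  have "\<exists>d\<in>F. \<pi> x = \<pi> d \<otimes>\<^bsub>S\<^esub> \<pi> ?v" if x: "x \<in> G 1" "\<pi> x \<in> I" for x
  proof -
    have xc: "x \<in> carrier R" "?v \<in> carrier R" using x vG by auto
    have "\<pi> (?v \<otimes> x) \<in> I" using xc x(2) I.I_l_closed by simp
    then obtain d where d: "d \<in> F" "\<pi> (?v \<otimes> x) = \<pi> d \<otimes>\<^bsub>S\<^esub> e"
      using even[OF odd_odd[OF vG x(1)]] by blast
    have dc: "d \<in> carrier R" using d by simp
    have "\<pi> x = \<pi> ?v \<otimes>\<^bsub>S\<^esub> \<pi> ?v \<otimes>\<^bsub>S\<^esub> \<pi> x" using vv e(2)[OF x(2)] by simp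
    also have "\<dots> = \<pi> ?v \<otimes>\<^bsub>S\<^esub> \<pi> (?v \<otimes> x)" using xc by (simp add: S.m_assoc)
    also have "\<dots> = \<pi> (?v \<otimes> d) \<otimes>\<^bsub>S\<^esub> e" unfolding d(2) using xc dc uc by (simp add: S.m_assoc)
    also have "?v \<otimes> d = d \<otimes> ?v" using scalars_central[OF d(1)] xc by simp
    also have "\<pi> (d \<otimes> ?v) \<otimes>\<^bsub>S\<^esub> e = \<pi> d \<otimes>\<^bsub>S\<^esub> (\<pi> ?v \<otimes>\<^bsub>S\<^esub> e)"
      using xc(2) dc uc(2) by (simp only: hom.hom_mult hom.hom_closed S.m_assoc)
    also have "\<pi> ?v \<otimes>\<^bsub>S\<^esub> e = \<pi> ?v" using e(3)[OF vI] .
    finally show ?thesis using d(1) by blast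
  qed
  thus ?thesis using vG vI vv by blast
qed

lemma lift_block:
  assumes I: "ideal I S" and e: "e \<in> I" "\<And>y. y \<in> I \<Longrightarrow> e \<otimes>\<^bsub>S\<^esub> y = y" "\<And>y. y \<in> I \<Longrightarrow> y \<otimes>\<^bsub>S\<^esub> e = y"
    and div: "\<And>g x. \<lbrakk>x \<in> G g; \<pi> x \<in> I; \<pi> x \<noteq> \<zero>\<^bsub>S\<^esub>\<rbrakk> \<Longrightarrow> \<exists>y\<in>I. y \<otimes>\<^bsub>S\<^esub> \<pi> x = e"
    and f: "f \<in> G 0" "f \<otimes> f = f" "\<pi> f = e"
  shows "\<exists>w\<in>G 1. f \<otimes> w = w \<and> w \<otimes> f = w \<and> (w \<otimes> w = f \<or> w = \<zero>) \<and>
    (\<forall>x\<in>carrier R. \<exists>c\<in>F. \<exists>d\<in>F. \<pi> (f \<otimes> x) = \<pi> (c \<otimes> f \<oplus> d \<otimes> w))"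
proof -
  interpret I: ideal I S by (rule I)
  have "\<exists>v\<in>G 1. \<pi> v \<in> I \<and> (\<pi> v \<otimes>\<^bsub>S\<^esub> \<pi> v = e \<or> v = \<zero>) \<and>
      (\<forall>x\<in>G 1. \<pi> x \<in> I \<longrightarrow> (\<exists>c\<in>F. \<pi> x = \<pi> c \<otimes>\<^bsub>S\<^esub> \<pi> v))"
    by (rule block_odd[OF I e f(1,3) div])
  then obtain v where v: "v \<in> G 1" "\<pi> v \<in> I" "\<pi> v \<otimes>\<^bsub>S\<^esub> \<pi> v = e \<or> v = \<zero>"
    and odd: "\<forall>x\<in>G 1. \<pi> x \<in> I \<longrightarrow> (\<exists>c\<in>F. \<pi> x = \<pi> c \<otimes>\<^bsub>S\<^esub> \<pi> v)"
    by blast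
  have even: "\<exists>c\<in>F. \<pi> x = \<pi> c \<otimes>\<^bsub>S\<^esub> e" if "x \<in> G 0" "\<pi> x \<in> I" for x
    by (rule block_even[OF I e(1,2) f(1,3) div that])
  have "\<exists>w\<in>G 1. f \<otimes> w = w \<and> w \<otimes> f = w \<and> (w \<otimes> w = f \<or> w = \<zero>) \<and> \<pi> w = \<pi> v"
  proof (cases "v = \<zero>")
    case True
    thus ?thesis using f by (intro bexI[of _ \<zero>]) auto
  next
    case False
    hence "\<pi> v \<otimes>\<^bsub>S\<^esub> \<pi> v = \<pi> f" "\<pi> f \<otimes>\<^bsub>S\<^esub> \<pi> v = \<pi> v" "\<pi> v \<otimes>\<^bsub>S\<^esub> \<pi> f = \<pi> v"
      using v f(3) e(2,3) by auto
    thus ?thesis using lift_odd_square_root[OF f(1,2) v(1)] by blast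
  qed
  then obtain w where w: "w \<in> G 1" "f \<otimes> w = w" "w \<otimes> f = w" "w \<otimes> w = f \<or> w = \<zero>" "\<pi> w = \<pi> v"
    by blast
  have "\<exists>c\<in>F. \<exists>d\<in>F. \<pi> (f \<otimes> x) = \<pi> (c \<otimes> f \<oplus> d \<otimes> w)" if x: "x \<in> carrier R" for x
  proof -
    obtain y z where yz: "y \<in> G 0" "z \<in> G 1" "x = y \<oplus> z" using decomposition[OF x] by blast
    have c: "f \<in> carrier R" "y \<in> carrier R" "z \<in> carrier R" "w \<in> carrier R" using yz f w by auto
    have "\<pi> (f \<otimes> y) \<in> I" "\<pi> (f \<otimes> z) \<in> I"
      using c f(3) e(1) I.I_r_closed by auto
    then obtain c' d where cd: "c' \<in> F" "\<pi> (f \<otimes> y) = \<pi> c' \<otimes>\<^bsub>S\<^esub> e" "d \<in> F" "\<pi> (f \<otimes> z) = \<pi> d \<otimes>\<^bsub>S\<^esub> \<pi> v"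
      using even[OF even_even[OF f(1) yz(1)]] odd even_odd[OF f(1) yz(2)] by blast
    have cdc: "c' \<in> carrier R" "d \<in> carrier R" using cd by auto
    have "\<pi> (f \<otimes> x) = \<pi> (f \<otimes> y) \<oplus>\<^bsub>S\<^esub> \<pi> (f \<otimes> z)"
      unfolding yz(3) using c by (simp add: S.r_distr)
    also have "\<dots> = \<pi> (c' \<otimes> f \<oplus> d \<otimes> w)"
      unfolding cd(2,4) using c cdc f(3) w(5) by simp
    finally show ?thesis using cd by blast
  qed
  thus ?thesis using w by blast
qed

text \<open>If \<open>c f\<close> with \<open>c \<noteq> 0\<close> lies in the kernel, then so does the idempotent \<open>f\<close>, which is then zero. The odd
  summand is reduced to this case by multiplication with \<open>w\<close>.\<close>

lemma span_kernel_zero: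
  assumes f: "f \<in> G 0" "f \<otimes> f = f" and w: "w \<in> G 1" "f \<otimes> w = w" "w \<otimes> f = w" "w \<otimes> w = f \<or> w = \<zero>"
    and cd: "c \<in> F" "d \<in> F" and ker: "\<pi> (c \<otimes> f \<oplus> d \<otimes> w) = \<zero>\<^bsub>S\<^esub>"
  shows "c \<otimes> f = \<zero>" and "d \<otimes> w = \<zero>"
proof -
  have scalar: "c \<otimes> f = \<zero>" if c: "c \<in> F" and 0: "\<pi> (c \<otimes> f) = \<zero>\<^bsub>S\<^esub>" for c
  proof (cases "c = \<zero>")
    case False
    then obtain c' where c': "c' \<in> F" "c' \<otimes> c = \<one>" using scalars_inverse[OF c] by blast
    have carr: "c \<in> carrier R" "c' \<in> carrier R" "f \<in> carrier R" using c c' f by auto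
    have "f = c' \<otimes> (c \<otimes> f)" using carr c' by (simp add: m_assoc[symmetric])
    hence "\<pi> f = \<pi> c' \<otimes>\<^bsub>S\<^esub> \<pi> (c \<otimes> f)" using carr by (metis hom.hom_mult m_closed)
    hence "\<pi> f = \<zero>\<^bsub>S\<^esub>" unfolding 0 using carr by simp
    hence "f = \<zero>" using kernel_even_idempotent_zero[OF f] by simp
    thus ?thesis using carr by simp
  qed (use f in simp)
  have carr: "c \<in> carrier R" "d \<in> carrier R" "f \<in> carrier R" "w \<in> carrier R" using cd f w by auto
  have hom: "c \<otimes> f \<in> G 0" "d \<otimes> w \<in> G 1" using cd f w scalars_even even_even even_odd by blast+
  have cf: "\<pi> (c \<otimes> f) = \<zero>\<^bsub>S\<^esub>" using kernel_graded[OF hom ker] .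
  thus "c \<otimes> f = \<zero>" using scalar[OF cd(1)] by simp
  have dw: "\<pi> (d \<otimes> w) = \<zero>\<^bsub>S\<^esub>"
    using ker cf carr by (metis hom.hom_add hom.hom_closed m_closed S.l_zero)
  show "d \<otimes> w = \<zero>"
  proof (cases "w = \<zero>")
    case False
    hence "d \<otimes> f = d \<otimes> w \<otimes> w" using w(4) carr by (simp add: m_assoc)
    hence "\<pi> (d \<otimes> f) = \<pi> (d \<otimes> w) \<otimes>\<^bsub>S\<^esub> \<pi> w" using carr by (metis hom.hom_mult m_closed)
    hence "\<pi> (d \<otimes> f) = \<zero>\<^bsub>S\<^esub>" unfolding dw using carr by simp
    hence df: "d \<otimes> f = \<zero>" using scalar[OF cd(2)] by simp
    have "d \<otimes> w = d \<otimes> f \<otimes> w" using w(2) carr by (simp add: m_assoc)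
    thus ?thesis unfolding df using carr by simp
  qed (use carr in simp)
qed

lemma span_mult:
  assumes f: "f \<in> G 0" "f \<otimes> f = f" and w: "w \<in> G 1" "f \<otimes> w = w" "w \<otimes> f = w" "w \<otimes> w = f \<or> w = \<zero>"
    and cd: "c \<in> F" "d \<in> F" "c' \<in> F" "d' \<in> F"
  shows "\<exists>p\<in>F. \<exists>q\<in>F. (c \<otimes> f \<oplus> d \<otimes> w) \<otimes> (c' \<otimes> f \<oplus> d' \<otimes> w) = p \<otimes> f \<oplus> q \<otimes> w"
proof -
  have carr: "c \<in> carrier R" "d \<in> carrier R" "c' \<in> carrier R" "d' \<in> carrier R" "f \<in> carrier R" "w \<in> carrier R"
    using cd f w by auto
  have sw: "(x \<otimes> y) \<otimes> (x' \<otimes> y') = (x \<otimes> x') \<otimes> (y \<otimes> y')"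
    if "x \<in> F" "x' \<in> F" "y \<in> carrier R" "y' \<in> carrier R" for x x' y y'
  proof -
    have xc: "x \<in> carrier R" "x' \<in> carrier R" using that by auto
    have "(x \<otimes> y) \<otimes> (x' \<otimes> y') = x \<otimes> (y \<otimes> x') \<otimes> y'" using xc that(3,4) by (simp add: m_assoc)
    also have "y \<otimes> x' = x' \<otimes> y" using scalars_central[OF that(2,3)] by simp
    finally show ?thesis using xc that(3,4) by (simp add: m_assoc)
  qed
  have "(c \<otimes> f \<oplus> d \<otimes> w) \<otimes> (c' \<otimes> f \<oplus> d' \<otimes> w) =
      (c \<otimes> f) \<otimes> (c' \<otimes> f) \<oplus> (c \<otimes> f) \<otimes> (d' \<otimes> w) \<oplus> ((d \<otimes> w) \<otimes> (c' \<otimes> f) \<oplus> (d \<otimes> w) \<otimes> (d' \<otimes> w))"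
    using carr by (simp add: l_distr r_distr a_ac)
  also have "\<dots> = (c \<otimes> c') \<otimes> f \<oplus> (c \<otimes> d') \<otimes> w \<oplus> ((d \<otimes> c') \<otimes> w \<oplus> (d \<otimes> d') \<otimes> (w \<otimes> w))"
    using sw cd carr f w by simp
  finally have eq: "(c \<otimes> f \<oplus> d \<otimes> w) \<otimes> (c' \<otimes> f \<oplus> d' \<otimes> w) =
    (c \<otimes> c') \<otimes> f \<oplus> (c \<otimes> d') \<otimes> w \<oplus> ((d \<otimes> c') \<otimes> w \<oplus> (d \<otimes> d') \<otimes> (w \<otimes> w))" .
  show ?thesis
  proof (cases "w = \<zero>")
    case True
    have "(c \<otimes> f \<oplus> d \<otimes> w) \<otimes> (c' \<otimes> f \<oplus> d' \<otimes> w) = (c \<otimes> c') \<otimes> f \<oplus> \<zero> \<otimes> w"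
      unfolding eq using carr True by simp
    thus ?thesis using cd by (intro bexI[of _ "c \<otimes> c'"] bexI[of _ \<zero>]) simp_all
  next
    case False
    have "(c \<otimes> f \<oplus> d \<otimes> w) \<otimes> (c' \<otimes> f \<oplus> d' \<otimes> w) = (c \<otimes> c' \<oplus> d \<otimes> d') \<otimes> f \<oplus> (c \<otimes> d' \<oplus> d \<otimes> c') \<otimes> w"
      unfolding eq using carr False w(4) by (simp add: l_distr a_ac)
    thus ?thesis using cd by (intro bexI[of _ "c \<otimes> c' \<oplus> d \<otimes> d'"] bexI[of _ "c \<otimes> d' \<oplus> d \<otimes> c'"]) simp_all
  qed
qed

text \<open>The complement \<open>T\<close> is the direct sum of the spaces \<open>F f\<^sub>i + F w\<^sub>i\<close>. It is described below by conditions on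
  the products with the \<open>f\<^sub>i\<close>, because in this form most closure properties can be checked for one index
  \<open>i\<close> at a time.\<close>

theorem ex_graded_complement:
  fixes n :: nat and f w :: "nat \<Rightarrow> 'a"
  assumes f: "\<And>i. i < n \<Longrightarrow> f i \<in> G 0"
    and orth: "\<And>i j. \<lbrakk>i < n; j < n\<rbrakk> \<Longrightarrow> f i \<otimes> f j = (if i = j then f i else \<zero>)"
    and sum: "(\<Oplus>i\<in>{..<n}. f i) = \<one>"
    and w: "\<And>i. i < n \<Longrightarrow> w i \<in> G 1 \<and> f i \<otimes> w i = w i \<and> w i \<otimes> f i = w i \<and> (w i \<otimes> w i = f i \<or> w i = \<zero>)"
    and span: "\<And>i x. \<lbrakk>i < n; x \<in> carrier R\<rbrakk> \<Longrightarrow> \<exists>c\<in>F. \<exists>d\<in>F. \<pi> (f i \<otimes> x) = \<pi> (c \<otimes> f i \<oplus> d \<otimes> w i)"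
  shows "\<exists>T. subring T R \<and> (\<forall>c\<in>F. \<forall>x\<in>T. c \<otimes> x \<in> T) \<and> (\<forall>x\<in>T. \<exists>y\<in>T \<inter> G 0. \<exists>z\<in>T \<inter> G 1. x = y \<oplus> z) \<and>
    (\<forall>x\<in>T. \<pi> x = \<zero>\<^bsub>S\<^esub> \<longrightarrow> x = \<zero>) \<and> (\<forall>x\<in>carrier R. \<exists>s\<in>T. \<pi> s = \<pi> x)"
proof -
  define L where "L i = {c \<otimes> f i \<oplus> d \<otimes> w i | c d. c \<in> F \<and> d \<in> F}" for i
  define T where "T = {x \<in> carrier R. \<forall>i<n. f i \<otimes> x = x \<otimes> f i \<and> f i \<otimes> x \<in> L i}"
  have LI: "c \<otimes> f i \<oplus> d \<otimes> w i \<in> L i" if "c \<in> F" "d \<in> F" for c d i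
    unfolding L_def using that by blast
  have fc: "f i \<in> carrier R" "w i \<in> carrier R" if "i < n" for i using f[OF that] w[OF that] by auto
  have ff: "f i \<otimes> f i = f i" if "i < n" for i using orth[OF that that] by simp
  have LC: "L i \<subseteq> carrier R" if "i < n" for i unfolding L_def using fc[OF that] by auto
  have Ladd: "x \<oplus> y \<in> L i" if i: "i < n" and x: "x \<in> L i" and y: "y \<in> L i" for x y i
  proof -
    obtain c d c' d' where cd: "c \<in> F" "d \<in> F" "x = c \<otimes> f i \<oplus> d \<otimes> w i"
        "c' \<in> F" "d' \<in> F" "y = c' \<otimes> f i \<oplus> d' \<otimes> w i" using x y unfolding L_def by blast
    have "x \<oplus> y = (c \<oplus> c') \<otimes> f i \<oplus> (d \<oplus> d') \<otimes> w i"
      unfolding cd(3,6) using cd(1,2,4,5) fc[OF i] by (simp add: l_distr a_ac)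
    thus ?thesis using LI[of "c \<oplus> c'" "d \<oplus> d'" i] cd by simp
  qed
  have Lsmult: "b \<otimes> x \<in> L i" if i: "i < n" and b: "b \<in> F" and x: "x \<in> L i" for b x i
  proof -
    obtain c d where cd: "c \<in> F" "d \<in> F" "x = c \<otimes> f i \<oplus> d \<otimes> w i" using x unfolding L_def by blast
    have "b \<otimes> x = (b \<otimes> c) \<otimes> f i \<oplus> (b \<otimes> d) \<otimes> w i"
      unfolding cd(3) using cd(1,2) b fc[OF i] by (simp add: r_distr m_assoc)
    thus ?thesis using LI[of "b \<otimes> c" "b \<otimes> d" i] cd b by simp
  qed
  have TC: "x \<in> carrier R" if "x \<in> T" for x using that unfolding T_def by blast
  have TD: "f i \<otimes> x = x \<otimes> f i" "f i \<otimes> x \<in> L i" if "x \<in> T" "i < n" for x i using that unfolding T_def by auto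
  have Tsmult: "c \<otimes> x \<in> T" if c: "c \<in> F" and x: "x \<in> T" for c x
    unfolding T_def
  proof (intro CollectI conjI allI impI)
    show "c \<otimes> x \<in> carrier R" using c TC[OF x] by simp
    fix i assume i: "i < n"
    have eq: "f i \<otimes> (c \<otimes> x) = c \<otimes> (f i \<otimes> x)"
      using scalars_central[OF c, of "f i"] fc[OF i] c TC[OF x] by (metis m_assoc scalar_carrier)
    show "f i \<otimes> (c \<otimes> x) = c \<otimes> x \<otimes> f i"
      unfolding eq TD(1)[OF x i] using fc[OF i] c TC[OF x] by (simp add: m_assoc)
    show "f i \<otimes> (c \<otimes> x) \<in> L i" unfolding eq using Lsmult[OF i c TD(2)[OF x i]] .
  qed
  have Tadd: "x \<oplus> y \<in> T" if x: "x \<in> T" and y: "y \<in> T" for x y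
    unfolding T_def
  proof (intro CollectI conjI allI impI)
    show "x \<oplus> y \<in> carrier R" using TC[OF x] TC[OF y] by simp
    fix i assume i: "i < n"
    have eq: "f i \<otimes> (x \<oplus> y) = f i \<otimes> x \<oplus> f i \<otimes> y" using fc[OF i] TC[OF x] TC[OF y] by (simp add: r_distr)
    show "f i \<otimes> (x \<oplus> y) = (x \<oplus> y) \<otimes> f i"
      unfolding eq TD(1)[OF x i] TD(1)[OF y i] using fc[OF i] TC[OF x] TC[OF y] by (simp add: l_distr)
    show "f i \<otimes> (x \<oplus> y) \<in> L i" unfolding eq using Ladd[OF i TD(2)[OF x i] TD(2)[OF y i]] .
  qed
  have Tmult: "x \<otimes> y \<in> T" if x: "x \<in> T" and y: "y \<in> T" for x y
    unfolding T_def
  proof (intro CollectI conjI allI impI)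
    show "x \<otimes> y \<in> carrier R" using TC[OF x] TC[OF y] by simp
    fix i assume i: "i < n"
    note c = fc[OF i] TC[OF x] TC[OF y]
    have "f i \<otimes> (x \<otimes> y) = x \<otimes> (f i \<otimes> y)" using TD(1)[OF x i] c by (simp add: m_assoc[symmetric])
    thus "f i \<otimes> (x \<otimes> y) = x \<otimes> y \<otimes> f i" using TD(1)[OF y i] c by (simp add: m_assoc)
    have "f i \<otimes> (x \<otimes> y) = f i \<otimes> (f i \<otimes> x) \<otimes> y" using ff[OF i] c by (simp add: m_assoc[symmetric])
    also have "\<dots> = f i \<otimes> (x \<otimes> f i) \<otimes> y" using TD(1)[OF x i] by simp
    also have "\<dots> = (f i \<otimes> x) \<otimes> (f i \<otimes> y)" using c by (simp add: m_assoc)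
    finally have eq: "f i \<otimes> (x \<otimes> y) = (f i \<otimes> x) \<otimes> (f i \<otimes> y)" .
    obtain p q p' q' where pq: "p \<in> F" "q \<in> F" "f i \<otimes> x = p \<otimes> f i \<oplus> q \<otimes> w i"
        "p' \<in> F" "q' \<in> F" "f i \<otimes> y = p' \<otimes> f i \<oplus> q' \<otimes> w i"
      using TD(2)[OF x i] TD(2)[OF y i] unfolding L_def by blast
    have "\<exists>r\<in>F. \<exists>s\<in>F. (p \<otimes> f i \<oplus> q \<otimes> w i) \<otimes> (p' \<otimes> f i \<oplus> q' \<otimes> w i) = r \<otimes> f i \<oplus> s \<otimes> w i"
      using w[OF i] by (intro span_mult f[OF i] ff[OF i] pq) auto
    thus "f i \<otimes> (x \<otimes> y) \<in> L i" unfolding eq pq(3,6) L_def by blast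
  qed
  have Tone: "\<one> \<in> T"
    unfolding T_def
  proof (intro CollectI conjI allI impI)
    fix i assume i: "i < n"
    show "f i \<otimes> \<one> = \<one> \<otimes> f i" using fc[OF i] by simp
    have "f i \<otimes> \<one> = \<one> \<otimes> f i \<oplus> \<zero> \<otimes> w i" using fc[OF i] by simp
    thus "f i \<otimes> \<one> \<in> L i" using LI[of \<one> \<zero> i] by simp
  qed simp
  have "subring T R"
  proof (rule subringI)
    show "\<ominus> x \<in> T" if x: "x \<in> T" for x
      using Tsmult[of "\<ominus> \<one>" x] x TC[OF x] by (simp add: l_minus)
  qed (use TC Tone Tmult Tadd in auto)
  moreover have "\<exists>y\<in>T \<inter> G 0. \<exists>z\<in>T \<inter> G 1. x = y \<oplus> z" if x: "x \<in> T" for x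
  proof -
    obtain y z where yz: "y \<in> G 0" "z \<in> G 1" "x = y \<oplus> z" using decomposition[OF TC[OF x]] by blast
    have yzc: "y \<in> carrier R" "z \<in> carrier R" using yz by auto
    have *: "f i \<otimes> y = y \<otimes> f i \<and> f i \<otimes> y \<in> L i \<and> f i \<otimes> z = z \<otimes> f i \<and> f i \<otimes> z \<in> L i" if i: "i < n" for i
    proof -
      note c = fc[OF i] yzc
      have wi: "w i \<in> G 1" using w[OF i] by simp
      have "f i \<otimes> y \<oplus> f i \<otimes> z = y \<otimes> f i \<oplus> z \<otimes> f i"
        using TD(1)[OF x i] unfolding yz(3) using c by (simp add: l_distr r_distr)
      from homogeneous_eqI[OF _ _ _ _ this]
      have 1: "f i \<otimes> y = y \<otimes> f i" "f i \<otimes> z = z \<otimes> f i"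
        using f[OF i] yz even_even even_odd odd_even by auto
      obtain p q where pq: "p \<in> F" "q \<in> F" "f i \<otimes> x = p \<otimes> f i \<oplus> q \<otimes> w i"
        using TD(2)[OF x i] unfolding L_def by blast
      have "f i \<otimes> y \<oplus> f i \<otimes> z = p \<otimes> f i \<oplus> q \<otimes> w i"
        using pq(3) unfolding yz(3) using c by (simp add: r_distr)
      moreover have "p \<in> G 0" "q \<in> G 0" using pq scalars_even by auto
      ultimately have 2: "f i \<otimes> y = p \<otimes> f i" "f i \<otimes> z = q \<otimes> w i"
        using homogeneous_eqI[of "f i \<otimes> y" "f i \<otimes> z" "p \<otimes> f i" "q \<otimes> w i"]
          f[OF i] wi yz even_even even_odd by auto
      have "p \<otimes> f i = p \<otimes> f i \<oplus> \<zero> \<otimes> w i" "q \<otimes> w i = \<zero> \<otimes> f i \<oplus> q \<otimes> w i" using pq(1,2) c by simp_all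
      hence "p \<otimes> f i \<in> L i" "q \<otimes> w i \<in> L i" using LI[of p \<zero> i] LI[of \<zero> q i] pq(1,2) by simp_all
      thus ?thesis using 1 2 by simp
    qed
    have "y \<in> T" "z \<in> T" unfolding T_def using * yzc by blast+
    thus ?thesis using yz by blast
  qed
  moreover have "x = \<zero>" if x: "x \<in> T" "\<pi> x = \<zero>\<^bsub>S\<^esub>" for x
  proof -
    have fx: "f i \<otimes> x = \<zero>" if i: "i < n" for i
    proof -
      obtain p q where pq: "p \<in> F" "q \<in> F" "f i \<otimes> x = p \<otimes> f i \<oplus> q \<otimes> w i"
        using TD(2)[OF x(1) i] unfolding L_def by blast
      have "\<pi> (f i \<otimes> x) = \<zero>\<^bsub>S\<^esub>" using fc[OF i] TC[OF x(1)] x(2) by simp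
      hence "p \<otimes> f i = \<zero>" "q \<otimes> w i = \<zero>"
        using span_kernel_zero[OF f[OF i] ff[OF i], of "w i" p q] w[OF i] pq by auto
      thus ?thesis using pq(3) by simp
    qed
    have "x = (\<Oplus>i\<in>{..<n}. f i) \<otimes> x" using sum TC[OF x(1)] by simp
    also have "\<dots> = (\<Oplus>i\<in>{..<n}. f i \<otimes> x)" using fc TC[OF x(1)] by (intro finsum_ldistr) auto
    also have "\<dots> = (\<Oplus>i\<in>{..<n}. \<zero>)" using fx by (intro finsum_cong) auto
    finally show ?thesis by simp
  qed
  moreover have "\<exists>s\<in>T. \<pi> s = \<pi> x" if x: "x \<in> carrier R" for x
  proof -
    have "\<forall>i\<in>{..<n}. \<exists>t. t \<in> L i \<and> \<pi> (f i \<otimes> x) = \<pi> t"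
    proof
      fix i assume "i \<in> {..<n}"
      hence "\<exists>c\<in>F. \<exists>d\<in>F. \<pi> (f i \<otimes> x) = \<pi> (c \<otimes> f i \<oplus> d \<otimes> w i)" using span x by simp
      thus "\<exists>t. t \<in> L i \<and> \<pi> (f i \<otimes> x) = \<pi> t" using LI by blast
    qed
    then obtain t where t: "\<forall>i\<in>{..<n}. t i \<in> L i \<and> \<pi> (f i \<otimes> x) = \<pi> (t i)"
      by (drule_tac bchoice) (elim exE, rule that)
    have tc: "t \<in> {..<n} \<rightarrow> carrier R"
    proof
      fix i assume "i \<in> {..<n}"
      thus "t i \<in> carrier R" using t LC[of i] by auto
    qed
    have tw: "f i \<otimes> t i = t i \<and> t i \<otimes> f i = t i" if i: "i < n" for i
    proof -
      obtain p q where pq: "p \<in> F" "q \<in> F" "t i = p \<otimes> f i \<oplus> q \<otimes> w i"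
        using t i unfolding L_def by blast
      have pqc: "p \<in> carrier R" "q \<in> carrier R" using pq by auto
      have "f i \<otimes> (p \<otimes> f i) = p \<otimes> (f i \<otimes> f i)" "f i \<otimes> (q \<otimes> w i) = q \<otimes> (f i \<otimes> w i)"
        using scalars_central[OF pq(1), of "f i"] scalars_central[OF pq(2), of "f i"] fc[OF i] pqc
        by (metis m_assoc)+
      thus ?thesis unfolding pq(3) using fc[OF i] pqc ff[OF i] w[OF i] by (simp add: r_distr l_distr m_assoc)
    qed
    have tcross: "f i \<otimes> t j = \<zero> \<and> t j \<otimes> f i = \<zero>" if ij: "i < n" "j < n" "i \<noteq> j" for i j
    proof -
      have c: "f i \<in> carrier R" "f j \<in> carrier R" "t j \<in> carrier R" using fc ij tc by auto
      have "f i \<otimes> t j = (f i \<otimes> f j) \<otimes> t j" "t j \<otimes> f i = t j \<otimes> (f j \<otimes> f i)"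
        using tw[OF ij(2)] c by (metis m_assoc)+
      thus ?thesis using orth ij c by simp
    qed
    define s where "s = (\<Oplus>j\<in>{..<n}. t j)"
    have sc: "s \<in> carrier R" unfolding s_def using tc by simp
    have fs: "f i \<otimes> s = t i \<and> s \<otimes> f i = t i" if i: "i < n" for i
    proof
      have "f i \<otimes> s = (\<Oplus>j\<in>{..<n}. f i \<otimes> t j)"
        unfolding s_def using fc[OF i] tc by (intro finsum_rdistr) auto
      also have "\<dots> = (\<Oplus>j\<in>{..<n}. if i = j then t j else \<zero>)"
        using tw tcross i tc fc by (intro finsum_cong) (auto simp: simp_implies_def)
      also have "\<dots> = t i" using i tc by (intro finsum_singleton) auto
      finally show "f i \<otimes> s = t i" .
      have "s \<otimes> f i = (\<Oplus>j\<in>{..<n}. t j \<otimes> f i)"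
        unfolding s_def using fc[OF i] tc by (intro finsum_ldistr) auto
      also have "\<dots> = (\<Oplus>j\<in>{..<n}. if i = j then t j else \<zero>)"
        using tw tcross i tc fc by (intro finsum_cong) (auto simp: simp_implies_def)
      also have "\<dots> = t i" using i tc by (intro finsum_singleton) auto
      finally show "s \<otimes> f i = t i" .
    qed
    have "s \<in> T" unfolding T_def using sc fs t by auto
    moreover have "\<pi> s = \<pi> x"
    proof -
      have "x = (\<Oplus>i\<in>{..<n}. f i) \<otimes> x" using sum x by simp
      also have "\<dots> = (\<Oplus>i\<in>{..<n}. f i \<otimes> x)" using fc x by (intro finsum_ldistr) auto
      finally have "\<pi> x = \<pi> (\<Oplus>i\<in>{..<n}. f i \<otimes> x)" by simp
      also have "\<dots> = (\<Oplus>\<^bsub>S\<^esub>i\<in>{..<n}. \<pi> (f i \<otimes> x))"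
        using fc x by (subst hom.hom_finsum) (auto simp: comp_def)
      also have "\<dots> = (\<Oplus>\<^bsub>S\<^esub>i\<in>{..<n}. \<pi> (t i))"
        using t tc by (intro S.finsum_cong) (auto simp: simp_implies_def Pi_iff)
      also have "\<dots> = \<pi> s" unfolding s_def using tc by (subst hom.hom_finsum) (auto simp: comp_def)
      finally show ?thesis by simp
    qed
    ultimately show ?thesis by blast
  qed
  ultimately show ?thesis using Tsmult by (intro exI[of _ T]) blast
qed

end

section \<open>Superalgebras over an algebraically closed field\<close>

text \<open>The structure map of a unital associative algebra over a field.\<close>

locale central_scalar_hom = ring A + K: field K + hom: ring_hom_ring K A \<sigma>
  for A (structure) and K (structure) and \<sigma> +
  assumes hom_central: "\<lbrakk>c \<in> carrier K; x \<in> carrier A\<rbrakk> \<Longrightarrow> \<sigma> c \<otimes> x = x \<otimes> \<sigma> c"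
begin

text \<open>Synthetic division of a polynomial by \<open>X - l\<close> with remainder, evaluated at \<open>x\<close>. Polynomials are lists
  with the leading coefficient first, so Horner's scheme is an induction from the right end.\<close>

lemma eval_root_factor:
  assumes x: "x \<in> carrier A" and l: "l \<in> carrier K"
  shows "set p \<subseteq> carrier K \<Longrightarrow> \<exists>q. set q \<subseteq> carrier K \<and> length q = length p - 1 \<and>
    (2 \<le> length p \<longrightarrow> hd q = hd p) \<and>
    eval (map \<sigma> p) x = (x \<ominus> \<sigma> l) \<otimes> eval (map \<sigma> q) x \<oplus> \<sigma> (K.eval p l)"
proof (induction p rule: rev_induct)
  case Nil
  show ?case using x l by (intro exI[of _ "[]"]) simp
next
  case (snoc b p)
  have b: "b \<in> carrier K" and p: "set p \<subseteq> carrier K" using snoc.prems by auto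
  show ?case
  proof (cases "p = []")
    case True
    thus ?thesis using x l b by (intro exI[of _ "[]"]) simp
  next
    case False
    obtain q where q: "set q \<subseteq> carrier K" "length q = length p - 1" "2 \<le> length p \<longrightarrow> hd q = hd p"
      "eval (map \<sigma> p) x = (x \<ominus> \<sigma> l) \<otimes> eval (map \<sigma> q) x \<oplus> \<sigma> (K.eval p l)"
      using snoc.IH[OF p] by blast
    define m where "m = K.eval p l"
    have m: "m \<in> carrier K" unfolding m_def using p l by (rule K.eval_in_carrier)
    have setq: "set (map \<sigma> q) \<subseteq> carrier A" "set (map \<sigma> p) \<subseteq> carrier A" using q(1) p by auto
    define Q where "Q = eval (map \<sigma> q) x"
    have Q: "Q \<in> carrier A" unfolding Q_def using setq(1) x by (rule eval_in_carrier)
    have c: "\<sigma> l \<in> carrier A" "\<sigma> m \<in> carrier A" "\<sigma> b \<in> carrier A" using l m b by auto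
    have e: "eval (map \<sigma> (p @ [b])) x = eval (map \<sigma> p) x \<otimes> x \<oplus> \<sigma> b"
      using eval_append_aux[OF setq(2) c(3) x] by simp
    have e': "eval (map \<sigma> (q @ [m])) x = Q \<otimes> x \<oplus> \<sigma> m"
      using eval_append_aux[OF setq(1) c(2) x] unfolding Q_def by simp
    have "K.eval (p @ [b]) l = m \<otimes>\<^bsub>K\<^esub> l \<oplus>\<^bsub>K\<^esub> b" using K.eval_append_aux[OF p b l] unfolding m_def .
    hence e'': "\<sigma> (K.eval (p @ [b]) l) = \<sigma> l \<otimes> \<sigma> m \<oplus> \<sigma> b"
      using l m b hom_central[OF l c(2)] by simp
    have "eval (map \<sigma> (p @ [b])) x = (x \<ominus> \<sigma> l) \<otimes> (Q \<otimes> x) \<oplus> x \<otimes> \<sigma> m \<oplus> \<sigma> b"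
      unfolding e q(4) Q_def[symmetric] m_def[symmetric]
      using x Q c hom_central[OF m x] by (simp add: l_distr m_assoc)
    also have "\<dots> = (x \<ominus> \<sigma> l) \<otimes> (Q \<otimes> x \<oplus> \<sigma> m) \<oplus> (\<sigma> l \<otimes> \<sigma> m \<oplus> \<sigma> b)"
      using x Q c by algebra
    finally have "eval (map \<sigma> (p @ [b])) x =
        (x \<ominus> \<sigma> l) \<otimes> eval (map \<sigma> (q @ [m])) x \<oplus> \<sigma> (K.eval (p @ [b]) l)"
      unfolding e' e'' .
    moreover have "hd (q @ [m]) = hd (p @ [b])"
    proof (cases "q = []")
      case True
      hence "length p = 1" using q(2) False by (cases p) auto
      then obtain a where "p = [a]" by (cases p) auto
      hence "m = a" using p l unfolding m_def by simp
      thus ?thesis using True \<open>p = [a]\<close> by simp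
    next
      case q_ne: False
      hence "2 \<le> length p" using q(2) by (cases q; cases p) auto
      thus ?thesis using q(3) q_ne False by simp
    qed
    ultimately show ?thesis
      using q(1,2) m False by (intro exI[of _ "q @ [m]"]) (auto simp: Suc_leI)
  qed
qed

lemma eval_eq_product:
  assumes ac: "algebraically_closed K" and x: "x \<in> carrier A"
  shows "\<lbrakk>set p \<subseteq> carrier K; p \<noteq> []; hd p \<noteq> \<zero>\<^bsub>K\<^esub>\<rbrakk> \<Longrightarrow>
    \<exists>ls c. set ls \<subseteq> carrier K \<and> c \<in> carrier K \<and> c \<noteq> \<zero>\<^bsub>K\<^esub> \<and>
      eval (map \<sigma> p) x = foldr (\<lambda>l y. (x \<ominus> \<sigma> l) \<otimes> y) ls (\<sigma> c)"
proof (induction "length p" arbitrary: p rule: less_induct)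
  case less
  show ?case
  proof (cases "length p = 1")
    case True
    then obtain c where "p = [c]" by (cases p) auto
    thus ?thesis using less.prems x by (intro exI[of _ "[]"] exI[of _ c]) simp
  next
    case False
    hence len: "2 \<le> length p" using less.prems(2) by (cases p) (auto simp: Suc_le_eq)
    have "p \<in> carrier (poly_ring K)"
      using less.prems unfolding univ_poly_carrier[symmetric] polynomial_def by simp
    hence "K.splitted p" and P: "p \<in> carrier (poly_ring K)"
      using algebraically_closed.roots_over_carrier[OF ac] by auto
    hence "size (K.roots p) > 0" using len unfolding K.splitted_def by simp
    then obtain l where "l \<in># K.roots p" by (metis multiset_nonemptyE nonempty_has_size)
    hence l: "l \<in> carrier K" "K.eval p l = \<zero>\<^bsub>K\<^esub>"
      using K.roots_mem_iff_is_root[OF P] unfolding K.is_root_def by auto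
    obtain q where q: "set q \<subseteq> carrier K" "length q = length p - 1" "hd q = hd p"
      "eval (map \<sigma> p) x = (x \<ominus> \<sigma> l) \<otimes> eval (map \<sigma> q) x \<oplus> \<sigma> (K.eval p l)"
      using eval_root_factor[OF x l(1) less.prems(1)] len by blast
    have "eval (map \<sigma> q) x \<in> carrier A" using q(1) x by (intro eval_in_carrier) auto
    hence eq: "eval (map \<sigma> p) x = (x \<ominus> \<sigma> l) \<otimes> eval (map \<sigma> q) x"
      unfolding q(4) l(2) using x l(1) by simp
    have "length q < length p" "q \<noteq> []" "hd q \<noteq> \<zero>\<^bsub>K\<^esub>" using q len less.prems by auto
    then obtain ls c where ls: "set ls \<subseteq> carrier K" "c \<in> carrier K" "c \<noteq> \<zero>\<^bsub>K\<^esub>"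
      "eval (map \<sigma> q) x = foldr (\<lambda>l y. (x \<ominus> \<sigma> l) \<otimes> y) ls (\<sigma> c)"
      using less.hyps[of q] q(1) by blast
    thus ?thesis using eq l(1) by (intro exI[of _ "l # ls"] exI[of _ c]) simp
  qed
qed

lemma foldr_product_carrier:
  assumes "x \<in> carrier A" "set ls \<subseteq> carrier K" "y \<in> carrier A"
  shows "foldr (\<lambda>l y. (x \<ominus> \<sigma> l) \<otimes> y) ls y \<in> carrier A"
  using assms(2) by (induction ls) (use assms(1,3) in auto)

lemma foldr_product_mult:
  assumes "x \<in> carrier A" "set ls \<subseteq> carrier K" "y \<in> carrier A"
  shows "foldr (\<lambda>l y. (x \<ominus> \<sigma> l) \<otimes> y) ls y = foldr (\<lambda>l y. (x \<ominus> \<sigma> l) \<otimes> y) ls \<one> \<otimes> y"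
  using assms(2)
  by (induction ls) (use assms(1,3) in \<open>auto simp: m_assoc foldr_product_carrier\<close>)

lemma ex_nonzero_head:
  assumes x: "x \<in> carrier A"
  shows "\<lbrakk>set p \<subseteq> carrier A; \<not> set p \<subseteq> {\<zero>}\<rbrakk> \<Longrightarrow>
    \<exists>q. set q \<subseteq> set p \<and> q \<noteq> [] \<and> hd q \<noteq> \<zero> \<and> eval q x = eval p x"
proof (induction p)
  case (Cons a p)
  show ?case
  proof (cases "a = \<zero>")
    case True
    then obtain q where q: "set q \<subseteq> set p" "q \<noteq> []" "hd q \<noteq> \<zero>" "eval q x = eval p x"
      using Cons by auto
    have "eval (a # p) x = eval p x" using True x eval_in_carrier[of p x] Cons.prems(1) by simp
    thus ?thesis using q by (intro exI[of _ q]) auto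
  next
    case False
    thus ?thesis by (intro exI[of _ "a # p"]) simp
  qed
qed simp

text \<open>More powers of \<open>x\<close> than the dimension are linearly dependent, so that \<open>x\<close> is a zero of a polynomial, which
  splits into linear factors. In the zero ring the scalars do not form a field; there the empty product is
  already zero.\<close>

lemma finite_span_imp_product_zero:
  assumes ac: "algebraically_closed K"
    and B: "finite B" "B \<subseteq> carrier A"
    and span: "\<And>x. x \<in> carrier A \<Longrightarrow> \<exists>c\<in>B \<rightarrow> carrier K. x = (\<Oplus>b\<in>B. \<sigma> (c b) \<otimes> b)"
    and x: "x \<in> carrier A"
  shows "\<exists>ls. set ls \<subseteq> carrier K \<and> foldr (\<lambda>l y. (x \<ominus> \<sigma> l) \<otimes> y) ls \<one> = \<zero>"
proof (cases "\<one> = \<zero>")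
  case True
  thus ?thesis by (intro exI[of _ "[]"]) simp
next
  case False
  let ?F = "\<sigma> ` carrier K"
  have F: "subfield ?F A" using hom.img_is_subfield(2)[OF K.carrier_is_subfield False] .
  obtain bs where bs: "set bs = B" using finite_list[OF B(1)] by blast
  have bsc: "set bs \<subseteq> carrier A" using bs B by simp
  have "y \<in> Span ?F bs" if y: "y \<in> carrier A" for y
  proof -
    obtain c where c: "c \<in> B \<rightarrow> carrier K" "y = (\<Oplus>b\<in>B. \<sigma> (c b) \<otimes> b)" using span[OF y] by blast
    have "\<sigma> (c b) \<otimes> b \<in> carrier A" if "b \<in> B" for b
      using that c(1) B(2) by (intro m_closed hom.hom_closed) auto
    note summand = this
    have "(\<Oplus>b\<in>C. \<sigma> (c b) \<otimes> b) \<in> Span ?F bs" if "C \<subseteq> B" for C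
      using finite_subset[OF that B(1)] that
    proof (induction C rule: finite_induct)
      case empty
      show ?case using Span_subgroup_props(2)[OF F bsc] by simp
    next
      case (insert b C)
      have "b \<in> Span ?F bs" using Span_base_incl[OF F bsc] bs insert by auto
      hence "\<sigma> (c b) \<otimes> b \<in> Span ?F bs"
        using Span_smult_closed[OF F bsc, of "\<sigma> (c b)" b] c(1) insert by auto
      moreover have "(\<Oplus>b\<in>insert b C. \<sigma> (c b) \<otimes> b) = \<sigma> (c b) \<otimes> b \<oplus> (\<Oplus>b\<in>C. \<sigma> (c b) \<otimes> b)"
        using insert summand by (intro finsum_insert) auto
      ultimately show ?case using Span_subgroup_props(3)[OF F bsc] insert by auto
    qed
    thus ?thesis using c(2) by simp
  qed
  moreover obtain n where n: "dimension n ?F (Span ?F bs)"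
    using Span_finite_dimension[OF F bsc] unfolding finite_dimension_def by blast
  moreover define us where "us = map (\<lambda>i. x [^] i) (rev [0..<Suc n])"
  have us: "set us \<subseteq> carrier A" "length us = Suc n" unfolding us_def using x by auto
  ultimately have "dependent ?F us"
    using independent_length_le_dimension[OF F n, of us] by auto
  then obtain ks where ks: "length ks = length us" "combine ks us = \<zero>" "set ks \<subseteq> ?F" "set ks \<noteq> {\<zero>}"
    using dependent_imp_non_trivial_combine[OF F us(1)] by metis
  have comb: "combine ks (map (\<lambda>i. x [^] i) (rev [0..<length ks])) = eval ks x" for ks
    by (induction ks) simp_all
  have ev: "eval ks x = \<zero>"
    using ks(2) comb[of ks] unfolding us_def ks(1)[unfolded us(2)] by simp
  have ksc: "set ks \<subseteq> carrier A" using ks(3) by auto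
  have "ks \<noteq> []" using ks(1) us(2) by auto
  hence "\<not> set ks \<subseteq> {\<zero>}" using ks(4) by (auto simp: subset_singleton_iff)
  then obtain q where q: "set q \<subseteq> set ks" "q \<noteq> []" "hd q \<noteq> \<zero>" "eval q x = eval ks x"
    using ex_nonzero_head[OF x ksc] by blast
  have "q \<in> lists (\<sigma> ` carrier K)" using q(1) ks(3) by auto
  hence "q \<in> map \<sigma> ` lists (carrier K)" by (simp add: lists_image)
  then obtain p where p: "q = map \<sigma> p" "set p \<subseteq> carrier K" by auto
  have p': "p \<noteq> []" "hd p \<noteq> \<zero>\<^bsub>K\<^esub>" using p q(2,3) by (auto simp: hd_map)
  obtain ls c where ls: "set ls \<subseteq> carrier K" "c \<in> carrier K" "c \<noteq> \<zero>\<^bsub>K\<^esub>"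
    "eval (map \<sigma> p) x = foldr (\<lambda>l y. (x \<ominus> \<sigma> l) \<otimes> y) ls (\<sigma> c)"
    using eval_eq_product[OF ac x p(2) p'] by blast
  let ?P = "foldr (\<lambda>l y. (x \<ominus> \<sigma> l) \<otimes> y) ls \<one>"
  have Pc: "?P \<in> carrier A" using foldr_product_carrier[OF x ls(1) one_closed] .
  have "?P \<otimes> \<sigma> c = \<zero>"
    using foldr_product_mult[OF x ls(1), of "\<sigma> c"] ls(2,4) q(4) ev p(1) by simp
  moreover obtain d where d: "d \<in> carrier K" "c \<otimes>\<^bsub>K\<^esub> d = \<one>\<^bsub>K\<^esub>"
    using ls(2,3) K.field_Units K.Units_r_inv_ex[of c] by blast
  have "\<sigma> c \<otimes> \<sigma> d = \<one>" using ls(2) d by (metis hom.hom_mult hom.hom_one)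
  hence "?P = (?P \<otimes> \<sigma> c) \<otimes> \<sigma> d" using Pc ls(2) d(1) by (simp add: m_assoc)
  ultimately have "?P = \<zero>" using d(1) by simp
  thus ?thesis using ls(1) by blast
qed

lemma foldr_product_commutes:
  assumes "x \<in> carrier A" "set ls \<subseteq> carrier K"
  shows "x \<otimes> foldr (\<lambda>l y. (x \<ominus> \<sigma> l) \<otimes> y) ls \<one> = foldr (\<lambda>l y. (x \<ominus> \<sigma> l) \<otimes> y) ls \<one> \<otimes> x"
  using assms(2)
proof (induction ls)
  case (Cons l ls)
  let ?P = "foldr (\<lambda>l y. (x \<ominus> \<sigma> l) \<otimes> y) ls \<one>"
  have l: "l \<in> carrier K" "\<sigma> l \<in> carrier A" and P: "?P \<in> carrier A"
    using Cons.prems foldr_product_carrier[OF assms(1) _ one_closed, of ls] by auto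
  have "x \<otimes> (x \<ominus> \<sigma> l) = x \<otimes> x \<ominus> x \<otimes> \<sigma> l" using assms(1) l by algebra
  also have "\<dots> = (x \<ominus> \<sigma> l) \<otimes> x"
    unfolding hom_central[OF l(1) assms(1), symmetric] using assms(1) l by algebra
  finally have "x \<otimes> ((x \<ominus> \<sigma> l) \<otimes> ?P) = (x \<ominus> \<sigma> l) \<otimes> (x \<otimes> ?P)"
    using assms(1) l P by (simp add: m_assoc[symmetric])
  thus ?case using Cons assms(1) l P by (simp add: m_assoc)
qed (use assms(1) in simp)

text \<open>The factors with \<open>l \<noteq> 0\<close> are cancelled and those with \<open>l = 0\<close> are moved to the right into \<open>y\<close>.\<close>

lemma product_zero_imp_nilpotent:
  assumes x: "x \<in> carrier A"
    and inv: "\<And>l. \<lbrakk>l \<in> carrier K; l \<noteq> \<zero>\<^bsub>K\<^esub>\<rbrakk> \<Longrightarrow> \<exists>z\<in>carrier A. z \<otimes> (x \<ominus> \<sigma> l) = \<one>"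
  shows "\<lbrakk>set ls \<subseteq> carrier K; y \<in> carrier A; foldr (\<lambda>l y. (x \<ominus> \<sigma> l) \<otimes> y) ls \<one> \<otimes> y = \<zero>\<rbrakk> \<Longrightarrow>
    \<exists>m::nat. x [^] m \<otimes> y = \<zero>"
proof (induction ls arbitrary: y)
  case Nil
  thus ?case by (intro exI[of _ 0]) simp
next
  case (Cons l ls)
  let ?P = "foldr (\<lambda>l y. (x \<ominus> \<sigma> l) \<otimes> y) ls \<one>"
  have l: "l \<in> carrier K" "\<sigma> l \<in> carrier A" and ls: "set ls \<subseteq> carrier K" and P: "?P \<in> carrier A"
    using Cons.prems foldr_product_carrier[OF x _ one_closed, of ls] by auto
  have 0: "(x \<ominus> \<sigma> l) \<otimes> (?P \<otimes> y) = \<zero>" using Cons.prems(2,3) x l P by (simp add: m_assoc)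
  show ?case
  proof (cases "l = \<zero>\<^bsub>K\<^esub>")
    case True
    have "x \<otimes> (?P \<otimes> y) = \<zero>" using 0 True x by (simp add: a_minus_def)
    hence "?P \<otimes> (x \<otimes> y) = \<zero>"
      using foldr_product_commutes[OF x ls] x P Cons.prems(2) by (metis m_assoc)
    then obtain m :: nat where "x [^] m \<otimes> (x \<otimes> y) = \<zero>"
      using Cons.IH[OF ls, of "x \<otimes> y"] x Cons.prems(2) by auto
    hence "x [^] Suc m \<otimes> y = \<zero>" using x Cons.prems(2) by (simp add: m_assoc)
    thus ?thesis by blast
  next
    case False
    obtain z where z: "z \<in> carrier A" "z \<otimes> (x \<ominus> \<sigma> l) = \<one>" using inv[OF l(1) False] by blast
    have "?P \<otimes> y = z \<otimes> (x \<ominus> \<sigma> l) \<otimes> (?P \<otimes> y)" using z P Cons.prems(2) by simp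
    also have "\<dots> = z \<otimes> ((x \<ominus> \<sigma> l) \<otimes> (?P \<otimes> y))" using z(1) x l P Cons.prems(2) by (intro m_assoc) auto
    also have "\<dots> = \<zero>" unfolding 0 using z(1) by simp
    finally show ?thesis using Cons.IH[OF ls Cons.prems(2)] by simp
  qed
qed

end

context field
begin

lemma ex_left_inverse:
  assumes "c \<in> carrier R" "c \<noteq> \<zero>"
  shows "\<exists>d\<in>carrier R. d \<otimes> c = \<one>"
  using assms Units_l_inv_ex[of c] field_Units by blast

lemma ex_half:
  assumes "ring_char R \<noteq> 2"
  shows "\<exists>c\<in>carrier R. c \<oplus> c = \<one>"
proof -
  have "\<one> \<oplus> \<one> \<noteq> \<zero>"
  proof
    assume 0: "\<one> \<oplus> \<one> = \<zero>"
    have grp: "group (add_monoid R)" by (rule a_group)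
    have "\<one> [^]\<^bsub>add_monoid R\<^esub> (2::nat) = \<one>\<^bsub>add_monoid R\<^esub>"
      using 0 by (simp add: numeral_2_eq_2 nat_pow_def)
    hence "ring_char R dvd 2"
      unfolding ring_char_def using group.pow_eq_id[OF grp, of \<one> 2] by simp
    hence "ring_char R = 1" using assms by (metis prime_nat_iff two_is_prime_nat)
    hence "\<one> = \<zero>" unfolding ring_char_def using group.ord_eq_1[OF grp, of \<one>] by simp
    thus False by simp
  qed
  hence "\<one> \<oplus> \<one> \<in> Units R" by (simp add: field_Units)
  then obtain c where c: "c \<in> carrier R" "c \<otimes> (\<one> \<oplus> \<one>) = \<one>" using Units_l_inv_ex by blast
  thus ?thesis by (intro bexI[of _ c]) (simp_all add: r_distr)
qed

lemma ex_sqrt: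
  assumes ac: "algebraically_closed R" and c: "c \<in> carrier R"
  shows "\<exists>d\<in>carrier R. d \<otimes> d = c"
proof -
  have P: "[\<one>, \<zero>, \<ominus> c] \<in> carrier (poly_ring R)"
    using c unfolding univ_poly_carrier[symmetric] polynomial_def by simp
  hence "splitted [\<one>, \<zero>, \<ominus> c]" using algebraically_closed.roots_over_carrier[OF ac] by simp
  hence "size (roots [\<one>, \<zero>, \<ominus> c]) > 0" unfolding splitted_def by simp
  then obtain d where "d \<in># roots [\<one>, \<zero>, \<ominus> c]" by (metis multiset_nonemptyE nonempty_has_size)
  hence d: "d \<in> carrier R" "eval [\<one>, \<zero>, \<ominus> c] d = \<zero>"
    using roots_mem_iff_is_root[OF P] unfolding is_root_def by auto
  hence "d \<otimes> d \<ominus> c = \<zero>" using c by (simp add: numeral_2_eq_2 a_minus_def)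
  hence "d \<otimes> d = c" using c d(1) by simp
  thus ?thesis using d(1) by blast
qed

end

context superalgebra
begin

lemma graded_ring: "graded_ring A G"
proof (intro graded_ring.intro graded_ring_axioms.intro)
  show "ring A" by (rule A.ring_axioms)
  show "additive_subgroup (G g) A" for g
    using component_subspace[of g] unfolding submodule_def additive_subgroup_def by blast
  show "\<exists>y\<in>G 0. \<exists>z\<in>G 1. x = y \<oplus>\<^bsub>A\<^esub> z" if "x \<in> carrier A" for x
    using that component_sum unfolding direct_sum_def set_add_def' by auto
  show "G 0 \<inter> G 1 = {\<zero>\<^bsub>A\<^esub>}" using component_sum unfolding direct_sum_def by blast
qed (rule component_mult)

definition scalar :: "'k \<Rightarrow> 'a" where
  "scalar c = c \<odot>\<^bsub>A\<^esub> \<one>\<^bsub>A\<^esub>"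

lemma scalar_mult:
  assumes "c \<in> carrier K" "x \<in> carrier A"
  shows "scalar c \<otimes>\<^bsub>A\<^esub> x = c \<odot>\<^bsub>A\<^esub> x" and "x \<otimes>\<^bsub>A\<^esub> scalar c = c \<odot>\<^bsub>A\<^esub> x"
  unfolding scalar_def using assms by (simp_all add: smult_mult_left smult_mult_right)

lemma central_scalar_hom: "central_scalar_hom A K scalar"
proof -
  have K: "ring K" and fieldK: "field K" by unfold_locales
  have "ring_hom_ring K A scalar"
  proof (rule ring_hom_ringI[OF K A.ring_axioms])
    show "scalar (x \<otimes> y) = scalar x \<otimes>\<^bsub>A\<^esub> scalar y" if "x \<in> carrier K" "y \<in> carrier K" for x y
      using that scalar_mult(1)[of x "scalar y"] by (simp add: scalar_def smult_assoc1)
  qed (simp_all add: scalar_def smult_l_distr)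
  thus ?thesis
    using scalar_mult A.ring_axioms fieldK
    by (intro central_scalar_hom.intro central_scalar_hom_axioms.intro) auto
qed

lemma gr_submoduleI:
  assumes sub: "N \<subseteq> carrier A" and zero: "\<zero>\<^bsub>A\<^esub> \<in> N"
    and add: "\<And>x y. \<lbrakk>x \<in> N; y \<in> N\<rbrakk> \<Longrightarrow> x \<oplus>\<^bsub>A\<^esub> y \<in> N"
    and smult: "\<And>c x. \<lbrakk>c \<in> carrier K; x \<in> N\<rbrakk> \<Longrightarrow> c \<odot>\<^bsub>A\<^esub> x \<in> N"
    and graded: "\<And>x. x \<in> N \<Longrightarrow> \<exists>y\<in>N \<inter> G 0. \<exists>z\<in>N \<inter> G 1. x = y \<oplus>\<^bsub>A\<^esub> z"
  shows "gr_submodule K A G N"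
proof -
  have "submodule N K A"
  proof (rule submoduleI[OF sub zero _ add smult])
    show "\<ominus>\<^bsub>A\<^esub> x \<in> N" if "x \<in> N" for x
      using smult[of "\<ominus> \<one>" x] smult_l_minus[of \<one> x] that sub by auto
  qed
  moreover have "N = (N \<inter> G 0) <+>\<^bsub>A\<^esub> (N \<inter> G 1)"
  proof
    show "N \<subseteq> (N \<inter> G 0) <+>\<^bsub>A\<^esub> (N \<inter> G 1)" using graded by (auto simp: set_add_def')
    show "(N \<inter> G 0) <+>\<^bsub>A\<^esub> (N \<inter> G 1) \<subseteq> N" using add by (auto simp: set_add_def')
  qed
  moreover have "(N \<inter> G 0) \<inter> (N \<inter> G 1) = {\<zero>\<^bsub>A\<^esub>}"
    using component_sum zero unfolding direct_sum_def by auto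
  ultimately show ?thesis unfolding gr_submodule_def direct_sum_def by simp
qed

lemma ex_scalar_product_zero:
  assumes ac: "algebraically_closed K" and fd: "finite_dim K A" and x: "x \<in> carrier A"
  shows "\<exists>ls. set ls \<subseteq> carrier K \<and>
    foldr (\<lambda>l y. (x \<ominus>\<^bsub>A\<^esub> scalar l) \<otimes>\<^bsub>A\<^esub> y) ls \<one>\<^bsub>A\<^esub> = \<zero>\<^bsub>A\<^esub>"
proof -
  interpret sc: central_scalar_hom A K scalar by (rule central_scalar_hom)
  obtain B where B: "finite B" "B \<subseteq> carrier A"
    and span: "\<forall>x\<in>carrier A. \<exists>c\<in>B \<rightarrow> carrier K. x = (\<Oplus>\<^bsub>A\<^esub>b\<in>B. c b \<odot>\<^bsub>A\<^esub> b)"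
    using fd unfolding finite_dim_def by blast
  have "\<exists>c\<in>B \<rightarrow> carrier K. y = (\<Oplus>\<^bsub>A\<^esub>b\<in>B. scalar (c b) \<otimes>\<^bsub>A\<^esub> b)" if y: "y \<in> carrier A" for y
  proof -
    obtain c where c: "c \<in> B \<rightarrow> carrier K" "y = (\<Oplus>\<^bsub>A\<^esub>b\<in>B. c b \<odot>\<^bsub>A\<^esub> b)" using span y by blast
    have "c b \<in> carrier K \<and> b \<in> carrier A" if "b \<in> B" for b using that c(1) B(2) by auto
    hence "(\<Oplus>\<^bsub>A\<^esub>b\<in>B. c b \<odot>\<^bsub>A\<^esub> b) = (\<Oplus>\<^bsub>A\<^esub>b\<in>B. scalar (c b) \<otimes>\<^bsub>A\<^esub> b)"
      by (intro M.finsum_cong') (auto simp: scalar_mult)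
    thus ?thesis using c by (intro bexI[of _ c]) simp_all
  qed
  from sc.finite_span_imp_product_zero[OF ac B this x] show ?thesis .
qed

text \<open>For a scalar \<open>l \<noteq> 0\<close> the element \<open>x - l\<close> is a scalar multiple of \<open>1 - l\<^sup>-\<^sup>1 x\<close>, hence left
  invertible; now cancel in a product of linear factors annihilating \<open>x\<close>.\<close>

lemma even_gr_jacobson_nilpotent:
  assumes ac: "algebraically_closed K" and fd: "finite_dim K A"
    and x: "x \<in> gr_jacobson A G" "x \<in> G 0"
  shows "\<exists>m::nat. x [^]\<^bsub>A\<^esub> m = \<zero>\<^bsub>A\<^esub>"
proof -
  interpret gr: graded_ring A G by (rule graded_ring)
  interpret sc: central_scalar_hom A K scalar by (rule central_scalar_hom)
  note J = gr.graded_left_idealD[OF gr.gr_jacobson_graded_left_ideal]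
  have xc: "x \<in> carrier A" using x(2) by simp
  obtain ls where ls: "set ls \<subseteq> carrier K"
      "foldr (\<lambda>l y. (x \<ominus>\<^bsub>A\<^esub> scalar l) \<otimes>\<^bsub>A\<^esub> y) ls \<one>\<^bsub>A\<^esub> = \<zero>\<^bsub>A\<^esub>"
    using ex_scalar_product_zero[OF ac fd xc] by blast
  have "\<exists>z\<in>carrier A. z \<otimes>\<^bsub>A\<^esub> (x \<ominus>\<^bsub>A\<^esub> scalar l) = \<one>\<^bsub>A\<^esub>" if l: "l \<in> carrier K" "l \<noteq> \<zero>" for l
  proof -
    obtain k where k: "k \<in> carrier K" "k \<otimes> l = \<one>" using ex_left_inverse[OF l] by blast
    have c: "scalar k \<in> carrier A" "scalar l \<in> carrier A" using k l by (simp_all add: scalar_def)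
    have kl: "scalar k \<otimes>\<^bsub>A\<^esub> scalar l = \<one>\<^bsub>A\<^esub>"
      using k l by (metis sc.hom.hom_mult sc.hom.hom_one)
    have "scalar k \<in> G 0"
      unfolding scalar_def using submoduleE(4)[OF component_subspace k(1) gr.one_even] .
    hence y: "\<ominus>\<^bsub>A\<^esub> (scalar k \<otimes>\<^bsub>A\<^esub> x) \<in> gr_jacobson A G" "\<ominus>\<^bsub>A\<^esub> (scalar k \<otimes>\<^bsub>A\<^esub> x) \<in> G 0"
      using J(5,6) c x gr.even_even gr.component_neg by auto
    obtain z where z: "z \<in> carrier A" "z \<otimes>\<^bsub>A\<^esub> (\<one>\<^bsub>A\<^esub> \<oplus>\<^bsub>A\<^esub> \<ominus>\<^bsub>A\<^esub> (scalar k \<otimes>\<^bsub>A\<^esub> x)) = \<one>\<^bsub>A\<^esub>"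
      using gr.even_gr_jacobson_left_inverse[OF y] by blast
    have "(z \<otimes>\<^bsub>A\<^esub> \<ominus>\<^bsub>A\<^esub> scalar k) \<otimes>\<^bsub>A\<^esub> (x \<ominus>\<^bsub>A\<^esub> scalar l) =
        z \<otimes>\<^bsub>A\<^esub> (scalar k \<otimes>\<^bsub>A\<^esub> scalar l \<oplus>\<^bsub>A\<^esub> \<ominus>\<^bsub>A\<^esub> (scalar k \<otimes>\<^bsub>A\<^esub> x))"
      using z(1) c xc by algebra
    hence "(z \<otimes>\<^bsub>A\<^esub> \<ominus>\<^bsub>A\<^esub> scalar k) \<otimes>\<^bsub>A\<^esub> (x \<ominus>\<^bsub>A\<^esub> scalar l) = \<one>\<^bsub>A\<^esub>"
      unfolding kl z(2) .
    moreover have "z \<otimes>\<^bsub>A\<^esub> \<ominus>\<^bsub>A\<^esub> scalar k \<in> carrier A" using z(1) c by simp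
    ultimately show ?thesis by blast
  qed
  then obtain m :: nat where "x [^]\<^bsub>A\<^esub> m \<otimes>\<^bsub>A\<^esub> \<one>\<^bsub>A\<^esub> = \<zero>\<^bsub>A\<^esub>"
    using sc.product_zero_imp_nilpotent[OF xc _ ls(1), of "\<one>\<^bsub>A\<^esub>"] ls(2) by auto
  thus ?thesis using xc by auto
qed

lemma scalar_graded_ring:
  assumes ac: "algebraically_closed K" and char: "ring_char K \<noteq> 2"
  shows "scalar_graded_ring A G (scalar ` carrier K)"
proof -
  interpret gr: graded_ring A G by (rule graded_ring)
  interpret sc: central_scalar_hom A K scalar by (rule central_scalar_hom)
  show ?thesis
  proof (intro scalar_graded_ring.intro scalar_graded_ring_axioms.intro)
    show "graded_ring A G" by (rule graded_ring)
    show "subring (scalar ` carrier K) A"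
    proof (rule sc.hom.img_is_subring, rule ring.carrier_is_subring)
      show "ring K" by unfold_locales
    qed
    show "scalar ` carrier K \<subseteq> G 0"
      unfolding scalar_def using submoduleE(4)[OF component_subspace _ gr.one_even] by blast
    show "c \<otimes>\<^bsub>A\<^esub> x = x \<otimes>\<^bsub>A\<^esub> c" if "c \<in> scalar ` carrier K" "x \<in> carrier A" for c x
      using that sc.hom_central by blast
    show "\<exists>d\<in>scalar ` carrier K. d \<otimes>\<^bsub>A\<^esub> c = \<one>\<^bsub>A\<^esub>"
      if c: "c \<in> scalar ` carrier K" "c \<noteq> \<zero>\<^bsub>A\<^esub>" for c
    proof -
      obtain l where l: "l \<in> carrier K" "c = scalar l" using c(1) by blast
      have "l \<noteq> \<zero>" using c(2) l(2) by auto
      then obtain k where k: "k \<in> carrier K" "k \<otimes> l = \<one>" using ex_left_inverse[OF l(1)] by blast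
      have "scalar k \<otimes>\<^bsub>A\<^esub> c = \<one>\<^bsub>A\<^esub>"
        unfolding l(2) using k l(1) by (metis sc.hom.hom_mult sc.hom.hom_one)
      thus ?thesis using k(1) by blast
    qed
    show "\<exists>\<eta>\<in>scalar ` carrier K. \<eta> \<oplus>\<^bsub>A\<^esub> \<eta> = \<one>\<^bsub>A\<^esub>"
    proof -
      obtain c where c: "c \<in> carrier K" "c \<oplus> c = \<one>" using ex_half[OF char] by blast
      have "scalar c \<oplus>\<^bsub>A\<^esub> scalar c = \<one>\<^bsub>A\<^esub>" using c by (metis sc.hom.hom_add sc.hom.hom_one)
      thus ?thesis using c(1) by blast
    qed
    show "\<exists>d\<in>scalar ` carrier K. d \<otimes>\<^bsub>A\<^esub> d = c" if c: "c \<in> scalar ` carrier K" for c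
    proof -
      obtain l where l: "l \<in> carrier K" "c = scalar l" using c by blast
      obtain d where d: "d \<in> carrier K" "d \<otimes> d = l" using ex_sqrt[OF ac l(1)] by blast
      have "scalar d \<otimes>\<^bsub>A\<^esub> scalar d = c" unfolding l(2) using d by (metis sc.hom.hom_mult)
      thus ?thesis using d(1) by blast
    qed
  qed
qed

end

section \<open>The quotient by the graded Jacobson radical\<close>

text \<open>The multiplication of cosets is a union over representatives. If its values are cosets, then the product
  of \<open>J\<close> with the coset of \<open>a\<close> contains \<open>0\<close>, so it is \<open>J\<close>, and it contains \<open>x a\<close> for each \<open>x \<in> J\<close>.\<close>

lemma ring_quotient_module_imp_ideal:
  fixes A :: "('k, 'a, 'n) module_scheme"
  assumes "ring A" and J: "additive_subgroup J A"
    and left: "\<And>a x. \<lbrakk>a \<in> carrier A; x \<in> J\<rbrakk> \<Longrightarrow> a \<otimes>\<^bsub>A\<^esub> x \<in> J"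
    and quot: "ring (quotient_module A J)"
  shows "ideal J A"
proof (rule idealI[OF assms(1)])
  interpret A: ring A by fact
  interpret J: abelian_subgroup J A
    using J A.abelian_group_axioms by (intro abelian_subgroupI3)
  interpret Q: ring "quotient_module A J" by fact
  show "subgroup J (add_monoid A)" using J.a_subgroup .
  show "a \<otimes>\<^bsub>A\<^esub> x \<in> J" if "x \<in> J" "a \<in> carrier A" for x a using left that by simp
  show "x \<otimes>\<^bsub>A\<^esub> a \<in> J" if x: "x \<in> J" and a: "a \<in> carrier A" for x a
  proof -
    have xc: "x \<in> carrier A" "x \<otimes>\<^bsub>A\<^esub> a \<in> carrier A" using x a by auto
    let ?C = "rcoset_mult A J J (J +>\<^bsub>A\<^esub> a)"
    have "J \<in> carrier (quotient_module A J)" using Q.zero_closed by (simp add: quotient_module_def)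
    moreover have "J +>\<^bsub>A\<^esub> a \<in> carrier (quotient_module A J)"
      using A.a_rcosetsI[OF J.a_subset a] by (simp add: quotient_module_def)
    ultimately have "?C \<in> a_rcosets\<^bsub>A\<^esub> J"
      using Q.m_closed by (simp add: quotient_module_def)
    then obtain y where y: "y \<in> carrier A" "?C = J +>\<^bsub>A\<^esub> y" unfolding A_RCOSETS_def' by blast
    have sub: "J +>\<^bsub>A\<^esub> (u \<otimes>\<^bsub>A\<^esub> a) \<subseteq> ?C" if "u \<in> J" for u
      using that J.a_rcos_self[OF a] unfolding rcoset_mult_def by blast
    have "\<zero>\<^bsub>A\<^esub> \<in> J +>\<^bsub>A\<^esub> (\<zero>\<^bsub>A\<^esub> \<otimes>\<^bsub>A\<^esub> a)" using a J.a_rcos_self by simp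
    hence "\<zero>\<^bsub>A\<^esub> \<in> J +>\<^bsub>A\<^esub> y" using sub[OF J.zero_closed] y(2) by blast
    hence "J +>\<^bsub>A\<^esub> y = J +>\<^bsub>A\<^esub> \<zero>\<^bsub>A\<^esub>" using J.a_repr_independence' y(1) by simp
    moreover have "x \<otimes>\<^bsub>A\<^esub> a \<in> J +>\<^bsub>A\<^esub> (x \<otimes>\<^bsub>A\<^esub> a)" using xc J.a_rcos_self by simp
    ultimately show ?thesis using sub[OF x] y(2) J.a_rcos_const[OF J.zero_closed] by auto
  qed
qed

text \<open>The ring operations of \<^const>\<open>quotient_module\<close> are those of \<^const>\<open>FactRing\<close>. The records have
  different types, so the ring axioms are transferred one by one.\<close>

lemma quotient_module_ring_hom:
  fixes A :: "('k, 'a, 'n) module_scheme"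
  assumes "ideal J A"
  shows "ring_hom_ring A (quotient_module A J) (a_r_coset A J)"
    and "\<And>x. x \<in> carrier A \<Longrightarrow> J +>\<^bsub>A\<^esub> x = \<zero>\<^bsub>quotient_module A J\<^esub> \<longleftrightarrow> x \<in> J"
proof -
  interpret ideal J A by fact
  let ?B = "quotient_module A J"
  have sel: "carrier ?B = carrier (A Quot J)" "monoid.mult ?B = monoid.mult (A Quot J)" "one ?B = one (A Quot J)"
    "ring.zero ?B = ring.zero (A Quot J)" "add ?B = add (A Quot J)"
    by (simp_all add: quotient_module_def FactRing_def)
  interpret Q: ring "A Quot J" by (rule quotient_is_ring)
  have "ring ?B"
  proof (rule ringI)
    show "abelian_group ?B"
    proof (rule abelian_groupI)
      show "\<exists>y\<in>carrier ?B. y \<oplus>\<^bsub>?B\<^esub> x = \<zero>\<^bsub>?B\<^esub>" if "x \<in> carrier ?B" for x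
        using that Q.l_neg[of x] Q.a_inv_closed[of x] unfolding sel by blast
    qed (simp_all add: sel Q.a_ac)
    show "Group.monoid ?B" by (rule monoidI) (simp_all add: sel Q.m_assoc)
  qed (simp_all add: sel Q.l_distr Q.r_distr)
  moreover have "a_r_coset A J \<in> ring_hom A ?B"
    using rcos_ring_hom unfolding ring_hom_def sel .
  ultimately show "ring_hom_ring A ?B (a_r_coset A J)" using ring_axioms by (intro ring_hom_ringI2)
  show "J +>\<^bsub>A\<^esub> x = \<zero>\<^bsub>?B\<^esub> \<longleftrightarrow> x \<in> J" if "x \<in> carrier A" for x
    using a_rcos_self[OF that] a_rcos_const by (auto simp: quotient_module_def)
qed

text \<open>The units of the summands form a complete system of orthogonal idempotents: distinct summands meet
  trivially because decompositions are unique, hence annihilate each other, and multiplying the decomposition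
  of \<open>1\<close> by \<open>e\<^sub>i\<close> shows that its component in the summand \<open>i\<close> is \<open>e\<^sub>i\<close>.\<close>

lemma sum_of_gr_division_blocks:
  assumes sum: "sum_of_gr_division K B H" and "ring B"
  obtains n :: nat and I e where
    "\<And>i. i < n \<Longrightarrow> ideal (I i) B" "\<And>i. i < n \<Longrightarrow> e i \<in> I i \<inter> H 0"
    "\<And>i y. \<lbrakk>i < n; y \<in> I i\<rbrakk> \<Longrightarrow> e i \<otimes>\<^bsub>B\<^esub> y = y" "\<And>i y. \<lbrakk>i < n; y \<in> I i\<rbrakk> \<Longrightarrow> y \<otimes>\<^bsub>B\<^esub> e i = y"
    "\<And>i g x. \<lbrakk>i < n; x \<in> H g \<inter> I i; x \<noteq> \<zero>\<^bsub>B\<^esub>\<rbrakk> \<Longrightarrow> \<exists>y\<in>I i. y \<otimes>\<^bsub>B\<^esub> x = e i"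
    "\<And>i j. \<lbrakk>i < n; j < n\<rbrakk> \<Longrightarrow> e i \<otimes>\<^bsub>B\<^esub> e j = (if i = j then e i else \<zero>\<^bsub>B\<^esub>)"
    "(\<Oplus>\<^bsub>B\<^esub>i\<in>{..<n}. e i) = \<one>\<^bsub>B\<^esub>"
proof -
  interpret B: ring B by fact
  obtain n :: nat and I e where
    blocks: "\<forall>i<n. ideal (I i) B \<and> gr_division K (B\<lparr>carrier := I i, one := e i\<rparr>) (\<lambda>g. H g \<inter> I i)"
    and decomp: "\<forall>x\<in>carrier B. \<exists>!y. y \<in> (\<Pi>\<^sub>E i\<in>{..<n}. I i) \<and> x = (\<Oplus>\<^bsub>B\<^esub>i\<in>{..<n}. y i)"
    using sum unfolding sum_of_gr_division_def by (elim exE conjE) (rule that)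
  have id: "ideal (I i) B" if "i < n" for i using blocks that by blast
  have sup: "superalgebra K (B\<lparr>carrier := I i, one := e i\<rparr>) (\<lambda>g. H g \<inter> I i)" if "i < n" for i
    using blocks that unfolding gr_division_def by blast
  have IC: "I i \<subseteq> carrier B" if "i < n" for i
    using ideal.axioms(1)[OF id[OF that]] by (rule additive_subgroup.a_subset)
  have e: "e i \<in> I i \<inter> H 0" if "i < n" for i
    using graded_ring.one_even[OF superalgebra.graded_ring[OF sup[OF that]]] by auto
  have unit: "e i \<otimes>\<^bsub>B\<^esub> y = y" "y \<otimes>\<^bsub>B\<^esub> e i = y" if "i < n" "y \<in> I i" for i y
  proof -
    interpret D: graded_ring "B\<lparr>carrier := I i, one := e i\<rparr>" "\<lambda>g. H g \<inter> I i"
      using superalgebra.graded_ring[OF sup[OF that(1)]] .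
    show "e i \<otimes>\<^bsub>B\<^esub> y = y" "y \<otimes>\<^bsub>B\<^esub> e i = y" using D.l_one[of y] D.r_one[of y] that(2) by simp_all
  qed
  have div: "\<exists>y\<in>I i. y \<otimes>\<^bsub>B\<^esub> x = e i" if "i < n" "x \<in> H g \<inter> I i" "x \<noteq> \<zero>\<^bsub>B\<^esub>" for i g x
  proof -
    have "x \<in> Units (B\<lparr>carrier := I i, one := e i\<rparr>)"
      using blocks that unfolding gr_division_def by auto
    thus ?thesis unfolding Units_def by auto
  qed
  have disjoint: "x = \<zero>\<^bsub>B\<^esub>" if ij: "i < n" "j < n" "i \<noteq> j" and x: "x \<in> I i" "x \<in> I j" for i j x
  proof -
    define y where "y k = (\<lambda>l\<in>{..<n}. if k = l then x else \<zero>\<^bsub>B\<^esub>)" for k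
    have z: "\<zero>\<^bsub>B\<^esub> \<in> I l" if "l < n" for l
      using additive_subgroup.zero_closed[OF ideal.axioms(1)[OF id[OF that]]] .
    have xc: "x \<in> carrier B" using x ij IC by blast
    have y: "y k \<in> (\<Pi>\<^sub>E i\<in>{..<n}. I i) \<and> x = (\<Oplus>\<^bsub>B\<^esub>i\<in>{..<n}. y k i)" if k: "k < n" "x \<in> I k" for k
    proof
      show "y k \<in> (\<Pi>\<^sub>E i\<in>{..<n}. I i)" unfolding y_def using z k by auto
      have "(\<Oplus>\<^bsub>B\<^esub>i\<in>{..<n}. y k i) = (\<Oplus>\<^bsub>B\<^esub>i\<in>{..<n}. if k = i then x else \<zero>\<^bsub>B\<^esub>)"
        unfolding y_def using xc by (intro B.finsum_cong') auto
      also have "\<dots> = x" using k xc by (intro B.finsum_singleton) auto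
      finally show "x = (\<Oplus>\<^bsub>B\<^esub>i\<in>{..<n}. y k i)" by simp
    qed
    have "y i = y j" using decomp xc y[OF ij(1) x(1)] y[OF ij(2) x(2)] by metis
    hence "y i i = y j i" by simp
    thus ?thesis unfolding y_def using ij by simp
  qed
  have orth: "y \<otimes>\<^bsub>B\<^esub> z = \<zero>\<^bsub>B\<^esub>" if "i < n" "j < n" "i \<noteq> j" "y \<in> I i" "z \<in> I j" for i j y z
  proof (rule disjoint[OF that(1-3)])
    show "y \<otimes>\<^bsub>B\<^esub> z \<in> I i" using ideal.I_r_closed[OF id[OF that(1)] that(4)] IC that by blast
    show "y \<otimes>\<^bsub>B\<^esub> z \<in> I j" using ideal.I_l_closed[OF id[OF that(2)] that(5)] IC that by blast
  qed
  have ee: "e i \<otimes>\<^bsub>B\<^esub> e j = (if i = j then e i else \<zero>\<^bsub>B\<^esub>)" if "i < n" "j < n" for i j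
    using unit(1)[OF that(1), of "e i"] orth[OF that] e that by auto
  obtain y where y: "y \<in> (\<Pi>\<^sub>E i\<in>{..<n}. I i)" "\<one>\<^bsub>B\<^esub> = (\<Oplus>\<^bsub>B\<^esub>i\<in>{..<n}. y i)"
    using decomp B.one_closed by blast
  have yI: "y i \<in> I i" if "i < n" for i using y(1) that by auto
  have yc: "y \<in> {..<n} \<rightarrow> carrier B" using yI IC by auto
  have "y i = e i" if i: "i < n" for i
  proof -
    have ec: "e i \<in> carrier B" using e[OF i] IC[OF i] by blast
    have "e i = e i \<otimes>\<^bsub>B\<^esub> (\<Oplus>\<^bsub>B\<^esub>j\<in>{..<n}. y j)" unfolding y(2)[symmetric] using ec by simp
    also have "\<dots> = (\<Oplus>\<^bsub>B\<^esub>j\<in>{..<n}. e i \<otimes>\<^bsub>B\<^esub> y j)" using ec yc by (intro B.finsum_rdistr) auto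
    also have "\<dots> = (\<Oplus>\<^bsub>B\<^esub>j\<in>{..<n}. if i = j then y j else \<zero>\<^bsub>B\<^esub>)"
    proof (intro B.finsum_cong')
      show "(\<lambda>j. if i = j then y j else \<zero>\<^bsub>B\<^esub>) \<in> {..<n} \<rightarrow> carrier B" using yc by auto
      show "e i \<otimes>\<^bsub>B\<^esub> y j = (if i = j then y j else \<zero>\<^bsub>B\<^esub>)" if "j \<in> {..<n}" for j
        using that i unit(1)[OF i, of "y j"] orth[OF i, of j "e i" "y j"] e[OF i] yI[of j] by auto
    qed simp
    also have "\<dots> = y i" using i yc by (intro B.finsum_singleton) auto
    finally show ?thesis by simp
  qed
  hence "(\<Oplus>\<^bsub>B\<^esub>i\<in>{..<n}. e i) = (\<Oplus>\<^bsub>B\<^esub>i\<in>{..<n}. y i)"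
    using yc by (intro B.finsum_cong') auto
  hence "(\<Oplus>\<^bsub>B\<^esub>i\<in>{..<n}. e i) = \<one>\<^bsub>B\<^esub>" using y(2) by simp
  thus thesis using that[of n I e] id e unit div ee by blast
qed

text \<open>By definition the radical is a left ideal. If the quotient has at least one summand, that summand being
  an ideal includes that the quotient is a ring, and the previous criterion applies. If there is no summand, the
  quotient is trivial; then \<open>-1\<close> lies in the radical, and the left invertibility of \<open>1 + (-1)\<close> shows
  that the algebra is zero.\<close>

lemma gr_jacobson_ideal:
  fixes A :: "('k, 'a, 'n) module_scheme"
  assumes "superalgebra K A G" and basic: "gr_basic K A G"
  shows "ideal (gr_jacobson A G) A"
proof -
  interpret superalgebra K A G by fact
  interpret gr: graded_ring A G by (rule graded_ring)
  let ?J = "gr_jacobson A G" and ?B = "quotient_module A (gr_jacobson A G)"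
  note J = gr.graded_left_idealD[OF gr.gr_jacobson_graded_left_ideal]
  interpret J: abelian_subgroup ?J A
    using J(1) M.abelian_group_axioms by (intro abelian_subgroupI3)
  obtain n :: nat and I e where
    blocks: "\<forall>i<n. ideal (I i) ?B \<and> gr_division K (?B\<lparr>carrier := I i, one := e i\<rparr>)
      (\<lambda>g. quotient_grading A G ?J g \<inter> I i)"
    and decomp: "\<forall>x\<in>carrier ?B. \<exists>!y. y \<in> (\<Pi>\<^sub>E i\<in>{..<n}. I i) \<and> x = (\<Oplus>\<^bsub>?B\<^esub>i\<in>{..<n}. y i)"
    using basic unfolding gr_basic_def sum_of_gr_division_def by (elim exE conjE) (rule that)
  show ?thesis
  proof (cases "n = 0")
    case False
    hence "ideal (I 0) ?B" using blocks by simp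
    hence "ring ?B" by (rule ideal.axioms(2))
    thus ?thesis
      using ring_quotient_module_imp_ideal[OF A.ring_axioms J(1) J(5)] by blast
  next
    case True
    have "x = (\<Oplus>\<^bsub>?B\<^esub>i\<in>({}::nat set). undefined)" if x: "x \<in> carrier ?B" for x
    proof -
      obtain y where "y \<in> (\<Pi>\<^sub>E i\<in>{}. I i)" "x = (\<Oplus>\<^bsub>?B\<^esub>i\<in>{}. y i)"
        using decomp x unfolding True by auto
      thus ?thesis by (simp add: PiE_empty_domain)
    qed
    moreover have "?J +>\<^bsub>A\<^esub> \<one>\<^bsub>A\<^esub> \<in> carrier ?B" "?J +>\<^bsub>A\<^esub> \<zero>\<^bsub>A\<^esub> \<in> carrier ?B"
      using M.a_rcosetsI[OF J(2)] by (simp_all add: quotient_module_def)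
    ultimately have "?J +>\<^bsub>A\<^esub> \<one>\<^bsub>A\<^esub> = ?J"
      using J.a_rcos_const[OF J(3)] by metis
    hence "\<one>\<^bsub>A\<^esub> \<in> ?J" using J.a_rcos_self[OF A.one_closed] by simp
    hence "\<ominus>\<^bsub>A\<^esub> \<one>\<^bsub>A\<^esub> \<in> ?J" "\<ominus>\<^bsub>A\<^esub> \<one>\<^bsub>A\<^esub> \<in> G 0" using J(6) gr.one_even gr.component_neg by auto
    then obtain z where z: "z \<in> carrier A" "z \<otimes>\<^bsub>A\<^esub> (\<one>\<^bsub>A\<^esub> \<oplus>\<^bsub>A\<^esub> \<ominus>\<^bsub>A\<^esub> \<one>\<^bsub>A\<^esub>) = \<one>\<^bsub>A\<^esub>"
      using gr.even_gr_jacobson_left_inverse by blast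
    hence "\<one>\<^bsub>A\<^esub> = \<zero>\<^bsub>A\<^esub>" by (simp add: M.r_neg)
    hence "carrier A = {\<zero>\<^bsub>A\<^esub>}" using A.one_zeroD by simp
    hence "?J = carrier A" using J(2,3) by auto
    thus ?thesis using A.oneideal by simp
  qed
qed

theorem theorem4p2:
  fixes K :: "'k ring"
    and A :: "('k, 'a) module"
    and G :: "bit \<Rightarrow> 'a set"
  assumes "algebraically_closed K"
    and "ring_char K \<noteq> 2"
    and "superalgebra K A G"
    and "finite_dim K A"
    and "gr_basic K A G"
  shows "\<exists>S. sub_superalgebra K A G S \<and> super_direct_sum K A G S (gr_jacobson A G)"
proof -
  interpret superalgebra K A G by fact
  interpret sgr: scalar_graded_ring A G "scalar ` carrier K"
    using assms(1,2) by (rule scalar_graded_ring)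
  define J where "J = gr_jacobson A G"
  define B where "B = quotient_module A J"
  define \<pi> where "\<pi> = a_r_coset A J"
  note J = sgr.graded_left_idealD[OF sgr.gr_jacobson_graded_left_ideal, folded J_def]
  have idJ: "ideal J A" unfolding J_def using assms(3,5) by (rule gr_jacobson_ideal)
  note quot = quotient_module_ring_hom[OF idJ, folded B_def \<pi>_def]
  have ker: "\<pi> x = \<zero>\<^bsub>B\<^esub> \<longleftrightarrow> x \<in> J" if "x \<in> carrier A" for x
    using quot(2)[OF that] unfolding \<pi>_def .
  interpret hom: ring_hom_ring A B \<pi> by (rule quot(1))
  have ringB: "ring B" by (rule hom.S.ring_axioms)
  interpret ext: graded_nil_extension A G "scalar ` carrier K" B \<pi>
  proof (intro graded_nil_extension.intro graded_nil_extension_axioms.intro)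
    show "\<exists>m::nat. x [^]\<^bsub>A\<^esub> m = \<zero>\<^bsub>A\<^esub>" if "x \<in> G 0" "\<pi> x = \<zero>\<^bsub>B\<^esub>" for x
      using even_gr_jacobson_nilpotent[OF assms(1,4), folded J_def, of x] that ker by simp
    show "\<pi> x = \<zero>\<^bsub>B\<^esub>" if x: "x \<in> G 0" and y: "y \<in> G 1" and 0: "\<pi> (x \<oplus>\<^bsub>A\<^esub> y) = \<zero>\<^bsub>B\<^esub>" for x y
    proof -
      have "x \<oplus>\<^bsub>A\<^esub> y \<in> J" using iffD1[OF ker 0] x y by simp
      hence "x \<in> J"
        using sgr.graded_left_ideal_homogeneous_part(1)[OF sgr.gr_jacobson_graded_left_ideal x y]
        unfolding J_def by simp
      thus ?thesis using ker x by simp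
    qed
    show "\<exists>ls. set ls \<subseteq> scalar ` carrier K \<and>
        foldr (\<lambda>l y. (x \<ominus>\<^bsub>A\<^esub> l) \<otimes>\<^bsub>A\<^esub> y) ls \<one>\<^bsub>A\<^esub> = \<zero>\<^bsub>A\<^esub>" if x: "x \<in> G 0" for x
    proof -
      have "x \<in> carrier A" using x by simp
      then obtain ls where ls: "set ls \<subseteq> carrier K"
          "foldr (\<lambda>l y. (x \<ominus>\<^bsub>A\<^esub> scalar l) \<otimes>\<^bsub>A\<^esub> y) ls \<one>\<^bsub>A\<^esub> = \<zero>\<^bsub>A\<^esub>"
        using ex_scalar_product_zero[OF assms(1,4)] by blast
      thus ?thesis by (intro exI[of _ "map scalar ls"]) (auto simp: foldr_map comp_def)
    qed
  qed (rule sgr.scalar_graded_ring_axioms ringB quot(1))+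
  obtain n :: nat and I e where
    id: "\<And>i. i < n \<Longrightarrow> ideal (I i) B" and e: "\<And>i. i < n \<Longrightarrow> e i \<in> I i \<inter> quotient_grading A G J 0"
    and unit: "\<And>i y. \<lbrakk>i < n; y \<in> I i\<rbrakk> \<Longrightarrow> e i \<otimes>\<^bsub>B\<^esub> y = y" "\<And>i y. \<lbrakk>i < n; y \<in> I i\<rbrakk> \<Longrightarrow> y \<otimes>\<^bsub>B\<^esub> e i = y"
    and div: "\<And>i g x. \<lbrakk>i < n; x \<in> quotient_grading A G J g \<inter> I i; x \<noteq> \<zero>\<^bsub>B\<^esub>\<rbrakk> \<Longrightarrow> \<exists>y\<in>I i. y \<otimes>\<^bsub>B\<^esub> x = e i"
    and ee: "\<And>i j. \<lbrakk>i < n; j < n\<rbrakk> \<Longrightarrow> e i \<otimes>\<^bsub>B\<^esub> e j = (if i = j then e i else \<zero>\<^bsub>B\<^esub>)"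
    and sum: "(\<Oplus>\<^bsub>B\<^esub>i\<in>{..<n}. e i) = \<one>\<^bsub>B\<^esub>"
    using sum_of_gr_division_blocks[OF _ ringB, of K "quotient_grading A G J"] assms(5)
    unfolding gr_basic_def J_def[symmetric] B_def[symmetric] by blast
  \<comment> \<open>The unit of each summand is even, so it has an even representative.\<close>
  have "\<forall>i\<in>{..<n}. \<exists>a. a \<in> G 0 \<and> e i = \<pi> a"
    using e unfolding quotient_grading_def \<pi>_def by blast
  then obtain a where a: "\<forall>i\<in>{..<n}. a i \<in> G 0 \<and> e i = \<pi> (a i)"
    by (drule_tac bchoice) (elim exE, rule that)
  have "(\<Oplus>\<^bsub>B\<^esub>i\<in>{..<n}. \<pi> (a i)) = (\<Oplus>\<^bsub>B\<^esub>i\<in>{..<n}. e i)"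
    using a by (intro hom.S.finsum_cong') auto
  hence suma: "(\<Oplus>\<^bsub>B\<^esub>i\<in>{..<n}. \<pi> (a i)) = \<one>\<^bsub>B\<^esub>" using sum by simp
  obtain f where f: "\<And>i. i < n \<Longrightarrow> f i \<in> G 0" "\<And>i. i < n \<Longrightarrow> \<pi> (f i) = \<pi> (a i)"
    "\<And>i j. \<lbrakk>i < n; j < n\<rbrakk> \<Longrightarrow> f i \<otimes>\<^bsub>A\<^esub> f j = (if i = j then f i else \<zero>\<^bsub>A\<^esub>)"
    "(\<Oplus>\<^bsub>A\<^esub>i\<in>{..<n}. f i) = \<one>\<^bsub>A\<^esub>"
  proof (rule ext.lift_complete_orthogonal_idempotents[of n a])
    show "\<pi> (a i) \<otimes>\<^bsub>B\<^esub> \<pi> (a j) = (if i = j then \<pi> (a i) else \<zero>\<^bsub>B\<^esub>)" if "i < n" "j < n" for i j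
      using ee[OF that] a that by simp
  qed (use a suma in auto)
  have "\<exists>w\<in>G 1. f i \<otimes>\<^bsub>A\<^esub> w = w \<and> w \<otimes>\<^bsub>A\<^esub> f i = w \<and> (w \<otimes>\<^bsub>A\<^esub> w = f i \<or> w = \<zero>\<^bsub>A\<^esub>) \<and>
      (\<forall>x\<in>carrier A. \<exists>c\<in>scalar ` carrier K. \<exists>d\<in>scalar ` carrier K.
        \<pi> (f i \<otimes>\<^bsub>A\<^esub> x) = \<pi> (c \<otimes>\<^bsub>A\<^esub> f i \<oplus>\<^bsub>A\<^esub> d \<otimes>\<^bsub>A\<^esub> w))" if i: "i < n" for i
  proof (rule ext.lift_block)
    show "ideal (I i) B" by (rule id[OF i])
    show "e i \<in> I i" using e[OF i] by simp
    show "e i \<otimes>\<^bsub>B\<^esub> y = y" "y \<otimes>\<^bsub>B\<^esub> e i = y" if "y \<in> I i" for y using unit i that by auto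
    show "\<exists>y\<in>I i. y \<otimes>\<^bsub>B\<^esub> \<pi> x = e i" if "x \<in> G g" "\<pi> x \<in> I i" "\<pi> x \<noteq> \<zero>\<^bsub>B\<^esub>" for g x
      using div[OF i, of "\<pi> x" g] that unfolding quotient_grading_def \<pi>_def by simp
    show "f i \<in> G 0" "f i \<otimes>\<^bsub>A\<^esub> f i = f i" using f(1,3) i by auto
    show "\<pi> (f i) = e i" using f(2)[OF i] a i by simp
  qed
  hence "\<forall>i\<in>{..<n}. \<exists>w. w \<in> G 1 \<and> f i \<otimes>\<^bsub>A\<^esub> w = w \<and> w \<otimes>\<^bsub>A\<^esub> f i = w \<and> (w \<otimes>\<^bsub>A\<^esub> w = f i \<or> w = \<zero>\<^bsub>A\<^esub>) \<and>
      (\<forall>x\<in>carrier A. \<exists>c\<in>scalar ` carrier K. \<exists>d\<in>scalar ` carrier K.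
        \<pi> (f i \<otimes>\<^bsub>A\<^esub> x) = \<pi> (c \<otimes>\<^bsub>A\<^esub> f i \<oplus>\<^bsub>A\<^esub> d \<otimes>\<^bsub>A\<^esub> w))"
    unfolding Bex_def by simp
  then obtain w where w: "\<forall>i\<in>{..<n}. w i \<in> G 1 \<and> f i \<otimes>\<^bsub>A\<^esub> w i = w i \<and> w i \<otimes>\<^bsub>A\<^esub> f i = w i \<and>
      (w i \<otimes>\<^bsub>A\<^esub> w i = f i \<or> w i = \<zero>\<^bsub>A\<^esub>) \<and>
      (\<forall>x\<in>carrier A. \<exists>c\<in>scalar ` carrier K. \<exists>d\<in>scalar ` carrier K.
        \<pi> (f i \<otimes>\<^bsub>A\<^esub> x) = \<pi> (c \<otimes>\<^bsub>A\<^esub> f i \<oplus>\<^bsub>A\<^esub> d \<otimes>\<^bsub>A\<^esub> w i))"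
    by (drule_tac bchoice) (elim exE, rule that)
  have "\<exists>T. subring T A \<and> (\<forall>c\<in>scalar ` carrier K. \<forall>x\<in>T. c \<otimes>\<^bsub>A\<^esub> x \<in> T) \<and>
      (\<forall>x\<in>T. \<exists>y\<in>T \<inter> G 0. \<exists>z\<in>T \<inter> G 1. x = y \<oplus>\<^bsub>A\<^esub> z) \<and>
      (\<forall>x\<in>T. \<pi> x = \<zero>\<^bsub>B\<^esub> \<longrightarrow> x = \<zero>\<^bsub>A\<^esub>) \<and> (\<forall>x\<in>carrier A. \<exists>s\<in>T. \<pi> s = \<pi> x)"
  proof (rule ext.ex_graded_complement[of n f w])
    show "\<exists>c\<in>scalar ` carrier K. \<exists>d\<in>scalar ` carrier K.
        \<pi> (f i \<otimes>\<^bsub>A\<^esub> x) = \<pi> (c \<otimes>\<^bsub>A\<^esub> f i \<oplus>\<^bsub>A\<^esub> d \<otimes>\<^bsub>A\<^esub> w i)" if "i < n" "x \<in> carrier A" for i x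
      using w that by blast
  qed (use f w in simp_all)
  then obtain T where T: "subring T A" "\<forall>c\<in>scalar ` carrier K. \<forall>x\<in>T. c \<otimes>\<^bsub>A\<^esub> x \<in> T"
      "\<forall>x\<in>T. \<exists>y\<in>T \<inter> G 0. \<exists>z\<in>T \<inter> G 1. x = y \<oplus>\<^bsub>A\<^esub> z"
      "\<forall>x\<in>T. \<pi> x = \<zero>\<^bsub>B\<^esub> \<longrightarrow> x = \<zero>\<^bsub>A\<^esub>" "\<forall>x\<in>carrier A. \<exists>s\<in>T. \<pi> s = \<pi> x"
    by (elim exE conjE) (rule that)
  note Tsub = subringE[OF T(1)]
  have grT: "gr_submodule K A G T"
  proof (rule gr_submoduleI)
    show "c \<odot>\<^bsub>A\<^esub> x \<in> T" if "c \<in> carrier K" "x \<in> T" for c x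
    proof -
      have "scalar c \<otimes>\<^bsub>A\<^esub> x \<in> T" using T(2) that by blast
      thus ?thesis using scalar_mult(1)[of c x] that Tsub(1) by (simp add: subsetD)
    qed
  qed (use Tsub T(3) in auto)
  have grJ: "gr_submodule K A G J"
  proof (rule gr_submoduleI)
    show "c \<odot>\<^bsub>A\<^esub> x \<in> J" if "c \<in> carrier K" "x \<in> J" for c x
    proof -
      have "scalar c \<otimes>\<^bsub>A\<^esub> x \<in> J" using J(5)[of "scalar c" x] that by simp
      thus ?thesis using scalar_mult(1)[of c x] that J(2) by (simp add: subsetD)
    qed
  qed (use J in auto)
  have "carrier A = T <+>\<^bsub>A\<^esub> J"
  proof
    show "carrier A \<subseteq> T <+>\<^bsub>A\<^esub> J"
    proof
      fix x assume x: "x \<in> carrier A"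
      then obtain s where s: "s \<in> T" "\<pi> s = \<pi> x" using T(5) by blast
      have sc: "s \<in> carrier A" using s Tsub(1) by blast
      have "\<pi> (x \<ominus>\<^bsub>A\<^esub> s) = \<zero>\<^bsub>B\<^esub>" using x sc s(2) by (simp add: a_minus_def hom.S.r_neg)
      hence "x \<ominus>\<^bsub>A\<^esub> s \<in> J" using ker x sc by simp
      moreover have "x = s \<oplus>\<^bsub>A\<^esub> (x \<ominus>\<^bsub>A\<^esub> s)" using x sc by algebra
      ultimately show "x \<in> T <+>\<^bsub>A\<^esub> J" using s(1) unfolding set_add_def' by blast
    qed
    show "T <+>\<^bsub>A\<^esub> J \<subseteq> carrier A" using Tsub(1) J(2) unfolding set_add_def' by auto
  qed
  moreover have "T \<inter> J = {\<zero>\<^bsub>A\<^esub>}"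
  proof
    show "T \<inter> J \<subseteq> {\<zero>\<^bsub>A\<^esub>}"
    proof
      fix x assume x: "x \<in> T \<inter> J"
      hence "\<pi> x = \<zero>\<^bsub>B\<^esub>" using ker[of x] J(2) by blast
      thus "x \<in> {\<zero>\<^bsub>A\<^esub>}" using T(4) x by blast
    qed
  qed (use J(3) Tsub(2) in simp)
  ultimately have "direct_sum A (carrier A) T J" unfolding direct_sum_def by simp
  thus ?thesis
    using T(1) grT grJ unfolding sub_superalgebra_def super_direct_sum_def J_def by blast
qed

end
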